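(* Let $d\ge 1$, let $T\colon[0,1]^d\to[0,1]^d$ be a piecewise expanding map, and let $\mu$ be a $T$-invariant Borel probability measure on $[0,1]^d$ that is absolutely continuous with respect to Lebesgue measure $\mathcal L^d$. Suppose that $\mu$ is exponential mixing and that the density $h$ of $\mu$ belongs to $L^q(\mathcal L^d)$ for some $q>1$. Let $\{\mathbf r_n\}_{n\ge1}$ be a sequence of vectors $\mathbf r_n=(r_{n,1},\dots,r_{n,d})\in(\mathbb R_{\ge 0})^d$ with $\lim_{n\to\infty}|\mathbf r_n|=0$, and let $$\mathcal R(\{\mathbf r_n\})=\bigcap_{N=1}^\infty\bigcup_{n\ge N}\{\mathbf x\in[0,1]^d: T^n\mathbf x\in R(\mathbf x,\mathbf r_n)\}.$$ Then $$\mu(\mathcal R(\{\mathbf r_n\}))=\begin{cases}0&\text{if }\sum_{n=1}^\infty r_{n,1}\cdots r_{n,d}<\infty,\\ 1&\text{if }\sum_{n=1}^\infty r_{n,1}\cdots r_{n,d}=\infty.\end{cases}$$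
   Context: Notation: $|\cdot|$ is the maximum norm on $\mathbb R^d$. For $\mathbf x\in[0,1]^d$ and $\mathbf r\in(\mathbb R_{\ge0})^d$, $R(\mathbf x,\mathbf r)=\prod_{i=1}^d B(x_i,r_i)$ with $B(x_i,r_i)=\{y\in\mathbb R:|y-x_i|<r_i\}$. For $A\subset\mathbb R^d$, $A(\epsilon)$ is its $\epsilon$-neighbourhood, and the upper Minkowski content is $M^{*(d-1)}(A)=\limsup_{\epsilon\to0^+}\mathcal L^d(A(\epsilon))/\epsilon$. Piecewise expanding map: $T\colon[0,1]^d\to[0,1]^d$ is piecewise expanding if there is a finite family $(U_i)_{i=1}^P$ of pairwise disjoint connected open subsets of $[0,1]^d$ with $\bigcup_{i=1}^P\overline{U_i}=[0,1]^d$ such that: (i) on each $U_i$ the map $T$ is injective and $T|_{U_i}$ can be extended to a $C^1$ map on $\overline{U_i}$; moreover there is a constant $L>1$ such that for every $i$ and every $\mathbf x\in U_i$ the differential $D_{\mathbf x}T$ satisfies $|(D_{\mathbf x}T)(\mathbf z)|\ge L|\mathbf z|$ for all $\mathbf z\in\mathbb R^d$; (ii) the boundary of each $U_i$ is included in a $C^1$ piecewise embedded compact submanifold of codimension one (in particular there is a constant $K$ with $\max_{1\le i\le P} M^{*(d-1)}(\partial U_i)\le K$). Exponential mixing: $\mu$ is exponential mixing if for any collection $\mathcal C$ of measurable subsets $F$ of $[0,1]^d$ satisfying $\sup_{F\in\mathcal C}M^{*(d-1)}(\partial F)<\infty$, there exist constants $c>0$ and $\tau>0$ such that for any $F,G\in\mathcal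 C$ and every $n\in\mathbb N$, $|\mu(F\cap T^{-n}G)-\mu(F)\mu(G)|\le c\,\mu(G)e^{-\tau n}$. *)

theory Defs
  imports "HOL-Probability.Probability"
begin

text \<open>
  Throughout, \<open>real^'n\<close> with \<open>d = CARD('n)\<close> plays the role of \<open>\<real>\<^sup>d\<close>; the maximum norm is \<^const>\<open>infnorm\<close>.
\<close>

definition unit_cube :: "(real^'n::finite) set" where
  "unit_cube = cbox 0 1"

definition cube_lebesgue :: "(real^'n::finite) measure" where
  "cube_lebesgue = restrict_space lborel unit_cube"

definition open_rectangle :: "real^'n::finite \<Rightarrow> real^'n \<Rightarrow> (real^'n) set" where
  "open_rectangle x r = {y. \<forall>i. \<bar>y $ i - x $ i\<bar> < r $ i}"

definition neighbourhood :: "(real^'n::finite) set \<Rightarrow> real \<Rightarrow> (real^'n) set" where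
  "neighbourhood A \<epsilon> = {x. \<exists>a\<in>A. infnorm (x - a) < \<epsilon>}"

definition upper_minkowski_content :: "(real^'n::finite) set \<Rightarrow> ennreal" where
  "upper_minkowski_content A =
     Limsup (at_right 0) (\<lambda>\<epsilon>. emeasure lborel (neighbourhood A \<epsilon>) / ennreal \<epsilon>)"

definition C1_on_open ::
    "('a::real_normed_vector) set \<Rightarrow> ('a \<Rightarrow> 'b::real_normed_vector) \<Rightarrow> bool" where
  "C1_on_open V f \<longleftrightarrow> open V \<and>
     (\<exists>f' :: 'a \<Rightarrow> 'a \<Rightarrow>\<^sub>L 'b.
        (\<forall>x\<in>V. (f has_derivative blinfun_apply (f' x)) (at x)) \<and> continuous_on V f')"

text \<open>
  A map on a closed set is \<open>C\<^sup>1\<close> if it is the restriction of a \<open>C\<^sup>1\<close> map on an open neighbourhood.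
\<close>

definition C1_extendable_to_closure ::
    "('a::real_normed_vector) set \<Rightarrow> ('a \<Rightarrow> 'b::real_normed_vector) \<Rightarrow> bool" where
  "C1_extendable_to_closure U f \<longleftrightarrow>
     (\<exists>V g. C1_on_open V g \<and> closure U \<subseteq> V \<and> (\<forall>x\<in>U. g x = f x))"

text \<open>
  A \<open>C\<^sup>1\<close> embedded compact cell of codimension one is the image of the compact
  \<open>(d-1)\<close>-dimensional cube under an injective \<open>C\<^sup>1\<close> immersion (by compactness an embedding).
  The domain \<open>[0,1]\<^sup>d\<^sup>-\<^sup>1\<close> is realised as a face \<open>y\<^sub>k = 0\<close> of \<open>[0,1]\<^sup>d\<close>;
  for \<open>d = 1\<close> the cells are the points.  Every compact embedded \<open>C\<^sup>1\<close>
  hypersurface, with or without boundary or corners, is a finite union of such cells.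
\<close>

definition C1_embedded_hypersurface_cell :: "(real^'n::finite) set \<Rightarrow> bool" where
  "C1_embedded_hypersurface_cell S \<longleftrightarrow>
     (\<exists>(k::'n) V (\<psi> :: real^'n \<Rightarrow> real^'n) (\<psi>' :: real^'n \<Rightarrow> (real^'n) \<Rightarrow>\<^sub>L (real^'n)).
        open V \<and> {y \<in> unit_cube. y $ k = 0} \<subseteq> V \<and>
        (\<forall>y\<in>V. (\<psi> has_derivative blinfun_apply (\<psi>' y)) (at y)) \<and> continuous_on V \<psi>' \<and>
        inj_on \<psi> {y \<in> unit_cube. y $ k = 0} \<and>
        (\<forall>y\<in>{y \<in> unit_cube. y $ k = 0}. inj_on (blinfun_apply (\<psi>' y)) {z. z $ k = 0}) \<and>
        S = \<psi> ` {y \<in> unit_cube. y $ k = 0})"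

definition piecewise_C1_compact_hypersurface :: "(real^'n::finite) set \<Rightarrow> bool" where
  "piecewise_C1_compact_hypersurface S \<longleftrightarrow>
     (\<exists>\<S>. finite \<S> \<and> (\<forall>M\<in>\<S>. C1_embedded_hypersurface_cell M) \<and> S = \<Union>\<S>)"

text \<open>
  The \<open>U i\<close> are open relative to the cube, so they may contain points of its boundary; the
  differential there is the derivative within \<open>U i\<close>, which is unique and agrees with the ordinary
  one at interior points.  The boundary of \<open>U i\<close> is taken in \<open>\<real>\<^sup>d\<close>; it differs from the relative
  boundary only by points of the faces of the cube.
\<close>

definition piecewise_expanding :: "(real^'n::finite \<Rightarrow> real^'n) \<Rightarrow> bool" where
  "piecewise_expanding T \<longleftrightarrow>
     T \<in> unit_cube \<rightarrow> unit_cube \<and>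
     (\<exists>(P::nat) U.
        disjoint_family_on U {1..P} \<and>
        (\<forall>i\<in>{1..P}. connected (U i) \<and> openin (top_of_set unit_cube) (U i)) \<and>
        (\<Union>i\<in>{1..P}. closure (U i)) = unit_cube \<and>
        (\<forall>i\<in>{1..P}. inj_on T (U i) \<and> C1_extendable_to_closure (U i) T) \<and>
        (\<exists>L>1. \<forall>i\<in>{1..P}. \<forall>x\<in>U i. \<exists>D. (T has_derivative D) (at x within U i) \<and>
           (\<forall>z. infnorm (D z) \<ge> L * infnorm z)) \<and>
        (\<forall>i\<in>{1..P}. \<exists>S. piecewise_C1_compact_hypersurface S \<and> frontier (U i) \<subseteq> S))"

definition invariant_measure :: "('a \<Rightarrow> 'a) \<Rightarrow> 'a measure \<Rightarrow> bool" where
  "invariant_measure T \<mu> \<longleftrightarrow> T \<in> measurable \<mu> \<mu> \<and> distr \<mu> \<mu> T = \<mu>"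

definition exponential_mixing ::
    "(real^'n::finite \<Rightarrow> real^'n) \<Rightarrow> (real^'n) measure \<Rightarrow> bool" where
  "exponential_mixing T \<mu> \<longleftrightarrow>
     (\<forall>\<C>. \<C> \<subseteq> sets \<mu> \<and> (SUP F\<in>\<C>. upper_minkowski_content (frontier F)) < \<infinity> \<longrightarrow>
        (\<exists>c>0. \<exists>\<tau>>0. \<forall>F\<in>\<C>. \<forall>G\<in>\<C>. \<forall>n::nat.
           \<bar>measure \<mu> (F \<inter> (T ^^ n) -` G) - measure \<mu> F * measure \<mu> G\<bar>
             \<le> c * measure \<mu> G * exp (- \<tau> * real n)))"

definition recurrence_set ::
    "(real^'n::finite \<Rightarrow> real^'n) \<Rightarrow> (nat \<Rightarrow> real^'n) \<Rightarrow> (real^'n) set" where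
  "recurrence_set T r =
     (\<Inter>N\<in>{1..}. \<Union>n\<in>{N..}. {x \<in> unit_cube. (T ^^ n) x \<in> open_rectangle x (r n)})"

end

theory Submission
  imports Defs
begin

text \<open>
  Let \<open>E\<^sub>n\<close> be the set of points \<open>x\<close> with \<open>T\<^sup>n x \<in> R(x, r\<^sub>n)\<close>, and cut the cube into dyadic tiles whose
  sides are the sides of \<open>r\<^sub>n\<close> up to a factor of two; let \<open>v\<^sub>n\<close> be the volume of these tiles. If \<open>x\<close> and
  \<open>T\<^sup>n x\<close> lie in one tile, then \<open>x \<in> E\<^sub>n\<close>; conversely, for \<open>x \<in> E\<^sub>n\<close> the tiles of \<open>x\<close> and of \<open>T\<^sup>n x\<close> are
  neighbours. Boxes have boundaries of bounded Minkowski content, so mixing gives the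
  measure of \<open>R \<inter> T\<^sup>-\<^sup>n R'\<close> as \<open>\<mu>(R) \<mu>(R')\<close> up to \<open>c e\<^sup>-\<^sup>\<tau>\<^sup>n \<mu>(R')\<close>, and \<open>\<mu>(E\<^sub>n)\<close> has the order of the sum of \<open>\<mu>(R)\<^sup>2\<close>
  over the tiles. This is comparable to \<open>v\<^sub>n\<close> once the tiles with \<open>\<mu>(R) > M v\<^sub>n\<close> are left out. As
  the density lies in \<open>L\<^sup>q\<close> only, the heavy tiles can dominate the sum, and each half of the
  theorem needs a way to discard them.

  If the volumes are summable, a point is discarded as soon as one dyadic rectangle around it,
  of any shape, is heavy. The discarded set has Lebesgue measure \<open>O(M\<^sup>-\<^sup>q)\<close> by the strong maximal
  theorem (\<open>strong_dyadic_maximal\<close>, obtained by iterating Doob's inequality over the coordinates,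
  and \<open>emeasure_heavy_le\<close>). Outside of it the Borel-Cantelli lemma applies, and \<open>M\<close> is arbitrary
  (\<open>recurrence_set_null\<close>).

  If the volumes are not summable, suppose that the set \<open>W\<close> of non-recurrent points has positive
  measure, and let \<open>V\<close> be a finite union of tiles close to \<open>W\<close>. Let \<open>A\<^sub>n\<close> be the union of \<open>R \<inter> T\<^sup>-\<^sup>n R\<close>
  over the light tiles \<open>R \<subseteq> V\<close>. The Cauchy-Schwarz inequality bounds \<open>\<mu>(A\<^sub>n)\<close> below by a multiple
  of \<open>v\<^sub>n\<close>, and the second moment method (\<open>limsup_second_moment\<close>) shows that infinitely many \<open>A\<^sub>n\<close>
  occur on a set of measure at least \<open>p\<close>, where \<open>p\<close> depends on \<open>\<mu>(W)\<close> but not on \<open>V\<close>. This set is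
  contained in \<open>V - W\<close>, which can be made smaller than \<open>p\<close>, a contradiction (\<open>recurrence_set_full\<close>).

  The second moment method requires \<open>\<mu>(A\<^sub>n \<inter> A\<^sub>m) \<le> K\<^sup>2 v\<^sub>n v\<^sub>m\<close> up to summable errors (\<open>self_return_pair\<close>).
  There are two cases, separated by a large constant \<open>D\<close>. If \<open>m < D n\<close>, mixing is used first at time
  \<open>n\<close> with the target \<open>R \<inter> T\<^sup>-\<^sup>(\<^sup>m\<^sup>-\<^sup>n\<^sup>) R'\<close>. This target can have a wild boundary, but the error term of the
  mixing estimate is proportional to the measure of the target, so that the estimate passes from
  boxes to all Borel sets (\<open>mixing_upper\<close>). If \<open>m \<ge> D n\<close>, the set \<open>A\<^sub>n\<close> is covered by cubes whose side
  is an exponentially small function of \<open>n\<close>; their number is negligible against \<open>e\<^sup>\<tau>\<^sup>m\<close>, so that each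
  of them may be used as a source set at time \<open>m\<close>. The points of these cubes outside \<open>A\<^sub>n\<close> come close
  to the boundary of a piece of \<open>T\<close> or of a tile before time \<open>n\<close> or at it, because \<open>T\<close> is Lipschitz on
  each piece; by invariance and by the thinness of those boundaries, their measure is exponentially
  small in \<open>n\<close> (\<open>measure_bad_set_le\<close>).
\<close>

section \<open>Dyadic tiles and half-open boxes\<close>

definition half_open_box :: "real^'n::finite \<Rightarrow> real^'n \<Rightarrow> (real^'n) set" where
  "half_open_box a b = {x \<in> unit_cube. \<forall>i. a $ i \<le> x $ i \<and> x $ i < b $ i}"

definition tile_index :: "('n::finite \<Rightarrow> nat) \<Rightarrow> real^'n \<Rightarrow> 'n \<Rightarrow> int" where
  "tile_index k x = (\<lambda>i. \<lfloor>2 ^ k i * x $ i\<rfloor>)"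

definition tile :: "('n::finite \<Rightarrow> nat) \<Rightarrow> ('n \<Rightarrow> int) \<Rightarrow> (real^'n) set" where
  "tile k z = {x \<in> unit_cube. tile_index k x = z}"

definition tile_indices :: "('n::finite \<Rightarrow> nat) \<Rightarrow> ('n \<Rightarrow> int) set" where
  "tile_indices k = (\<Pi>\<^sub>E i\<in>UNIV. {0..2 ^ k i})"

definition tile_volume :: "('n::finite \<Rightarrow> nat) \<Rightarrow> real" where
  "tile_volume k = (\<Prod>i\<in>UNIV. (1/2) ^ k i)"

lemma mem_unit_cube: "x \<in> unit_cube \<longleftrightarrow> (\<forall>i. 0 \<le> x $ i \<and> x $ i \<le> 1)"
  by (simp add: unit_cube_def mem_box_cart)

lemma half_open_box_Int:
  "half_open_box a b \<inter> half_open_box a' b' =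
    half_open_box (\<chi> i. max (a $ i) (a' $ i)) (\<chi> i. min (b $ i) (b' $ i))"
  unfolding half_open_box_def by auto

lemma tile_eq_half_open_box:
  "tile k z = half_open_box (\<chi> i. of_int (z i) / 2 ^ k i) (\<chi> i. (of_int (z i) + 1) / 2 ^ k i)"
  unfolding tile_def tile_index_def half_open_box_def
  by (auto simp: fun_eq_iff floor_eq_iff field_simps)

lemma mem_tile_iff: "x \<in> tile k z \<longleftrightarrow> x \<in> unit_cube \<and> tile_index k x = z"
  by (simp add: tile_def)

lemma tile_subset_unit_cube: "tile k z \<subseteq> unit_cube"
  by (auto simp: tile_def)

lemma disjoint_family_tile: "disjoint_family_on (tile k) A"
  by (auto simp: disjoint_family_on_def tile_def)

lemma finite_tile_indices [simp, intro]: "finite (tile_indices k)"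
  by (simp add: tile_indices_def finite_PiE)

lemma tile_index_in_indices:
  assumes "x \<in> unit_cube"
  shows "tile_index k x \<in> tile_indices k"
proof -
  have "0 \<le> \<lfloor>2 ^ k i * x $ i\<rfloor> \<and> \<lfloor>2 ^ k i * x $ i\<rfloor> \<le> 2 ^ k i" for i
  proof -
    have x: "0 \<le> x $ i" "x $ i \<le> 1" using assms by (auto simp: mem_unit_cube)
    have "\<lfloor>2 ^ k i * x $ i\<rfloor> \<le> \<lfloor>(2::real) ^ k i\<rfloor>"
      by (rule floor_mono) (use x in \<open>simp add: mult_left_le\<close>)
    also have "\<dots> = 2 ^ k i"
      by (metis floor_of_int of_int_numeral of_int_power)
    finally show ?thesis using x by simp
  qed
  then show ?thesis by (auto simp: tile_indices_def tile_index_def)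
qed

lemma tile_volume_pos: "0 < tile_volume k"
  by (auto simp: tile_volume_def intro!: prod_pos)

lemma tile_volume_le: "tile_volume k \<le> (1/2) ^ k i"
proof -
  have "tile_volume k = (1/2) ^ k i * (\<Prod>j\<in>UNIV - {i}. (1/2) ^ k j)"
    unfolding tile_volume_def by (subst prod.remove[of UNIV i]) auto
  also have "\<dots> \<le> (1/2) ^ k i * 1"
    by (intro mult_left_mono prod_le_1) (auto simp: power_le_one)
  finally show ?thesis by simp
qed

lemma tile_volume_const: "tile_volume (\<lambda>_::'n::finite. N) = (1/2) ^ (N * CARD('n))"
  by (simp add: tile_volume_def power_mult)

lemma card_tile_indices: 
  fixes k :: "'n::finite \<Rightarrow> nat"
  shows "real (card (tile_indices k)) \<le> 2 ^ CARD('n) / tile_volume k"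
proof -
  have "real (card (tile_indices k)) = (\<Prod>i\<in>UNIV. (2::real) ^ k i + 1)"
  proof -
    have "real (card {0..(2::int) ^ m}) = 2 ^ m + 1" for m
      by simp
    then show ?thesis by (simp add: tile_indices_def card_PiE del: card_atLeastAtMost_int)
  qed
  also have "\<dots> \<le> (\<Prod>i\<in>(UNIV::'n set). 2 * 2 ^ k i)"
    by (intro prod_mono) auto
  also have "\<dots> = 2 ^ CARD('n) / tile_volume k"
    by (simp add: tile_volume_def prod.distrib power_one_over prod_dividef field_simps)
  finally show ?thesis .
qed

lemma emeasure_lborel_cbox_cart:
  fixes a b :: "real^'n::finite"
  assumes "\<And>i. a $ i \<le> b $ i"
  shows "emeasure lborel (cbox a b) = ennreal (\<Prod>i\<in>UNIV. b $ i - a $ i)"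
proof -
  have "emeasure lborel (cbox a b) = ennreal (\<Prod>j\<in>Basis. (b - a) \<bullet> j)"
    using assms by (subst emeasure_lborel_cbox) (auto simp: Basis_vec_def inner_axis)
  also have "(\<Prod>j\<in>Basis. (b - a) \<bullet> j) = (\<Prod>i\<in>UNIV. b $ i - a $ i)"
  proof -
    have B: "(Basis::(real^'n) set) = (\<lambda>i. axis i 1) ` UNIV" by (auto simp: Basis_vec_def)
    have "inj (\<lambda>i::'n. axis i (1::real))" by (auto simp: inj_on_def axis_eq_axis)
    then show ?thesis unfolding B by (subst prod.reindex) (auto simp: inner_axis)
  qed
  finally show ?thesis .
qed

lemma unit_cube_borel [measurable]: "unit_cube \<in> sets borel"
  by (simp add: unit_cube_def)

lemma half_open_box_subset_unit_cube: "half_open_box a b \<subseteq> unit_cube"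
  by (auto simp: half_open_box_def)

lemma half_open_box_borel [measurable]: "half_open_box a b \<in> sets borel"
proof -
  have "half_open_box a b = unit_cube \<inter> (\<Inter>i. {x. a $ i \<le> x $ i} \<inter> {x. x $ i < b $ i})"
    by (auto simp: half_open_box_def)
  also have "\<dots> \<in> sets borel"
    unfolding unit_cube_def
    by (intro sets.Int sets.countable_INT' ) auto
  finally show ?thesis .
qed

lemma tile_borel [measurable]: "tile k z \<in> sets borel"
  by (simp add: tile_eq_half_open_box)

lemma emeasure_tile_le: "emeasure lborel (tile k z) \<le> ennreal (tile_volume k)"
proof -
  let ?a = "(\<chi> i. of_int (z i) / 2 ^ k i) :: real^'a" and ?b = "(\<chi> i. (of_int (z i) + 1) / 2 ^ k i) :: real^'a"
  have "emeasure lborel (tile k z) \<le> emeasure lborel (cbox ?a ?b)"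
    by (intro emeasure_mono) (auto simp: tile_eq_half_open_box half_open_box_def mem_box_cart less_imp_le)
  also have "\<dots> = ennreal (\<Prod>i\<in>UNIV. ?b $ i - ?a $ i)"
    by (rule emeasure_lborel_cbox_cart) (auto simp: divide_right_mono)
  also have "(\<Prod>i\<in>UNIV. ?b $ i - ?a $ i) = tile_volume k"
    by (simp add: tile_volume_def diff_divide_distrib[symmetric] power_one_over)
  finally show ?thesis .
qed

lemma dist_tile_le:
  fixes x y :: "real^'n::finite"
  assumes "x \<in> tile (\<lambda>_. N) z" "y \<in> tile (\<lambda>_. N) z"
  shows "dist x y \<le> real CARD('n) * (1/2) ^ N"
proof -
  have "\<bar>(x - y) $ i\<bar> \<le> (1/2) ^ N" for i
  proof -
    have "of_int (z i) / 2 ^ N \<le> x $ i" "x $ i < (of_int (z i) + 1) / 2 ^ N"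
      "of_int (z i) / 2 ^ N \<le> y $ i" "y $ i < (of_int (z i) + 1) / 2 ^ N"
      using assms by (auto simp: tile_eq_half_open_box half_open_box_def)
    then show ?thesis by (auto simp: add_divide_distrib power_one_over abs_le_iff)
  qed
  then have "norm (x - y) \<le> (\<Sum>i\<in>(UNIV::'n set). (1/2) ^ N)"
    by (intro order_trans[OF norm_le_l1_cart sum_mono]) auto
  then show ?thesis by (simp add: dist_norm)
qed

text \<open>
  The bounds \<open>-1\<close> and \<open>2\<close> leave room for neighbourhoods of subsets of the cube of radius at most one.
\<close>

definition slab :: "'n::finite \<Rightarrow> real \<Rightarrow> real \<Rightarrow> (real^'n) set" where
  "slab i c \<delta> = {x. \<bar>x $ i - c\<bar> \<le> \<delta> \<and> (\<forall>j. -1 \<le> x $ j \<and> x $ j \<le> 2)}"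

lemma slab_borel [measurable, simp]: "slab i c \<delta> \<in> sets borel"
proof -
  have "slab i c \<delta> = {x. \<bar>x $ i - c\<bar> \<le> \<delta>} \<inter> cbox (\<chi> j. -1) (\<chi> j. 2)"
    by (auto simp: slab_def mem_box_cart)
  also have "\<dots> \<in> sets borel"
    by (intro sets.Int borel_closed closed_Collect_le continuous_intros closed_cbox)
  finally show ?thesis .
qed

lemma unit_cube_imp_slab:
  assumes "x \<in> unit_cube" "\<bar>x $ i - c\<bar> \<le> \<delta>"
  shows "x \<in> slab i c \<delta>"
  using assms by (auto simp: slab_def mem_unit_cube intro: order_trans[of _ 0] order_trans[of _ 1])

lemma emeasure_slab_le:
  fixes i :: "'n::finite"
  assumes "0 \<le> \<delta>"
  shows "emeasure lborel (slab i a \<delta>) \<le> ennreal (2 * \<delta> * 3 ^ CARD('n))"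
proof -
  let ?a = "\<chi> j. if j = i then a - \<delta> else -1" and ?b = "\<chi> j. if j = i then a + \<delta> else 2"
  have "slab i a \<delta> \<subseteq> cbox ?a ?b"
    by (auto simp: slab_def mem_box_cart abs_le_iff)
  then have "emeasure lborel (slab i a \<delta>) \<le> emeasure lborel (cbox ?a ?b)"
    by (intro emeasure_mono) auto
  also have "\<dots> = ennreal (\<Prod>j\<in>UNIV. ?b $ j - ?a $ j)"
    using assms by (intro emeasure_lborel_cbox_cart) auto
  also have "(\<Prod>j\<in>UNIV. ?b $ j - ?a $ j) = (2 * \<delta>) * (\<Prod>j\<in>UNIV-{i}. ?b $ j - ?a $ j)"
    by (subst prod.remove[of UNIV i]) auto
  also have "(\<Prod>j\<in>UNIV-{i}. ?b $ j - ?a $ j) = (\<Prod>j\<in>UNIV-{i}. 3)"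
    by (intro prod.cong) auto
  also have "(\<Prod>j\<in>UNIV-{i}. 3) \<le> (3::real) ^ CARD('n)"
    by (simp add: card_Diff_singleton)
  finally show ?thesis using assms by (simp add: ennreal_leI mult_left_mono)
qed

lemma frontier_half_open_box:
  assumes "x \<in> frontier (half_open_box a b)"
  shows "x \<in> unit_cube" "\<exists>i. x $ i \<in> {0, 1, a $ i, b $ i}"
proof -
  have cl: "closure (half_open_box a b) \<subseteq> {x. \<forall>i. 0 \<le> x $ i \<and> x $ i \<le> 1 \<and> a $ i \<le> x $ i \<and> x $ i \<le> b $ i}"
    (is "_ \<subseteq> ?K")
  proof (rule closure_minimal)
    show "half_open_box a b \<subseteq> ?K" by (auto simp: half_open_box_def mem_unit_cube less_imp_le)
    have "?K = (\<Inter>i. {x. 0 \<le> x $ i} \<inter> {x. x $ i \<le> 1} \<inter> {x. a $ i \<le> x $ i} \<inter> {x. x $ i \<le> b $ i})"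
      by auto
    also have "closed \<dots>" 
      by (intro closed_INT ballI closed_Int closed_Collect_le continuous_intros)
    finally show "closed ?K" .
  qed
  have xK: "x \<in> ?K" using assms cl by (auto simp: frontier_def)
  then show "x \<in> unit_cube" by (simp add: mem_unit_cube)
  show "\<exists>i. x $ i \<in> {0, 1, a $ i, b $ i}"
  proof (rule ccontr)
    assume "\<not> ?thesis"
    then have ne: "\<And>i. x $ i \<noteq> 0 \<and> x $ i \<noteq> 1 \<and> x $ i \<noteq> a $ i \<and> x $ i \<noteq> b $ i" by blast
    let ?O = "\<Inter>i. {x. 0 < x $ i} \<inter> {x. x $ i < 1} \<inter> {x. a $ i < x $ i} \<inter> {x. x $ i < b $ i}"
    have "open ?O"
      by (intro open_INT ballI open_Int open_Collect_less continuous_intros) auto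
    moreover have "?O \<subseteq> half_open_box a b"
      by (auto simp: half_open_box_def mem_unit_cube less_imp_le)
    moreover have "x \<in> ?O"
    proof -
      have "0 < x $ i \<and> x $ i < 1 \<and> a $ i < x $ i \<and> x $ i < b $ i" for i
        using xK ne[of i] by (auto simp: less_le)
      then show ?thesis by simp
    qed
    ultimately have "x \<in> interior (half_open_box a b)" by (meson interiorI)
    then show False using assms by (simp add: frontier_def)
  qed
qed

text \<open>
  The frontier lies in the at most \<open>4 d\<close> hyperplane pieces given by the walls of the box and the
  faces of the cube, and an \<open>\<epsilon>\<close>-neighbourhood of each of them is a slab of volume \<open>O(\<epsilon>)\<close>. The bound
  does not depend on the box, hence all boxes together are an admissible class for mixing.
\<close>

lemma upper_minkowski_content_half_open_box:
  fixes a b :: "real^'n::finite"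
  shows "upper_minkowski_content (frontier (half_open_box a b)) \<le> ennreal (8 * real CARD('n) * 3 ^ CARD('n))"
  unfolding upper_minkowski_content_def
proof (rule Limsup_bounded)
  have "emeasure lborel (neighbourhood (frontier (half_open_box a b)) \<epsilon>) / ennreal \<epsilon>
      \<le> ennreal (8 * real CARD('n) * 3 ^ CARD('n))" if e: "0 < \<epsilon>" "\<epsilon> < 1" for \<epsilon>
  proof -
    let ?S = "\<lambda>i c. slab i c \<epsilon>"
    define D where "D = (SIGMA i:UNIV. {0, 1, a $ i, b $ i})"
    have sub: "neighbourhood (frontier (half_open_box a b)) \<epsilon> \<subseteq> (\<Union>p\<in>D. ?S (fst p) (snd p))"
    proof
      fix x assume "x \<in> neighbourhood (frontier (half_open_box a b)) \<epsilon>"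
      then obtain y where y: "y \<in> frontier (half_open_box a b)" and xy: "infnorm (x - y) < \<epsilon>"
        by (auto simp: neighbourhood_def)
      have d: "\<bar>x $ j - y $ j\<bar> \<le> \<epsilon>" for j
        using component_le_infnorm_cart[of "x - y" j] xy by simp
      obtain i where i: "y $ i \<in> {0, 1, a $ i, b $ i}" using frontier_half_open_box[OF y] by blast
      have "-1 \<le> x $ j \<and> x $ j \<le> 2" for j
        using d[of j] frontier_half_open_box(1)[OF y] e by (auto simp: mem_unit_cube abs_le_iff) (smt (verit))+
      then have "x \<in> ?S i (y $ i)" using d by (auto simp: slab_def)
      with i show "x \<in> (\<Union>p\<in>D. ?S (fst p) (snd p))" by (intro UN_I[of "(i, y $ i)"]) (auto simp: D_def)
    qed
    have [simp]: "finite D" by (auto simp: D_def)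
    have cD: "card D \<le> CARD('n) * 4"
    proof -
      have "card D = (\<Sum>i\<in>UNIV. card {0, 1, a $ i, b $ i})" unfolding D_def by (rule card_SigmaI) auto
      also have "\<dots> \<le> (\<Sum>i\<in>(UNIV::'n set). 4)"
        by (intro sum_mono) (simp add: card_insert_if)
      finally show ?thesis by simp
    qed
    have "emeasure lborel (neighbourhood (frontier (half_open_box a b)) \<epsilon>)
       \<le> emeasure lborel (\<Union>p\<in>D. ?S (fst p) (snd p))"
      by (intro emeasure_mono sub sets.finite_UN) auto
    also have "\<dots> \<le> (\<Sum>p\<in>D. emeasure lborel (?S (fst p) (snd p)))"
      by (intro emeasure_subadditive_finite) auto
    also have "\<dots> \<le> (\<Sum>p\<in>D. ennreal (2 * \<epsilon> * 3 ^ CARD('n)))"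
      using e by (intro sum_mono emeasure_slab_le) auto
    also have "\<dots> = ennreal (real (card D) * (2 * \<epsilon> * 3 ^ CARD('n)))"
      using e by (simp add: ennreal_mult ennreal_of_nat_eq_real_of_nat)
    also have "\<dots> \<le> ennreal (real (CARD('n) * 4) * (2 * \<epsilon> * 3 ^ CARD('n)))"
      using e cD by (intro ennreal_leI mult_right_mono) (auto simp del: of_nat_mult)
    finally have "emeasure lborel (neighbourhood (frontier (half_open_box a b)) \<epsilon>)
        \<le> ennreal (real (CARD('n) * 4) * (2 * \<epsilon> * 3 ^ CARD('n)))" .
    then have "emeasure lborel (neighbourhood (frontier (half_open_box a b)) \<epsilon>) / ennreal \<epsilon>
        \<le> ennreal (real (CARD('n) * 4) * (2 * \<epsilon> * 3 ^ CARD('n))) / ennreal \<epsilon>"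
      by (rule divide_right_mono_ennreal)
    also have "\<dots> = ennreal (8 * real CARD('n) * 3 ^ CARD('n))"
      using e by (subst divide_ennreal) (auto simp: field_simps)
    finally show ?thesis .
  qed
  then show "\<forall>\<^sub>F \<epsilon> in at_right 0. emeasure lborel (neighbourhood (frontier (half_open_box a b)) \<epsilon>) / ennreal \<epsilon>
      \<le> ennreal (8 * real CARD('n) * 3 ^ CARD('n))"
    unfolding eventually_at_right_field by (intro exI[of _ 1]) auto
qed

lemma exponential_mixing_half_open_box:
  fixes T :: "real^'n::finite \<Rightarrow> real^'n"
  assumes "exponential_mixing T \<mu>" and "sets \<mu> = sets (restrict_space borel unit_cube)"
  obtains c \<tau> where "c > 0" "\<tau> > 0"
    "\<And>a b a' b' n. \<bar>measure \<mu> (half_open_box a b \<inter> (T ^^ n) -` half_open_box a' b')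
        - measure \<mu> (half_open_box a b) * measure \<mu> (half_open_box a' b')\<bar>
      \<le> c * measure \<mu> (half_open_box a' b') * exp (- \<tau> * real n)"
proof -
  let ?C = "range (\<lambda>(a, b). half_open_box a b) :: (real^'n) set set"
  have "?C \<subseteq> sets \<mu>"
  proof
    fix F assume "F \<in> ?C"
    then obtain a b where "F = half_open_box a b" by auto
    then show "F \<in> sets \<mu>"
      unfolding assms(2) by (simp only: sets_restrict_space_iff[of unit_cube borel] space_borel Int_UNIV_left
          Int_UNIV_right unit_cube_borel half_open_box_borel half_open_box_subset_unit_cube simp_thms)
  qed
  moreover have "(SUP F\<in>?C. upper_minkowski_content (frontier F)) < \<infinity>"
  proof -
    have "(SUP F\<in>?C. upper_minkowski_content (frontier F)) \<le> ennreal (8 * real CARD('n) * 3 ^ CARD('n))"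
    proof (rule SUP_least)
      fix F :: "(real^'n) set" assume "F \<in> ?C"
      then obtain a b where "F = half_open_box a b" by auto
      then show "upper_minkowski_content (frontier F) \<le> ennreal (8 * real CARD('n) * 3 ^ CARD('n))"
        by (simp only: upper_minkowski_content_half_open_box)
    qed
    also have "\<dots> < \<infinity>" by simp
    finally show ?thesis .
  qed
  ultimately have "\<exists>c>0. \<exists>\<tau>>0. \<forall>F\<in>?C. \<forall>G\<in>?C. \<forall>n::nat.
           \<bar>measure \<mu> (F \<inter> (T ^^ n) -` G) - measure \<mu> F * measure \<mu> G\<bar>
             \<le> c * measure \<mu> G * exp (- \<tau> * real n)"
    by (intro assms(1)[unfolded exponential_mixing_def, rule_format]) (rule conjI)
  then obtain c \<tau> where "c > 0" "\<tau> > 0" and *: "\<forall>F\<in>?C. \<forall>G\<in>?C. \<forall>n::nat.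
           \<bar>measure \<mu> (F \<inter> (T ^^ n) -` G) - measure \<mu> F * measure \<mu> G\<bar>
             \<le> c * measure \<mu> G * exp (- \<tau> * real n)"
    by (elim exE conjE)
  show ?thesis
  proof (rule that[OF \<open>c > 0\<close> \<open>\<tau> > 0\<close>])
    fix a b a' b' :: "real^'n" and n
    have "half_open_box a b \<in> ?C" "half_open_box a' b' \<in> ?C" by auto
    then show "\<bar>measure \<mu> (half_open_box a b \<inter> (T ^^ n) -` half_open_box a' b')
        - measure \<mu> (half_open_box a b) * measure \<mu> (half_open_box a' b')\<bar>
      \<le> c * measure \<mu> (half_open_box a' b') * exp (- \<tau> * real n)"
      by (intro *[rule_format])
  qed
qed

section \<open>Doob's maximal inequality on a dyadic interval\<close>

lemma weighted_young:
  fixes a m q :: real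
  assumes "1 < q" "0 \<le> a" "0 \<le> m"
  shows "q * m powr (q - 1) * a \<le> (q - 1) * m powr q + a powr q"
proof (cases "a = 0 \<or> m = 0")
  case True
  then show ?thesis using assms by auto
next
  case False
  then have pos: "0 < a" "0 < m" using assms by auto
  \<comment> \<open>Weighted inequality of the means, with the weights \<open>(q - 1) / q\<close> and \<open>1 / q\<close>.\<close>
  have "((m powr q) powr ((q-1)/q)) * ((a powr q) powr (1/q)) \<le> ((q-1)/q) * m powr q + (1/q) * a powr q"
    using assms pos by (intro Youngs_inequality_0) (auto simp: field_simps)
  moreover have "(m powr q) powr ((q-1)/q) = m powr (q - 1)" "(a powr q) powr (1/q) = a"
    using assms pos by (auto simp: powr_powr)
  ultimately have "m powr (q - 1) * a \<le> ((q-1)/q) * m powr q + (1/q) * a powr q" by simp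
  then have "q * (m powr (q - 1) * a) \<le> q * (((q-1)/q) * m powr q + (1/q) * a powr q)"
    using assms by (intro mult_left_mono) auto
  also have "\<dots> = (q - 1) * m powr q + a powr q"
    using assms by (simp add: distrib_left)
  finally show ?thesis by (simp add: mult.assoc)
qed

text \<open>
  The running maximum of \<open>m\<close> and of the averages of \<open>g\<close> over the dyadic blocks in \<open>{..<2 ^ N}\<close> that
  contain \<open>t\<close>. Starting the recursion at an arbitrary \<open>m\<close> is what makes the induction over \<open>N\<close> in the
  maximal inequality possible.
\<close>

fun dyadic_max :: "nat \<Rightarrow> real \<Rightarrow> (nat \<Rightarrow> real) \<Rightarrow> nat \<Rightarrow> real" where
  "dyadic_max 0 m g t = max m (g 0)"
| "dyadic_max (Suc N) m g t =
    (let m' = max m ((\<Sum>s<2 ^ Suc N. g s) / 2 ^ Suc N)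
     in if t < 2 ^ N then dyadic_max N m' g t else dyadic_max N m' (\<lambda>s. g (s + 2 ^ N)) (t - 2 ^ N))"

lemma dyadic_max_ge_start: "m \<le> dyadic_max N m g t"
proof (induction N arbitrary: m g t)
  case (Suc N)
  show ?case
    using Suc[of "max m ((\<Sum>s<2 ^ Suc N. g s) / 2 ^ Suc N)"]
    by (auto simp: Let_def simp del: power_Suc intro: order_trans[rotated])
qed auto

lemma sum_lessThan_double:
  "(\<Sum>s<2 ^ Suc N. f s) = (\<Sum>s<2 ^ N. f s) + (\<Sum>s<(2::nat) ^ N. f (s + 2 ^ N) :: real)"
proof -
  have "(\<Sum>s<2 ^ Suc N. f s) = (\<Sum>s<2 ^ N + 2 ^ N. f s)" by (simp add: mult_2)
  also have "\<dots> = (\<Sum>s<2 ^ N. f s) + (\<Sum>s=2 ^ N..<2 ^ N + 2 ^ N. f s)"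
    by (simp add: lessThan_atLeast0 sum.atLeastLessThan_concat)
  also have "(\<Sum>s=2 ^ N..<2 ^ N + 2 ^ N. f s) = (\<Sum>s<2 ^ N. f (s + 2 ^ N))"
    using sum.shift_bounds_nat_ivl[of f 0 "2^N" "2^N"] by (simp add: lessThan_atLeast0)
  finally show ?thesis .
qed

lemma dyadic_max_ge_average:
  assumes "l \<le> N" "t < 2 ^ N"
  shows "(\<Sum>s<2 ^ l. g ((t div 2 ^ l) * 2 ^ l + s)) / 2 ^ l \<le> dyadic_max N m g t"
  using assms
proof (induction N arbitrary: m g t)
  case 0
  then show ?case by auto
next
  case (Suc N)
  let ?m = "max m ((\<Sum>s<2 ^ Suc N. g s) / 2 ^ Suc N)"
  show ?case
  proof (cases "l = Suc N")
    case True
    have "(\<Sum>s<2 ^ l. g ((t div 2 ^ l) * 2 ^ l + s)) / 2 ^ l \<le> ?m"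
      using True Suc.prems by (simp del: power_Suc)
    also have "\<dots> \<le> dyadic_max (Suc N) m g t"
      unfolding dyadic_max.simps Let_def by (simp add: dyadic_max_ge_start del: power_Suc max.bounded_iff)
    finally show ?thesis .
  next
    case False
    then have l: "l \<le> N" using Suc.prems by simp
    show ?thesis
    proof (cases "t < 2 ^ N")
      case True
      then show ?thesis using Suc.IH[OF l True] by (simp add: Let_def del: power_Suc)
    next
      case False
      then have t: "t - 2 ^ N < 2 ^ N" using Suc.prems by auto
      obtain e where e: "(2::nat) ^ N = e * 2 ^ l"
        using l by (metis le_imp_power_dvd dvdE mult.commute)
      have "t div 2 ^ l * 2 ^ l = ((t - 2 ^ N) div 2 ^ l) * 2 ^ l + 2 ^ N"
      proof -
        have "t = (t - 2 ^ N) + e * 2 ^ l" using False e by simp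
        then have "t div 2 ^ l = (t - 2 ^ N) div 2 ^ l + e"
          by (metis div_mult_self1 add.commute power_not_zero zero_neq_numeral)
        then show ?thesis using e by (simp add: algebra_simps)
      qed
      then show ?thesis using Suc.IH[OF l t, of "\<lambda>s. g (s + 2 ^ N)" ?m] False
        by (simp add: Let_def algebra_simps del: power_Suc)
    qed
  qed
qed

text \<open>
  The Bellman function \<open>(q - 1) m\<^sup>q - q m\<^sup>q\<^sup>-\<^sup>1 a\<close> of the maximal inequality: \<open>m\<close> is the running maximum
  and \<open>a\<close> the current average. It does not increase when \<open>m\<close> is replaced by the larger of \<open>m\<close> and \<open>a\<close>,
  and for fixed \<open>m\<close> it is affine in \<open>a\<close>, so it is preserved on average when a block is halved.
\<close>

lemma bellman_step:
  fixes a m q :: real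
  assumes "1 < q" "0 \<le> a" "0 \<le> m"
  shows "(q - 1) * (max m a) powr q - q * (max m a) powr (q - 1) * a \<le> (q - 1) * m powr q - q * m powr (q - 1) * a"
proof (cases "a \<le> m")
  case False
  then have "0 < a" using assms by simp
  then have "a powr (q - 1) * a = a powr q"
    by (metis add.commute diff_add_cancel powr_add powr_one less_imp_le)
  then have e: "q * a powr (q - 1) * a = q * a powr q" by (simp add: mult.assoc)
  have "max m a = a" using False by simp
  show ?thesis unfolding \<open>max m a = a\<close> e using weighted_young[OF assms] by (simp add: algebra_simps)
qed auto

lemma dyadic_max_bellman:
  assumes "1 < q" "\<And>s. 0 \<le> g s" "0 \<le> m"
  shows "(\<Sum>t<2 ^ N. (q - 1) * dyadic_max N m g t powr q - q * dyadic_max N m g t powr (q - 1) * g t)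
    \<le> 2 ^ N * ((q - 1) * m powr q) - q * m powr (q - 1) * (\<Sum>s<2 ^ N. g s)"
  using assms(2,3)
proof (induction N arbitrary: m g)
  case 0
  then show ?case using bellman_step[OF \<open>1 < q\<close>, of "g 0" m] by simp
next
  case (Suc N)
  define a where "a = (\<Sum>s<2 ^ Suc N. g s) / 2 ^ Suc N"
  define m' where "m' = max m a"
  have "0 \<le> a" unfolding a_def using Suc.prems by (intro divide_nonneg_nonneg sum_nonneg) auto
  have "0 \<le> m'" using Suc.prems by (simp add: m'_def)
  let ?F = "\<lambda>M x. (q - 1) * M powr q - q * M powr (q - 1) * x"
  have "(\<Sum>t<2 ^ Suc N. ?F (dyadic_max (Suc N) m g t) (g t))
     = (\<Sum>t<2 ^ N. ?F (dyadic_max N m' g t) (g t)) +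
       (\<Sum>t<2 ^ N. ?F (dyadic_max N m' (\<lambda>s. g (s + 2 ^ N)) t) (g (t + 2 ^ N)))"
    unfolding sum_lessThan_double
    by (intro arg_cong2[where f="(+)"] sum.cong refl) (simp_all add: Let_def m'_def a_def del: power_Suc)
  also have "\<dots> \<le> (2 ^ N * ((q - 1) * m' powr q) - q * m' powr (q - 1) * (\<Sum>s<2 ^ N. g s))
     + (2 ^ N * ((q - 1) * m' powr q) - q * m' powr (q - 1) * (\<Sum>s<2 ^ N. g (s + 2 ^ N)))"
    using Suc.prems \<open>0 \<le> m'\<close> by (intro add_mono Suc.IH) auto
  also have "\<dots> = 2 ^ Suc N * ((q - 1) * m' powr q) - q * m' powr (q - 1) * (\<Sum>s<2 ^ Suc N. g s)"
    unfolding sum_lessThan_double by (simp add: algebra_simps)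
  also have "\<dots> = 2 ^ Suc N * ?F m' a"
    by (simp add: a_def algebra_simps)
  also have "\<dots> \<le> 2 ^ Suc N * ?F m a"
    unfolding m'_def using bellman_step[OF \<open>1 < q\<close> \<open>0 \<le> a\<close> \<open>0 \<le> m\<close>] by (intro mult_left_mono) auto
  also have "\<dots> = 2 ^ Suc N * ((q - 1) * m powr q) - q * m powr (q - 1) * (\<Sum>s<2 ^ Suc N. g s)"
    by (simp add: a_def algebra_simps)
  finally show ?case .
qed

text \<open>
  Young's inequality with the second factor doubled: half of \<open>(q - 1) m\<^sup>q\<close> can then be absorbed on
  the left.
\<close>

lemma young_absorb:
  fixes a m q :: real
  assumes "1 < q" "0 \<le> a" "0 \<le> m"
  shows "(q - 1) * m powr q \<le> 2 * ((q - 1) * m powr q - q * m powr (q - 1) * a) + 2 powr q * a powr q"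
  using weighted_young[of q "2 * a" m] assms by (simp add: powr_mult algebra_simps)

text \<open>
  Doob's inequality in \<open>L\<^sup>q\<close>. With start value zero the Bellman bound has right-hand side zero.
\<close>

lemma dyadic_max_powr_sum_le:
  assumes "1 < q" "\<And>s. 0 \<le> g s"
  shows "(q - 1) * (\<Sum>t<2 ^ N. dyadic_max N 0 g t powr q) \<le> 2 powr q * (\<Sum>s<2 ^ N. g s powr q)"
proof -
  let ?M = "dyadic_max N 0 g"
  have "(q - 1) * (\<Sum>t<2 ^ N. ?M t powr q) = (\<Sum>t<2 ^ N. (q - 1) * ?M t powr q)"
    by (simp add: sum_distrib_left)
  also have "\<dots> \<le> (\<Sum>t<2 ^ N. 2 * ((q - 1) * ?M t powr q - q * ?M t powr (q - 1) * g t) + 2 powr q * g t powr q)"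
    using assms by (intro sum_mono young_absorb) (auto simp: dyadic_max_ge_start)
  also have "\<dots> = 2 * (\<Sum>t<2 ^ N. (q - 1) * ?M t powr q - q * ?M t powr (q - 1) * g t)
      + 2 powr q * (\<Sum>s<2 ^ N. g s powr q)"
    by (simp only: sum.distrib sum_distrib_left)
  also have "\<dots> \<le> 2 * 0 + 2 powr q * (\<Sum>s<2 ^ N. g s powr q)"
    using dyadic_max_bellman[OF assms, of 0 N] by (intro add_mono mult_left_mono) auto
  finally show ?thesis by simp
qed

section \<open>The strong dyadic maximal function\<close>

definition grid :: "nat \<Rightarrow> ('n::finite \<Rightarrow> nat) set" where
  "grid N = (\<Pi>\<^sub>E i\<in>UNIV. {..<2 ^ N})"

text \<open>
  The level \<open>l i\<close> counts from below: the block has side \<open>2 ^ l i\<close> in direction \<open>i\<close>, measured in cells of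
  the finest grid.
\<close>

definition block :: "('n::finite \<Rightarrow> nat) \<Rightarrow> ('n \<Rightarrow> nat) \<Rightarrow> ('n \<Rightarrow> nat) set" where
  "block l z = {w. \<forall>i. w i div 2 ^ l i = z i div 2 ^ l i}"

lemma mem_grid: "z \<in> grid N \<longleftrightarrow> (\<forall>i. z i < 2 ^ N)"
  by (auto simp: grid_def)

lemma finite_grid [simp, intro]: "finite (grid N)"
  by (simp add: grid_def finite_PiE)

lemma div_block_eq: "{t. t div 2 ^ l = (a::nat) div 2 ^ l} = (\<lambda>s. a div 2 ^ l * 2 ^ l + s) ` {..<2 ^ l}"
proof (intro set_eqI iffI)
  fix t assume "t \<in> {t. t div 2 ^ l = a div 2 ^ l}"
  then have "t = a div 2 ^ l * 2 ^ l + t mod 2 ^ l" using div_mult_mod_eq[of t "2 ^ l"] by simp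
  then show "t \<in> (\<lambda>s. a div 2 ^ l * 2 ^ l + s) ` {..<2 ^ l}" by (intro image_eqI[of _ _ "t mod 2 ^ l"]) auto
qed auto

lemma finite_block [simp, intro]: "finite (block l z)"
proof -
  have "block l z = (\<Pi>\<^sub>E i\<in>UNIV. {t. t div 2 ^ l i = z i div 2 ^ l i})"
    by (auto simp: block_def)
  also have "finite \<dots>" by (intro finite_PiE) (auto simp: div_block_eq)
  finally show ?thesis .
qed

lemma block_fiber:
  assumes "t div 2 ^ l i = z i div 2 ^ l i"
  shows "{w \<in> block l z. w i = t} = block (l(i := 0)) (z(i := t))"
  using assms by (auto simp: block_def)

lemma sum_block_split:
  fixes g :: "('n::finite \<Rightarrow> nat) \<Rightarrow> real"
  shows "(\<Sum>w\<in>block l z. g w) =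
    (\<Sum>s<2 ^ l i. \<Sum>w\<in>block (l(i := 0)) (z(i := z i div 2 ^ l i * 2 ^ l i + s)). g w)"
proof -
  let ?T = "{t. t div 2 ^ l i = z i div 2 ^ l i}"
  have "(\<Sum>w\<in>block l z. g w) = (\<Sum>t\<in>?T. \<Sum>w\<in>{w \<in> block l z. w i = t}. g w)"
    by (rule sum.group[symmetric]) (auto simp: div_block_eq, auto simp: block_def div_block_eq[symmetric])
  also have "\<dots> = (\<Sum>t\<in>?T. \<Sum>w\<in>block (l(i := 0)) (z(i := t)). g w)"
    by (intro sum.cong refl block_fiber) auto
  also have "\<dots> = (\<Sum>s<2 ^ l i. \<Sum>w\<in>block (l(i := 0)) (z(i := z i div 2 ^ l i * 2 ^ l i + s)). g w)"
    unfolding div_block_eq by (subst sum.reindex) (auto simp: inj_on_def)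
  finally show ?thesis .
qed

text \<open>
  The map exchanging the \<open>i\<close>-th coordinate of \<open>z\<close> with \<open>t\<close> is an involution of the pairs \<open>(z, t)\<close>. This
  takes the place of Fubini's theorem when a one-dimensional inequality is applied in direction \<open>i\<close>.
\<close>

lemma sum_grid_fiber:
  fixes F :: "('n::finite \<Rightarrow> nat) \<Rightarrow> real"
  shows "(\<Sum>z\<in>grid N. \<Sum>t<2 ^ N. F (z(i := t))) = 2 ^ N * (\<Sum>z\<in>grid N. F z)"
proof -
  let ?A = "(grid N :: ('n \<Rightarrow> nat) set) \<times> {..<(2::nat) ^ N}"
  have "(\<Sum>z\<in>grid N. \<Sum>t<2 ^ N. F (z(i := t))) = (\<Sum>p\<in>?A. F ((fst p)(i := snd p)))"
    by (simp add: sum.cartesian_product case_prod_unfold)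
  also have "\<dots> = (\<Sum>p\<in>?A. F (fst p))"
    by (rule sum.reindex_bij_witness[where i="\<lambda>p. ((fst p)(i := snd p), fst p i)"
          and j="\<lambda>p. ((fst p)(i := snd p), fst p i)"]) (auto simp: mem_grid)
  also have "\<dots> = (\<Sum>z\<in>grid N. \<Sum>t<(2::nat) ^ N. F z)"
    by (simp only: sum.cartesian_product case_prod_unfold)
  finally show ?thesis by (simp add: sum_distrib_left)
qed

text \<open>
  The maximal function is applied in one coordinate after the other: if \<open>G\<close> dominates all averages
  over blocks that extend in the directions of \<open>S\<close> only, the maximal function of \<open>G\<close> in a further
  direction \<open>i\<close> dominates the averages over blocks that extend in the directions of \<open>insert i S\<close>, and
  it costs one more factor in the \<open>L\<^sup>q\<close> bound.
\<close>

lemma strong_dyadic_maximal_aux: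
  fixes g :: "('n::finite \<Rightarrow> nat) \<Rightarrow> real"
  assumes q: "1 < q" and g: "\<And>z. 0 \<le> g z" and "finite S"
  shows "\<exists>G. (\<forall>z. 0 \<le> G z) \<and>
    (\<forall>z\<in>grid N. \<forall>l. (\<forall>i. l i \<le> N) \<longrightarrow> (\<forall>i. i \<notin> S \<longrightarrow> l i = 0) \<longrightarrow>
       (\<Sum>w\<in>block l z. g w) / (\<Prod>i\<in>UNIV. 2 ^ l i) \<le> G z) \<and>
    (q - 1) ^ card S * (\<Sum>z\<in>grid N. G z powr q) \<le> (2 powr q) ^ card S * (\<Sum>z\<in>grid N. g z powr q)"
  using \<open>finite S\<close>
proof (induction S)
  case empty
  show ?case
  proof (intro exI[of _ g] conjI ballI allI impI)
    fix z :: "'n \<Rightarrow> nat" and l :: "'n \<Rightarrow> nat" assume "\<forall>i. i \<notin> {} \<longrightarrow> l i = 0"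
    then have "l = (\<lambda>_. 0)" by auto
    then have "block l z = {z}" by (auto simp: block_def)
    then show "(\<Sum>w\<in>block l z. g w) / (\<Prod>i\<in>UNIV. 2 ^ l i) \<le> g z" using \<open>l = _\<close> by simp
  qed (use g in auto)
next
  case (insert i S)
  from insert.IH obtain G where G0: "\<forall>z. 0 \<le> G z"
    and G1: "\<forall>z\<in>grid N. \<forall>l. (\<forall>i. l i \<le> N) \<longrightarrow> (\<forall>i. i \<notin> S \<longrightarrow> l i = 0) \<longrightarrow>
       (\<Sum>w\<in>block l z. g w) / (\<Prod>i\<in>UNIV. 2 ^ l i) \<le> G z"
    and G2: "(q - 1) ^ card S * (\<Sum>z\<in>grid N. G z powr q) \<le> (2 powr q) ^ card S * (\<Sum>z\<in>grid N. g z powr q)"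
    by (elim exE conjE)
  \<comment> \<open>The maximal function in direction \<open>i\<close>, on the line through \<open>z\<close>.\<close>
  define G' where "G' z = dyadic_max N 0 (\<lambda>t. G (z(i := t))) (z i)" for z
  show ?case
  proof (intro exI[of _ G'] conjI ballI allI impI)
    show "0 \<le> G' z" for z by (simp add: G'_def dyadic_max_ge_start)
  next
    fix z :: "'n \<Rightarrow> nat" and l :: "'n \<Rightarrow> nat" 
    assume z: "z \<in> grid N" and lN: "\<forall>i. l i \<le> N" and l0: "\<forall>j. j \<notin> insert i S \<longrightarrow> l j = 0"
    let ?l = "l(i := 0)" and ?z = "\<lambda>s. z(i := z i div 2 ^ l i * 2 ^ l i + s)"
    have lNi: "l i \<le> N" using lN by simp
    have zi: "z i < 2 ^ N" using z by (simp add: mem_grid)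
    have grid: "?z s \<in> grid N" if "s < 2 ^ l i" for s
    proof -
      have "(z i div 2 ^ l i * 2 ^ l i + s) div 2 ^ l i = z i div 2 ^ l i" using that by simp
      moreover have "z i div 2 ^ l i < 2 ^ (N - l i)"
        using zi lN by (simp add: less_mult_imp_div_less power_add[symmetric])
      ultimately have "(z i div 2 ^ l i * 2 ^ l i + s) div 2 ^ l i < 2 ^ (N - l i)" by simp
      then have "z i div 2 ^ l i * 2 ^ l i + s < 2 ^ (N - l i) * 2 ^ l i"
        by (subst (asm) div_less_iff_less_mult) auto
      also have "\<dots> = 2 ^ N" using lN by (simp add: power_add[symmetric])
      finally show ?thesis using z by (auto simp: mem_grid)
    qed
    have vol: "(\<Prod>j\<in>UNIV. 2 ^ l j) = (2::real) ^ l i * (\<Prod>j\<in>UNIV. 2 ^ ?l j)"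
      by (simp add: prod.remove[of UNIV i])
    have "(\<Sum>w\<in>block l z. g w) / (\<Prod>i\<in>UNIV. 2 ^ l i)
       = (\<Sum>s<2 ^ l i. (\<Sum>w\<in>block ?l (?z s). g w) / (\<Prod>j\<in>UNIV. 2 ^ ?l j)) / 2 ^ l i"
      unfolding sum_block_split[of g l z i] vol by (simp add: sum_divide_distrib mult.commute)
    also have "\<dots> \<le> (\<Sum>s<2 ^ l i. G (?z s)) / 2 ^ l i"
      using lN l0 by (intro divide_right_mono sum_mono G1[rule_format] grid) (auto split: if_splits)
    also have "\<dots> \<le> G' z"
      unfolding G'_def using dyadic_max_ge_average[OF lNi zi, where g="\<lambda>t. G (z(i := t))" and m=0] by simp
    finally show "(\<Sum>w\<in>block l z. g w) / (\<Prod>i\<in>UNIV. 2 ^ l i) \<le> G' z" .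
  next
    have fib: "(q - 1) * (\<Sum>t<2 ^ N. G' (z(i := t)) powr q) \<le> 2 powr q * (\<Sum>t<2 ^ N. G (z(i := t)) powr q)" for z
      unfolding G'_def using dyadic_max_powr_sum_le[OF q, of "\<lambda>t. G (z(i := t))" N] G0 by simp
    have "2 ^ N * ((q - 1) * (\<Sum>z\<in>grid N. G' z powr q)) = (\<Sum>z\<in>grid N. (q - 1) * (\<Sum>t<2 ^ N. G' (z(i := t)) powr q))"
      using sum_grid_fiber[of "\<lambda>z. G' z powr q" i N] by (simp add: sum_distrib_left[symmetric])
    also have "\<dots> \<le> (\<Sum>z\<in>grid N. 2 powr q * (\<Sum>t<2 ^ N. G (z(i := t)) powr q))"
      by (intro sum_mono fib)
    also have "\<dots> = 2 ^ N * (2 powr q * (\<Sum>z\<in>grid N. G z powr q))"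
      using sum_grid_fiber[of "\<lambda>z. G z powr q" i N] by (simp add: sum_distrib_left[symmetric])
    finally have s: "(q - 1) * (\<Sum>z\<in>grid N. G' z powr q) \<le> 2 powr q * (\<Sum>z\<in>grid N. G z powr q)" by simp
    have "(q - 1) ^ card (insert i S) * (\<Sum>z\<in>grid N. G' z powr q) = (q - 1) ^ card S * ((q - 1) * (\<Sum>z\<in>grid N. G' z powr q))"
      using insert by simp
    also have "\<dots> \<le> (q - 1) ^ card S * (2 powr q * (\<Sum>z\<in>grid N. G z powr q))"
      using q s by (intro mult_left_mono) auto
    also have "\<dots> = 2 powr q * ((q - 1) ^ card S * (\<Sum>z\<in>grid N. G z powr q))" by simp
    also have "\<dots> \<le> 2 powr q * ((2 powr q) ^ card S * (\<Sum>z\<in>grid N. g z powr q))"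
      by (intro mult_left_mono G2) auto
    also have "\<dots> = (2 powr q) ^ card (insert i S) * (\<Sum>z\<in>grid N. g z powr q)" using insert by simp
    finally show "(q - 1) ^ card (insert i S) * (\<Sum>z\<in>grid N. G' z powr q)
        \<le> (2 powr q) ^ card (insert i S) * (\<Sum>z\<in>grid N. g z powr q)" .
  qed
qed

lemma strong_dyadic_maximal:
  fixes g :: "('n::finite \<Rightarrow> nat) \<Rightarrow> real"
  assumes q: "1 < q" and g: "\<And>z. 0 \<le> g z"
  obtains G where "\<forall>z. 0 \<le> G z"
    and "\<forall>z\<in>grid N. \<forall>l. (\<forall>i. l i \<le> N) \<longrightarrow> (\<Sum>w\<in>block l z. g w) / (\<Prod>i\<in>UNIV. 2 ^ l i) \<le> G z"
    and "(\<Sum>z\<in>grid N. G z powr q) \<le> (2 powr q / (q - 1)) ^ CARD('n) * (\<Sum>z\<in>grid N. g z powr q)"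
proof -
  obtain G where "\<forall>z. 0 \<le> G z"
    and "\<forall>z\<in>grid N. \<forall>l. (\<forall>i. l i \<le> N) \<longrightarrow> (\<Sum>w\<in>block l z. g w) / (\<Prod>i\<in>UNIV. 2 ^ l i) \<le> G z"
    and *: "(q - 1) ^ CARD('n) * (\<Sum>z\<in>grid N. G z powr q) \<le> (2 powr q) ^ CARD('n) * (\<Sum>z\<in>grid N. g z powr q)"
    using strong_dyadic_maximal_aux[of q g "UNIV :: 'n set" N, OF q g finite]
    by (elim exE conjE) (rule that, simp_all)
  moreover have "(\<Sum>z\<in>grid N. G z powr q) \<le> (2 powr q / (q - 1)) ^ CARD('n) * (\<Sum>z\<in>grid N. g z powr q)"
    using * q by (simp add: power_divide field_simps)
  ultimately show ?thesis using that by blast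
qed

section \<open>Measures with a density in \<open>L\<^sup>q\<close>\<close>

lemma space_cube_lebesgue [simp]: "space cube_lebesgue = unit_cube"
  by (simp add: cube_lebesgue_def space_restrict_space)

lemma sets_cube_lebesgue_iff: "A \<in> sets cube_lebesgue \<longleftrightarrow> A \<in> sets borel \<and> A \<subseteq> unit_cube"
  by (auto simp: cube_lebesgue_def sets_restrict_space_iff unit_cube_borel)

lemma emeasure_cube_lebesgue:
  "A \<subseteq> unit_cube \<Longrightarrow> emeasure cube_lebesgue A = emeasure lborel A"
  by (simp add: cube_lebesgue_def emeasure_restrict_space unit_cube_borel)

lemma finite_measure_cube_lebesgue: "finite_measure (cube_lebesgue :: (real^'n::finite) measure)"
proof
  have "emeasure lborel (unit_cube :: (real^'n) set) < \<infinity>"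
    unfolding unit_cube_def by (rule emeasure_lborel_cbox_finite)
  then show "emeasure cube_lebesgue (space (cube_lebesgue :: (real^'n) measure)) \<noteq> \<infinity>"
    by (simp add: emeasure_cube_lebesgue)
qed

locale cube_density = prob_space \<mu>
  for \<mu> :: "(real^'n::finite) measure" +
  fixes h :: "real^'n \<Rightarrow> real" and q :: real
  assumes h_measurable [measurable]: "h \<in> borel_measurable cube_lebesgue"
    and h_nonneg: "\<And>x. x \<in> unit_cube \<Longrightarrow> 0 \<le> h x"
    and density: "\<mu> = density cube_lebesgue (\<lambda>x. ennreal (h x))"
    and q_gt_1: "1 < q"
    and integrable_powr: "integrable cube_lebesgue (\<lambda>x. h x powr q)"
begin

lemma space_mu [simp]: "space \<mu> = unit_cube"
  by (simp add: density)

lemma sets_mu_iff: "A \<in> sets \<mu> \<longleftrightarrow> A \<in> sets borel \<and> A \<subseteq> unit_cube"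
  by (simp add: density sets_cube_lebesgue_iff)

lemma unit_cube_sets [simp]: "unit_cube \<in> sets \<mu>"
  by (simp add: sets_mu_iff unit_cube_borel)

lemma tile_sets [measurable, simp]: "tile k z \<in> sets \<mu>"
  by (simp add: sets_mu_iff tile_borel tile_subset_unit_cube)

lemma integrable_h: "integrable cube_lebesgue h"
proof (rule integrableI_bounded)
  have "(\<integral>\<^sup>+ x. ennreal (norm (h x)) \<partial>cube_lebesgue) = (\<integral>\<^sup>+ x. ennreal (h x) * indicator (space cube_lebesgue) x \<partial>cube_lebesgue)"
    by (intro nn_integral_cong) (auto simp: h_nonneg)
  also have "\<dots> = emeasure \<mu> (space \<mu>)"
    unfolding density using sets.top[of "cube_lebesgue :: (real^'n) measure"]
    by (subst emeasure_density) auto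
  also have "\<dots> < \<infinity>" unfolding emeasure_space_1 by simp
  finally show "(\<integral>\<^sup>+ x. ennreal (norm (h x)) \<partial>cube_lebesgue) < \<infinity>" .
qed simp

lemma measure_eq_integral:
  assumes "A \<in> sets \<mu>"
  shows "prob A = (\<integral>x. indicator A x * h x \<partial>cube_lebesgue)"
proof -
  have [measurable]: "A \<in> sets cube_lebesgue" using assms by (simp add: density)
  have int: "integrable cube_lebesgue (\<lambda>x. indicator A x * h x)"
    using integrable_real_mult_indicator[OF _ integrable_h, of A] by (simp add: mult.commute)
  have "emeasure \<mu> A = (\<integral>\<^sup>+ x. ennreal (h x) * indicator A x \<partial>cube_lebesgue)"
    unfolding density by (subst emeasure_density) auto
  also have "\<dots> = (\<integral>\<^sup>+ x. ennreal (indicator A x * h x) \<partial>cube_lebesgue)"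
    by (intro nn_integral_cong) (auto simp: indicator_def)
  also have "\<dots> = ennreal (\<integral>x. indicator A x * h x \<partial>cube_lebesgue)"
    using int by (intro nn_integral_eq_integral) (auto simp: h_nonneg indicator_def)
  finally have "emeasure \<mu> A = ennreal (\<integral>x. indicator A x * h x \<partial>cube_lebesgue)" .
  moreover have "0 \<le> (\<integral>x. indicator A x * h x \<partial>cube_lebesgue)"
    by (rule Bochner_Integration.integral_nonneg) (auto simp: h_nonneg indicator_def)
  ultimately show ?thesis
    by (simp add: measure_def)
qed

definition powr_integral :: real where
  "powr_integral = (\<integral>x. h x powr q \<partial>cube_lebesgue)"

lemma powr_integral_nonneg: "0 \<le> powr_integral"
  unfolding powr_integral_def by (intro integral_nonneg_AE) auto

lemma measure_cube_lebesgue_le: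
  assumes "A \<in> sets \<mu>" "emeasure lborel A \<le> ennreal v" "0 \<le> v"
  shows "measure cube_lebesgue A \<le> v"
  using assms emeasure_cube_lebesgue[of A]
  by (simp add: measure_def sets_mu_iff enn2real_leI)

lemma integrable_indicator_powr:
  assumes "A \<in> sets \<mu>"
  shows "integrable cube_lebesgue (\<lambda>x. indicator A x * h x powr q)"
  using integrable_real_mult_indicator[OF _ integrable_powr, of A] assms by (simp add: mult.commute density)

lemma integrable_indicator_h:
  assumes "A \<in> sets \<mu>"
  shows "integrable cube_lebesgue (\<lambda>x. indicator A x * h x)"
  using integrable_real_mult_indicator[OF _ integrable_h, of A] assms by (simp add: mult.commute density)

lemma integrable_indicator_const:
  assumes "A \<in> sets \<mu>"
  shows "integrable cube_lebesgue (\<lambda>x. indicator A x * (c::real))"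
proof -
  interpret finite_measure cube_lebesgue by (rule finite_measure_cube_lebesgue)
  show ?thesis using assms
    by (intro integrable_mult_left integrable_real_indicator) (auto simp: density less_top[symmetric])
qed

lemma integral_indicator_const:
  assumes "A \<in> sets \<mu>"
  shows "(\<integral>x. indicator A x * (c::real) \<partial>cube_lebesgue) = measure cube_lebesgue A * c"
  proof -
  have "A \<inter> unit_cube = A" using sets.sets_into_space[OF assms] by auto
  then show ?thesis using assms by (simp add: density)
qed

text \<open>
  Jensen's inequality for the average of the density over \<open>A\<close>, here with an upper bound \<open>v\<close> for the
  volume of \<open>A\<close>. It is Young's inequality at the average, integrated over \<open>A\<close>.
\<close>

lemma average_powr_le:
  assumes A: "A \<in> sets \<mu>" and v: "emeasure lborel A \<le> ennreal v" "0 < v"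
  shows "(prob A / v) powr q * v \<le> (\<integral>x. indicator A x * h x powr q \<partial>cube_lebesgue)"
proof -
  define a where "a = prob A / v"
  have a: "0 \<le> a" using v by (simp add: a_def)
  have "q * a powr (q - 1) * prob A = (\<integral>x. q * a powr (q - 1) * (indicator A x * h x) \<partial>cube_lebesgue)"
    unfolding measure_eq_integral[OF A] by simp
  also have "\<dots> \<le> (\<integral>x. indicator A x * h x powr q + indicator A x * ((q - 1) * a powr q) \<partial>cube_lebesgue)"
  proof (rule integral_mono)
    fix x :: "real^'n" assume "x \<in> space cube_lebesgue"
    then have "q * a powr (q - 1) * h x \<le> (q - 1) * a powr q + h x powr q"
      using weighted_young[of q "h x" a] q_gt_1 a h_nonneg by simp
    then show "q * a powr (q - 1) * (indicator A x * h x) \<le> indicator A x * h x powr q + indicator A x * ((q - 1) * a powr q)"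
      by (auto simp: indicator_def)
  qed (use A in \<open>auto intro!: integrable_add integrable_indicator_powr integrable_indicator_const integrable_indicator_h integrable_mult_right\<close>)
  also have "\<dots> = (\<integral>x. indicator A x * h x powr q \<partial>cube_lebesgue) + measure cube_lebesgue A * ((q - 1) * a powr q)"
    unfolding integral_indicator_const[OF A, symmetric]
    by (rule Bochner_Integration.integral_add) (rule integrable_indicator_powr[OF A] integrable_indicator_const[OF A])+
  also have "measure cube_lebesgue A * ((q - 1) * a powr q) \<le> v * ((q - 1) * a powr q)"
    using q_gt_1 v by (intro mult_right_mono measure_cube_lebesgue_le A) auto
  finally have *: "q * a powr (q - 1) * prob A \<le> (\<integral>x. indicator A x * h x powr q \<partial>cube_lebesgue) + v * ((q - 1) * a powr q)"
    by simp
  have "a powr (q - 1) * prob A = a powr q * v"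
  proof -
    have "a powr (q - 1) * a = a powr q"
    proof (cases "a = 0")
      case False
      then show ?thesis using a by (simp add: powr_mult_base mult.commute)
    qed simp
    moreover have "prob A = a * v" using v by (simp add: a_def)
    ultimately show ?thesis by (metis mult.assoc)
  qed
  then have e: "q * a powr (q - 1) * prob A = q * (a powr q * v)" by (simp add: mult.assoc)
  show ?thesis unfolding a_def[symmetric] using *[unfolded e] by (simp add: algebra_simps)
qed

text \<open>
  Split the density at height \<open>t\<close>; above that height it is at most \<open>t\<^sup>1\<^sup>-\<^sup>q h\<^sup>q\<close>. With a suitable \<open>t\<close> this
  turns smallness in volume into smallness in \<open>\<mu>\<close>.
\<close>

lemma measure_le_truncation:
  assumes A: "A \<in> sets \<mu>" and v: "emeasure lborel A \<le> ennreal v" "0 \<le> v" and t: "0 < t"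
  shows "prob A \<le> t * v + t powr (1 - q) * powr_integral"
proof -
  have "prob A \<le> (\<integral>x. indicator A x * t + t powr (1 - q) * h x powr q \<partial>cube_lebesgue)"
    unfolding measure_eq_integral[OF A]
  proof (rule integral_mono)
    fix x :: "real^'n" assume "x \<in> space cube_lebesgue"
    then have x: "0 \<le> h x" by (simp add: h_nonneg)
    have "h x \<le> t + t powr (1 - q) * h x powr q"
    proof (cases "h x \<le> t")
      case False
      then have "0 < h x" using t by simp
      have "h x = h x powr (1 - q) * h x powr q" using \<open>0 < h x\<close> by (simp add: powr_add[symmetric])
      also have "\<dots> \<le> t powr (1 - q) * h x powr q"
        using False t q_gt_1 by (intro mult_right_mono powr_mono2') auto
      finally show ?thesis using t by simp
    next
      case True
      then show ?thesis by (intro add_increasing2) auto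
    qed
    then show "indicator A x * h x \<le> indicator A x * t + t powr (1 - q) * h x powr q"
      by (auto simp: indicator_def)
  qed (use A integrable_powr in \<open>auto intro!: integrable_add integrable_indicator_const integrable_indicator_h integrable_mult_right\<close>)
  also have "\<dots> = measure cube_lebesgue A * t + t powr (1 - q) * powr_integral"
    unfolding integral_indicator_const[OF A, symmetric] powr_integral_def integral_mult_right_zero[symmetric]
    by (rule Bochner_Integration.integral_add)
      (rule integrable_indicator_const[OF A] integrable_mult_right integrable_powr)+
  also have "\<dots> \<le> v * t + t powr (1 - q) * powr_integral"
    using t v by (intro add_right_mono mult_right_mono measure_cube_lebesgue_le A) auto
  finally show ?thesis by (simp add: mult.commute)
qed

end

section \<open>Rectangles carrying too much mass\<close>

text \<open>
  Dyadic tiles are nested: the index at a coarser level is a function of the index at a finer one.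
\<close>

lemma tile_index_coarsen:
  assumes "k i \<le> m i"
  shows "tile_index k x i = tile_index m x i div 2 ^ (m i - k i)"
proof -
  have "2 ^ k i * x $ i = (2 ^ m i * x $ i) / real_of_int (2 ^ (m i - k i))"
    using assms by (simp add: field_simps power_add[symmetric])
  then show ?thesis
    unfolding tile_index_def using floor_divide_real_eq_div[of "2 ^ (m i - k i)" "2 ^ m i * x $ i"] by simp
qed

lemma upper_faces_null: "(\<Union>i::'n::finite. slab i 1 0) \<in> null_sets lborel"
proof (rule null_sets_UN'[OF countable_finite[OF finite]])
  fix i :: 'n
  show "slab i 1 0 \<in> null_sets lborel"
    using emeasure_slab_le[of 0 i 1] by (intro null_setsI) auto
qed

lemma inj_int_comp: "inj (\<lambda>w i. int (w i))"
  by (auto simp: inj_def fun_eq_iff)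

context cube_density
begin

text \<open>
  The points at which the strong dyadic maximal function of \<open>\<mu>\<close> exceeds \<open>M\<close>. The rectangles may have
  arbitrary side ratios, because nothing relates the shapes of the target rectangles for different
  times.
\<close>

definition heavy :: "real \<Rightarrow> (real^'n) set" where
  "heavy M = {x \<in> unit_cube. \<exists>k. M * tile_volume k < prob (tile k (tile_index k x))}"

definition heavy_upto :: "nat \<Rightarrow> real \<Rightarrow> (real^'n) set" where
  "heavy_upto N M = {x \<in> unit_cube. \<exists>k. (\<forall>i. k i \<le> N) \<and> M * tile_volume k < prob (tile k (tile_index k x))}"

lemma heavy_upto_eq_UN:
  "heavy_upto N M = (\<Union>k\<in>{k. \<forall>i. k i \<le> N}. \<Union>z\<in>{z \<in> tile_indices k. M * tile_volume k < prob (tile k z)}. tile k z)"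
  by (auto simp: heavy_upto_def mem_tile_iff tile_index_in_indices)

lemma heavy_upto_sets [measurable]: "heavy_upto N M \<in> sets \<mu>"
  unfolding heavy_upto_eq_UN by (intro sets.countable_UN' sets.finite_UN) auto

lemma heavy_eq_UN_upto: "heavy M = (\<Union>N. heavy_upto N M)"
proof -
  have "\<exists>N. \<forall>i. k i \<le> N" for k :: "'n \<Rightarrow> nat"
    using Max_ge[of "range k"] by (intro exI[of _ "Max (range k)"]) auto
  then show ?thesis by (auto simp: heavy_def heavy_upto_def) metis
qed

lemma heavy_sets [measurable]: "heavy M \<in> sets \<mu>"
  unfolding heavy_eq_UN_upto by (intro sets.countable_UN) auto

lemma tile_eq_UN_block:
  assumes x: "x \<in> unit_cube" and kN: "\<And>i. k i \<le> N" and w: "\<And>i. tile_index (\<lambda>_. N) x i = int (w i)"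
  shows "tile k (tile_index k x) = (\<Union>w'\<in>block (\<lambda>i. N - k i) w. tile (\<lambda>_. N) (\<lambda>i. int (w' i)))"
proof (intro set_eqI iffI)
  fix y assume "y \<in> tile k (tile_index k x)"
  then have y: "y \<in> unit_cube" "tile_index k y = tile_index k x" by (auto simp: mem_tile_iff)
  define w' where "w' i = nat (tile_index (\<lambda>_. N) y i)" for i
  have w': "int (w' i) = tile_index (\<lambda>_. N) y i" for i
    using tile_index_in_indices[OF y(1), of "\<lambda>_. N"] by (auto simp: w'_def tile_indices_def PiE_iff)
  have "w' i div 2 ^ (N - k i) = w i div 2 ^ (N - k i)" for i
  proof -
    have "int (w' i) div 2 ^ (N - k i) = int (w i) div 2 ^ (N - k i)"
      using tile_index_coarsen[of k i "\<lambda>_. N" x] tile_index_coarsen[of k i "\<lambda>_. N" y] kN[of i] y w w' by simp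
    then have "int (w' i div 2 ^ (N - k i)) = int (w i div 2 ^ (N - k i))" by (simp add: zdiv_int)
    then show ?thesis by linarith
  qed
  then show "y \<in> (\<Union>w'\<in>block (\<lambda>i. N - k i) w. tile (\<lambda>_. N) (\<lambda>i. int (w' i)))"
    using y w' by (intro UN_I[of w']) (auto simp: block_def mem_tile_iff fun_eq_iff)
next
  fix y assume "y \<in> (\<Union>w'\<in>block (\<lambda>i. N - k i) w. tile (\<lambda>_. N) (\<lambda>i. int (w' i)))"
  then obtain w' where w'_block: "w' \<in> block (\<lambda>i. N - k i) w" and yt: "y \<in> tile (\<lambda>_. N) (\<lambda>i. int (w' i))"
    by blast
  have b: "w' i div 2 ^ (N - k i) = w i div 2 ^ (N - k i)" for i using w'_block by (simp add: block_def)
  have y: "y \<in> unit_cube" and w': "tile_index (\<lambda>_. N) y i = int (w' i)" for i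
    using yt by (auto simp: mem_tile_iff)
  have "tile_index k y i = tile_index k x i" for i
  proof -
    have "int (w' i div 2 ^ (N - k i)) = int (w i div 2 ^ (N - k i))" using b by simp
    then have "int (w' i) div 2 ^ (N - k i) = int (w i) div 2 ^ (N - k i)" by (simp add: zdiv_int)
    then show ?thesis
      using tile_index_coarsen[of k i "\<lambda>_. N" x] tile_index_coarsen[of k i "\<lambda>_. N" y] kN[of i] w w' by simp
  qed
  then show "y \<in> tile k (tile_index k x)" using y by (auto simp: mem_tile_iff fun_eq_iff)
qed

lemma sum_average_powr_le:
  assumes "finite Z"
  shows "(\<Sum>z\<in>Z. (prob (tile k z) / tile_volume k) powr q) * tile_volume k \<le> powr_integral"
proof -
  have "(\<Sum>z\<in>Z. (prob (tile k z) / tile_volume k) powr q) * tile_volume k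
     \<le> (\<Sum>z\<in>Z. \<integral>x. indicator (tile k z) x * h x powr q \<partial>cube_lebesgue)"
    unfolding sum_distrib_right
    by (intro sum_mono average_powr_le tile_sets emeasure_tile_le tile_volume_pos)
  also have "\<dots> = (\<integral>x. (\<Sum>z\<in>Z. indicator (tile k z) x * h x powr q) \<partial>cube_lebesgue)"
    by (intro Bochner_Integration.integral_sum[symmetric] integrable_indicator_powr tile_sets)
  also have "\<dots> \<le> powr_integral"
    unfolding powr_integral_def
  proof (intro integral_mono Bochner_Integration.integrable_sum integrable_indicator_powr tile_sets integrable_powr)
    fix x :: "real^'n"
    have "(\<Sum>z\<in>Z. indicator (tile k z) x * h x powr q) = (\<Sum>z\<in>Z. indicator (tile k z) x) * h x powr q"
      by (simp add: sum_distrib_right)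
    also have "(\<Sum>z\<in>Z. indicator (tile k z) x) = (indicator (\<Union>z\<in>Z. tile k z) x :: real)"
      by (rule indicator_UN_disjoint[symmetric]) (use assms disjoint_family_tile in auto)
    also have "\<dots> * h x powr q \<le> 1 * h x powr q"
      by (intro mult_right_mono) (auto simp: indicator_def)
    finally show "(\<Sum>z\<in>Z. indicator (tile k z) x * h x powr q) \<le> h x powr q" by simp
  qed
  finally show ?thesis .
qed

definition maximal_constant :: real where
  "maximal_constant = (2 powr q / (q - 1)) ^ CARD('n) * powr_integral"

text \<open>
  With levels bounded by \<open>N\<close>, only the masses of the cells of side \<open>2\<^sup>-\<^sup>N\<close> matter, and the weak type
  bound follows from the maximal theorem on the finite grid. The constant does not depend on \<open>N\<close>.
\<close>

lemma emeasure_heavy_upto_le: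
  assumes "0 < M"
  shows "emeasure lborel (heavy_upto N M) \<le> ennreal (maximal_constant / M powr q)"
proof -
  let ?t = "\<lambda>w. tile (\<lambda>_::'n. N) (\<lambda>i. int (w i))"
  let ?v = "tile_volume (\<lambda>_::'n. N)"
  define g where "g w = prob (?t w) / ?v" for w
  have gnn: "0 \<le> g w" for w using tile_volume_pos[of "\<lambda>_::'n. N"] by (simp add: g_def)
  obtain G where G0: "\<forall>z. 0 \<le> G z"
    and G1: "\<forall>z\<in>grid N. \<forall>l. (\<forall>i. l i \<le> N) \<longrightarrow> (\<Sum>w\<in>block l z. g w) / (\<Prod>i\<in>UNIV. 2 ^ l i) \<le> G z"
    and G2: "(\<Sum>z\<in>grid N. G z powr q) \<le> (2 powr q / (q - 1)) ^ CARD('n) * (\<Sum>z\<in>grid N. g z powr q)"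
    by (rule strong_dyadic_maximal[of q g N, OF q_gt_1 gnn])
  define B where "B = {z \<in> grid N. M < G z}"
  \<comment> \<open>Tile indices run up to \<open>2\<^sup>N\<close>, the last value belonging to the upper faces of the cube. These
    are null, and the grid consists of the other indices.\<close>
  let ?face = "(\<Union>i. slab i 1 0) :: (real^'n) set"
  have finB: "finite B" by (simp add: B_def)
  have sub: "heavy_upto N M \<subseteq> (\<Union>w\<in>B. ?t w) \<union> ?face"
  proof
    fix x assume "x \<in> heavy_upto N M"
    then obtain k where x: "x \<in> unit_cube" and k: "\<And>i. k i \<le> N"
      and heavy: "M * tile_volume k < prob (tile k (tile_index k x))"
      by (auto simp: heavy_upto_def)
    show "x \<in> (\<Union>w\<in>B. ?t w) \<union> ?face"
    proof (cases "\<exists>i. x $ i = 1")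
      case False
      define w where "w i = nat (tile_index (\<lambda>_. N) x i)" for i
      have w: "tile_index (\<lambda>_. N) x i = int (w i)" for i
        using tile_index_in_indices[OF x, of "\<lambda>_. N"] by (auto simp: w_def tile_indices_def PiE_iff)
      have wlt: "w i < 2 ^ N" for i
      proof -
        have "x $ i < 1" using x False by (metis mem_unit_cube less_eq_real_def)
        then have "tile_index (\<lambda>_. N) x i < 2 ^ N"
          unfolding tile_index_def by (simp add: floor_less_iff)
        then have "int (w i) < int (2 ^ N)" unfolding w by simp
        then show ?thesis by (simp only: of_nat_less_iff)
      qed
      have wg: "w \<in> grid N" using wlt by (simp add: mem_grid)
      let ?b = "block (\<lambda>i. N - k i) w"
      have "prob (tile k (tile_index k x)) = (\<Sum>w'\<in>?b. prob (?t w'))"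
        unfolding tile_eq_UN_block[OF x k w]
        by (rule finite_measure_finite_Union) (auto simp: disjoint_family_on_def mem_tile_iff fun_eq_iff)
      also have "\<dots> = (\<Sum>w'\<in>?b. g w') * ?v"
        using tile_volume_pos[of "\<lambda>_::'n. N"] by (simp add: g_def sum_divide_distrib[symmetric])
      finally have "M * tile_volume k < (\<Sum>w'\<in>?b. g w') * ?v" using heavy by simp
      moreover have "tile_volume k = ?v * (\<Prod>i\<in>UNIV. 2 ^ (N - k i))"
        unfolding tile_volume_def prod.distrib[symmetric]
        using k by (intro prod.cong) (auto simp: power_one_over power_diff)
      ultimately have "?v * (M * (\<Prod>i\<in>UNIV. 2 ^ (N - k i))) < ?v * (\<Sum>w'\<in>?b. g w')"
        by (simp add: algebra_simps)
      then have "M * (\<Prod>i\<in>UNIV. 2 ^ (N - k i)) < (\<Sum>w'\<in>?b. g w')"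
        using tile_volume_pos[of "\<lambda>_::'n. N"] by simp
      then have "M < (\<Sum>w'\<in>?b. g w') / (\<Prod>i\<in>UNIV. 2 ^ (N - k i))"
        by (subst pos_less_divide_eq) (auto intro: prod_pos)
      also have "\<dots> \<le> G w" by (rule G1[rule_format, OF wg]) simp
      finally have "w \<in> B" using wg by (simp add: B_def)
      moreover have "x \<in> ?t w" using x w by (auto simp: mem_tile_iff fun_eq_iff)
      ultimately show ?thesis by blast
    next
      case True
      then show ?thesis using unit_cube_imp_slab[OF x, of _ 1 0] by auto
    qed
  qed
  have "real (card B) * M powr q = (\<Sum>z\<in>B. M powr q)" by simp
  also have "\<dots> \<le> (\<Sum>z\<in>B. G z powr q)"
    using assms q_gt_1 by (intro sum_mono powr_mono2) (auto simp: B_def)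
  also have "\<dots> \<le> (\<Sum>z\<in>grid N. G z powr q)"
    by (intro sum_mono2) (auto simp: B_def)
  also note G2
  finally have "real (card B) * M powr q * ?v \<le> (2 powr q / (q - 1)) ^ CARD('n) * (\<Sum>z\<in>grid N. g z powr q) * ?v"
    using tile_volume_pos[of "\<lambda>_::'n. N"] by (intro mult_right_mono) auto
  also have "\<dots> = (2 powr q / (q - 1)) ^ CARD('n) * ((\<Sum>z\<in>grid N. g z powr q) * ?v)" by simp
  also have "\<dots> \<le> (2 powr q / (q - 1)) ^ CARD('n) * powr_integral"
  proof (rule mult_left_mono)
    have "(\<Sum>z\<in>grid N. g z powr q) = (\<Sum>z\<in>(\<lambda>w i. int (w i)) ` (grid N :: ('n \<Rightarrow> nat) set). (prob (tile (\<lambda>_. N) z) / ?v) powr q)"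
      by (subst sum.reindex) (auto simp: g_def intro: inj_on_subset[OF inj_int_comp])
    then show "(\<Sum>z\<in>grid N. g z powr q) * ?v \<le> powr_integral"
      using sum_average_powr_le[of "(\<lambda>w i. int (w i)) ` (grid N :: ('n \<Rightarrow> nat) set)" "\<lambda>_. N"] by simp
  qed (use q_gt_1 in auto)
  finally have card: "real (card B) * ?v \<le> maximal_constant / M powr q"
    unfolding maximal_constant_def using assms by (subst pos_le_divide_eq) (simp_all add: mult_ac)
  have "emeasure lborel (heavy_upto N M) \<le> emeasure lborel ((\<Union>w\<in>B. ?t w) \<union> ?face)"
    using upper_faces_null finB by (intro emeasure_mono sub sets.Un sets.finite_UN) (auto simp: tile_borel null_setsD2)
  also have "\<dots> = emeasure lborel (\<Union>w\<in>B. ?t w)"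
    by (rule emeasure_Un_null_set) (use upper_faces_null finB in \<open>auto intro!: sets.finite_UN simp: tile_borel\<close>)
  also have "\<dots> \<le> (\<Sum>w\<in>B. emeasure lborel (?t w))"
    using finB by (intro emeasure_subadditive_finite) (auto simp: tile_borel)
  also have "\<dots> \<le> (\<Sum>w\<in>B. ennreal ?v)"
    by (intro sum_mono emeasure_tile_le)
  also have "\<dots> = ennreal (real (card B) * ?v)"
    using tile_volume_pos[of "\<lambda>_::'n. N"] by (simp add: ennreal_mult ennreal_of_nat_eq_real_of_nat less_imp_le)
  also have "\<dots> \<le> ennreal (maximal_constant / M powr q)" using card by (rule ennreal_leI)
  finally show ?thesis .
qed

lemma emeasure_heavy_le:
  assumes "0 < M"
  shows "emeasure lborel (heavy M) \<le> ennreal (maximal_constant / M powr q)"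
proof -
  have "incseq (\<lambda>N. heavy_upto N M)"
    unfolding incseq_def heavy_upto_def by (auto intro: order_trans)
  moreover have "range (\<lambda>N. heavy_upto N M) \<subseteq> sets lborel"
    using heavy_upto_sets by (auto simp: sets_mu_iff)
  ultimately have "emeasure lborel (heavy M) = (SUP N. emeasure lborel (heavy_upto N M))"
    unfolding heavy_eq_UN_upto by (intro SUP_emeasure_incseq[symmetric])
  also have "\<dots> \<le> ennreal (maximal_constant / M powr q)"
    by (intro SUP_least emeasure_heavy_upto_le assms)
  finally show ?thesis .
qed

lemma AE_not_heavy: "AE x in \<mu>. \<exists>n::nat. x \<notin> heavy (real (Suc n))"
proof (rule AE_I[of _ _ "\<Inter>n. heavy (real (Suc n))"])
  let ?I = "\<Inter>n. heavy (real (Suc n))"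
  show "{x \<in> space \<mu>. \<not> (\<exists>n::nat. x \<notin> heavy (real (Suc n)))} \<subseteq> ?I" by auto
  show I: "?I \<in> sets \<mu>" by (intro sets.countable_INT) auto
  have "(\<lambda>n. maximal_constant / real (Suc n) powr q) \<longlonglongrightarrow> 0"
  proof -
    have "(\<lambda>n. (1 + real n) powr - q) \<longlonglongrightarrow> 0"
      using q_gt_1 by (intro tendsto_neg_powr filterlim_tendsto_add_at_top[OF tendsto_const] filterlim_real_sequentially) auto
    then have "(\<lambda>n. maximal_constant * (1 + real n) powr - q) \<longlonglongrightarrow> maximal_constant * 0"
      by (intro tendsto_mult_left)
    then show ?thesis by (simp add: powr_minus_divide)
  qed
  then have "(\<lambda>n. ennreal (maximal_constant / real (Suc n) powr q)) \<longlonglongrightarrow> ennreal 0"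
    by (rule tendsto_ennrealI)
  moreover have "\<forall>n. emeasure lborel ?I \<le> ennreal (maximal_constant / real (Suc n) powr q)"
  proof
    fix n
    have "emeasure lborel ?I \<le> emeasure lborel (heavy (real (Suc n)))"
      using heavy_sets[of "real (Suc n)"] by (intro emeasure_mono) (auto simp: sets_mu_iff)
    then show "emeasure lborel ?I \<le> ennreal (maximal_constant / real (Suc n) powr q)"
      using emeasure_heavy_le[of "real (Suc n)"] by simp
  qed
  ultimately have "emeasure lborel ?I \<le> ennreal 0"
    by (intro LIMSEQ_le_const) auto
  then have "?I \<in> null_sets cube_lebesgue"
    using I emeasure_cube_lebesgue[of ?I] by (intro null_setsI) (auto simp: sets_mu_iff sets_cube_lebesgue_iff)
  moreover have "absolutely_continuous cube_lebesgue \<mu>"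
    unfolding density by (rule absolutely_continuousI_density) simp
  ultimately show "emeasure \<mu> ?I = 0"
    unfolding absolutely_continuous_def by auto
qed

end

section \<open>Mixing with arbitrary Borel targets\<close>

locale mixing_cube = cube_density \<mu> h q
  for \<mu> :: "(real^'n::finite) measure" and h q +
  fixes T :: "real^'n \<Rightarrow> real^'n" and c \<tau> :: real
  assumes T_measurable: "T \<in> measurable \<mu> \<mu>"
    and T_invariant: "distr \<mu> \<mu> T = \<mu>"
    and c_pos: "0 < c" and tau_pos: "0 < \<tau>"
    and mixing_box: "\<And>a b a' b' n. \<bar>prob (half_open_box a b \<inter> (T ^^ n) -` half_open_box a' b')
        - prob (half_open_box a b) * prob (half_open_box a' b')\<bar>
      \<le> c * prob (half_open_box a' b') * exp (- \<tau> * real n)"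
begin

lemma half_open_box_sets [measurable, simp]: "half_open_box a b \<in> sets \<mu>"
  by (simp add: sets_mu_iff half_open_box_borel half_open_box_subset_unit_cube)

lemma funpow_measurable [measurable]: "(T ^^ n) \<in> measurable \<mu> \<mu>"
proof (induction n)
  case (Suc n)
  then show ?case using T_measurable by (simp add: measurable_comp)
qed simp

lemma distr_funpow: "distr \<mu> \<mu> (T ^^ n) = \<mu>"
proof (induction n)
  case 0
  show ?case by (simp add: distr_id)
next
  case (Suc n)
  have "distr \<mu> \<mu> (T ^^ Suc n) = distr (distr \<mu> \<mu> (T ^^ n)) \<mu> T"
    using T_measurable by (subst distr_distr) auto
  then show ?case unfolding Suc T_invariant .
qed

lemma funpow_in_cube: "x \<in> unit_cube \<Longrightarrow> (T ^^ n) x \<in> unit_cube"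
  using measurable_space[OF funpow_measurable, of x n] by simp

lemma Int_vimage_sets:
  assumes "F \<in> sets \<mu>" "G \<in> sets \<mu>"
  shows "F \<inter> (T ^^ n) -` G \<in> sets \<mu>"
proof -
  have "F \<inter> (T ^^ n) -` G = F \<inter> ((T ^^ n) -` G \<inter> space \<mu>)"
    using sets.sets_into_space[OF assms(1)] by auto
  also have "\<dots> \<in> sets \<mu>" using assms by (intro sets.Int measurable_sets[OF funpow_measurable])
  finally show ?thesis .
qed

lemma measure_vimage:
  assumes "G \<in> sets \<mu>"
  shows "prob (unit_cube \<inter> (T ^^ n) -` G) = prob G"
  using measure_distr[OF funpow_measurable assms, of n] distr_funpow[of n] by (simp add: Int_commute)

lemma measure_Int_vimage_le:
  assumes "F \<in> sets \<mu>" "G \<in> sets \<mu>"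
  shows "prob (F \<inter> (T ^^ n) -` G) \<le> prob G"
proof -
  have "prob (F \<inter> (T ^^ n) -` G) \<le> prob (unit_cube \<inter> (T ^^ n) -` G)"
    using assms sets.top[of \<mu>] by (intro finite_measure_mono Int_vimage_sets) (auto simp: sets_mu_iff)
  then show ?thesis using measure_vimage[OF assms(2)] by simp
qed

definition mixing_err :: "nat \<Rightarrow> real" where "mixing_err n = c * exp (- \<tau> * real n)"

lemma mixing_err_pos: "0 < mixing_err n" using c_pos by (simp add: mixing_err_def)

lemma mixing_box_upper:
  "prob (half_open_box a b \<inter> (T ^^ n) -` half_open_box a' b')
     \<le> (prob (half_open_box a b) + mixing_err n) * prob (half_open_box a' b')"
  using mixing_box[of a b n a' b'] by (simp add: mixing_err_def abs_le_iff algebra_simps)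

lemma mixing_box_lower:
  "(prob (half_open_box a b) - mixing_err n) * prob (half_open_box a' b')
     \<le> prob (half_open_box a b \<inter> (T ^^ n) -` half_open_box a' b')"
  using mixing_box[of a b n a' b'] by (simp add: mixing_err_def abs_le_iff algebra_simps)

text \<open>
  The cubes of side \<open>2\<^sup>-\<^sup>N\<close> that meet \<open>K\<close>. For compact \<open>K\<close> they decrease to \<open>K\<close>, which gives the passage
  from boxes to Borel sets.
\<close>

definition tile_hull :: "nat \<Rightarrow> (real^'n) set \<Rightarrow> (real^'n) set" where
  "tile_hull N K = (\<Union>z\<in>tile_index (\<lambda>_. N) ` K. tile (\<lambda>_. N) z)"

lemma finite_tile_index_image:
  assumes "K \<subseteq> unit_cube"
  shows "finite (tile_index k ` K)"
  by (rule finite_subset[OF _ finite_tile_indices[of k]]) (use assms tile_index_in_indices in blast)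

lemma tile_hull_sets: "K \<subseteq> unit_cube \<Longrightarrow> tile_hull N K \<in> sets \<mu>"
  unfolding tile_hull_def by (intro sets.finite_UN finite_tile_index_image) auto

lemma subset_tile_hull: "K \<subseteq> unit_cube \<Longrightarrow> K \<subseteq> tile_hull N K"
  by (auto simp: tile_hull_def mem_tile_iff)

lemma measure_tile_hull_tendsto:
  assumes "compact K" "K \<subseteq> unit_cube"
  shows "(\<lambda>N. prob (tile_hull N K)) \<longlonglongrightarrow> prob K"
proof -
  have "decseq (\<lambda>N. tile_hull N K)"
    unfolding decseq_Suc_iff
  proof (intro allI subsetI)
    fix N y assume "y \<in> tile_hull (Suc N) K"
    then obtain x where x: "x \<in> K" "y \<in> unit_cube" and e: "tile_index (\<lambda>_. Suc N) y = tile_index (\<lambda>_. Suc N) x"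
      by (auto simp: tile_hull_def mem_tile_iff)
    have "tile_index (\<lambda>_. N) y = tile_index (\<lambda>_. N) x"
    proof
      fix i show "tile_index (\<lambda>_. N) y i = tile_index (\<lambda>_. N) x i"
        using tile_index_coarsen[of "\<lambda>_. N" i "\<lambda>_. Suc N" y] tile_index_coarsen[of "\<lambda>_. N" i "\<lambda>_. Suc N" x] e by simp
    qed
    then show "y \<in> tile_hull N K" using x by (auto simp: tile_hull_def mem_tile_iff)
  qed
  moreover have "(\<Inter>N. tile_hull N K) = K"
  proof
    show "K \<subseteq> (\<Inter>N. tile_hull N K)" using subset_tile_hull[OF assms(2)] by auto
    show "(\<Inter>N. tile_hull N K) \<subseteq> K"
    proof
      fix y assume y: "y \<in> (\<Inter>N. tile_hull N K)"
      have "\<exists>x\<in>K. dist x y \<le> real CARD('n) * (1/2) ^ N" for N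
      proof -
        obtain x where "x \<in> K" "y \<in> tile (\<lambda>_. N) (tile_index (\<lambda>_. N) x)"
          using y by (auto simp: tile_hull_def)
        moreover have "x \<in> tile (\<lambda>_. N) (tile_index (\<lambda>_. N) x)"
          using \<open>x \<in> K\<close> assms by (auto simp: mem_tile_iff)
        ultimately show ?thesis using dist_tile_le by blast
      qed
      then obtain x where x: "\<And>N. x N \<in> K" "\<And>N. dist (x N) y \<le> real CARD('n) * (1/2) ^ N" by metis
      have "(\<lambda>N. dist (x N) y) \<longlonglongrightarrow> 0"
      proof (rule tendsto_sandwich[OF _ _ tendsto_const])
        have "(\<lambda>N. real CARD('n) * (1/2) ^ N) \<longlonglongrightarrow> real CARD('n) * 0"
          by (intro tendsto_mult_left LIMSEQ_realpow_zero) auto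
        then show "(\<lambda>N. real CARD('n) * (1/2) ^ N) \<longlonglongrightarrow> 0" by simp
      qed (use x in auto)
      then have "x \<longlonglongrightarrow> y" by (rule tendsto_dist_iff[THEN iffD2])
      then show "y \<in> K" by (rule closed_sequentially[OF compact_imp_closed[OF assms(1)] x(1)])
    qed
  qed
  moreover have "range (\<lambda>N. tile_hull N K) \<subseteq> sets \<mu>" using tile_hull_sets[OF assms(2)] by auto
  ultimately show ?thesis using finite_Lim_measure_decseq[of "\<lambda>N. tile_hull N K"] by simp
qed

lemma inner_regular_compact:
  assumes "A \<in> sets \<mu>" "0 < e"
  obtains K where "compact K" "K \<subseteq> A" "prob (A - K) < e"
proof -
  let ?D = "distr \<mu> borel (\<lambda>x. x)"
  have id: "(\<lambda>x. x) \<in> measurable \<mu> borel"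
    by (rule measurableI) (auto simp: sets_mu_iff unit_cube_borel)
  have D: "emeasure ?D B = emeasure \<mu> (B \<inter> unit_cube)" if "B \<in> sets borel" for B
    using emeasure_distr[OF id that] by simp
  have A: "A \<in> sets borel" "A \<subseteq> unit_cube" using assms by (auto simp: sets_mu_iff)
  have "emeasure ?D A = (SUP K\<in>{K. K \<subseteq> A \<and> compact K}. emeasure ?D K)"
    by (rule inner_regular) (use A D[of UNIV] in auto)
  then have SUP: "emeasure \<mu> A = (SUP K\<in>{K. K \<subseteq> A \<and> compact K}. emeasure ?D K)"
    using D[of A] A by (simp add: Int_absorb2)
  show ?thesis
  proof (cases "prob A < e")
    case True
    then show ?thesis by (intro that[of "{}"]) auto
  next
    case False
    then have "ennreal (prob A - e) < emeasure \<mu> A"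
      using assms by (simp add: emeasure_eq_measure ennreal_less_iff)
    then obtain K where K: "K \<subseteq> A" "compact K" and lt: "ennreal (prob A - e) < emeasure ?D K"
      unfolding SUP less_SUP_iff by auto
    have Ks: "K \<in> sets \<mu>" using K A by (auto simp: sets_mu_iff intro: borel_compact)
    have "emeasure ?D K = ennreal (prob K)"
      using D[of K] K A Ks by (simp add: Int_absorb2 borel_compact emeasure_eq_measure)
    then have "prob A - e < prob K"
      using lt False by (simp add: ennreal_less_iff)
    then have "prob (A - K) < e"
      using finite_measure_Diff[OF assms(1) Ks K(1)] by simp
    then show ?thesis using K that by blast
  qed
qed

text \<open>
  The upper mixing bound for a target \<open>G\<close> is linear in the measure of \<open>G\<close>, so it adds up over disjoint
  boxes. It therefore holds for tile hulls, in the limit for compact sets, and by inner regularity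
  for Borel sets.
\<close>

lemma mixing_upper:
  assumes G: "G \<in> sets \<mu>"
  shows "prob (half_open_box a b \<inter> (T ^^ n) -` G) \<le> (prob (half_open_box a b) + mixing_err n) * prob G"
proof (rule field_le_epsilon)
  fix e :: real assume "0 < e"
  let ?F = "half_open_box a b"
  let ?k = "prob ?F + mixing_err n"
  \<comment> \<open>The preimage of \<open>G - K\<close> has the measure of \<open>G - K\<close>, so approximating \<open>G\<close> controls the preimage too.\<close>
  obtain K where K: "compact K" "K \<subseteq> G" "prob (G - K) < e"
    using inner_regular_compact[OF G \<open>0 < e\<close>] .
  have Kc: "K \<subseteq> unit_cube" using K G by (auto simp: sets_mu_iff)
  have Ks: "K \<in> sets \<mu>" using K Kc by (auto simp: sets_mu_iff borel_compact)
  have "prob (?F \<inter> (T ^^ n) -` K) \<le> ?k * prob (tile_hull N K)" for N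
  proof -
    let ?Z = "tile_index (\<lambda>_. N) ` K"
    have fin: "finite ?Z" by (rule finite_tile_index_image[OF Kc])
    have "?F \<inter> (T ^^ n) -` K \<subseteq> (\<Union>z\<in>?Z. ?F \<inter> (T ^^ n) -` tile (\<lambda>_. N) z)"
      using subset_tile_hull[OF Kc, of N] unfolding tile_hull_def by blast
    then have "prob (?F \<inter> (T ^^ n) -` K) \<le> prob (\<Union>z\<in>?Z. ?F \<inter> (T ^^ n) -` tile (\<lambda>_. N) z)"
      using fin by (intro finite_measure_mono sets.finite_UN Int_vimage_sets) auto
    also have "\<dots> \<le> (\<Sum>z\<in>?Z. prob (?F \<inter> (T ^^ n) -` tile (\<lambda>_. N) z))"
      by (intro measure_subadditive_finite fin) (auto intro!: Int_vimage_sets)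
    also have "\<dots> \<le> (\<Sum>z\<in>?Z. ?k * prob (tile (\<lambda>_. N) z))"
      unfolding tile_eq_half_open_box by (intro sum_mono mixing_box_upper)
    also have "\<dots> = ?k * (\<Sum>z\<in>?Z. prob (tile (\<lambda>_. N) z))" by (simp add: sum_distrib_left)
    also have "(\<Sum>z\<in>?Z. prob (tile (\<lambda>_. N) z)) = prob (tile_hull N K)"
      unfolding tile_hull_def by (rule finite_measure_finite_Union[symmetric]) (auto simp: fin disjoint_family_tile)
    finally show ?thesis .
  qed
  then have "prob (?F \<inter> (T ^^ n) -` K) \<le> ?k * prob K"
    by (intro LIMSEQ_le_const[OF tendsto_mult_left[OF measure_tile_hull_tendsto[OF K(1) Kc]]]) auto
  also have "\<dots> \<le> ?k * prob G"
    using mixing_err_pos[of n] K G by (intro mult_left_mono finite_measure_mono) (auto intro: add_nonneg_nonneg)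
  finally have 1: "prob (?F \<inter> (T ^^ n) -` K) \<le> ?k * prob G" .
  have "?F \<inter> (T ^^ n) -` G = (?F \<inter> (T ^^ n) -` K) \<union> (?F \<inter> (T ^^ n) -` (G - K))"
    using K by auto
  then have "prob (?F \<inter> (T ^^ n) -` G) \<le> prob (?F \<inter> (T ^^ n) -` K) + prob (?F \<inter> (T ^^ n) -` (G - K))"
    using G Ks by (simp only:) (intro measure_Un_le Int_vimage_sets sets.Diff half_open_box_sets)
  also have "prob (?F \<inter> (T ^^ n) -` (G - K)) \<le> prob (G - K)"
    using G Ks by (intro measure_Int_vimage_le) auto
  finally show "prob (?F \<inter> (T ^^ n) -` G) \<le> ?k * prob G + e"
    using 1 K(3) by simp
qed

lemma tile_approximation:
  assumes "W \<in> sets \<mu>" "0 < e"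
  obtains N Z where "Z \<subseteq> tile_indices (\<lambda>_. N)"
    "prob (W - (\<Union>z\<in>Z. tile (\<lambda>_. N) z)) < e" "prob ((\<Union>z\<in>Z. tile (\<lambda>_. N) z) - W) < e"
proof -
  obtain K where K: "compact K" "K \<subseteq> W" "prob (W - K) < e"
    using inner_regular_compact[OF assms] .
  have Kc: "K \<subseteq> unit_cube" using K assms by (auto simp: sets_mu_iff)
  have Ks: "K \<in> sets \<mu>" using K Kc by (auto simp: sets_mu_iff borel_compact)
  have "\<forall>\<^sub>F N in sequentially. prob (tile_hull N K) < prob K + e"
    using assms by (intro order_tendstoD[OF measure_tile_hull_tendsto[OF K(1) Kc]]) auto
  then obtain N where N: "prob (tile_hull N K) < prob K + e"
    by (auto simp: eventually_sequentially)
  let ?V = "tile_hull N K"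
  have V: "?V \<in> sets \<mu>" "K \<subseteq> ?V" using tile_hull_sets[OF Kc] subset_tile_hull[OF Kc] by auto
  show ?thesis
  proof (rule that[of "tile_index (\<lambda>_. N) ` K" N])
    show "tile_index (\<lambda>_. N) ` K \<subseteq> tile_indices (\<lambda>_. N)" using Kc tile_index_in_indices by blast
    have "prob (W - ?V) \<le> prob (W - K)"
      using V assms Ks by (intro finite_measure_mono) auto
    then show "prob (W - (\<Union>z\<in>tile_index (\<lambda>_. N) ` K. tile (\<lambda>_. N) z)) < e"
      using K by (simp add: tile_hull_def)
    have "prob (?V - W) \<le> prob (?V - K)"
      using V assms Ks K by (intro finite_measure_mono) auto
    also have "\<dots> = prob ?V - prob K" using V Ks by (intro finite_measure_Diff) auto
    finally show "prob ((\<Union>z\<in>tile_index (\<lambda>_. N) ` K. tile (\<lambda>_. N) z) - W) < e"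
      using N by (simp add: tile_hull_def)
  qed
qed

end

section \<open>Convergent volume sums\<close>

text \<open>
  The least level whose tiles have side at most \<open>r\<close>.
\<close>

lemma dyadic_level_exists:
  fixes r :: real
  assumes "0 < r" "r < 1"
  shows "\<exists>k::nat. (1/2) ^ k \<le> r \<and> r < 2 * (1/2) ^ k"
proof -
  let ?P = "\<lambda>k. (1/2::real) ^ k \<le> r"
  have "\<exists>k. ?P k" using real_arch_pow_inv[of r "1/2"] assms by (auto intro: less_imp_le)
  then have L: "?P (LEAST k. ?P k)" by (rule LeastI_ex)
  define k where "k = (LEAST k. ?P k)"
  have "k \<noteq> 0" using L assms unfolding k_def[symmetric] by (cases k) auto
  then obtain j where j: "k = Suc j" by (cases k) auto
  then have "\<not> ?P j" using not_less_Least[of j ?P] by (simp add: k_def)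
  then show ?thesis using L unfolding k_def[symmetric] by (intro exI[of _ k]) (auto simp: j)
qed

context mixing_cube
begin

lemma ident_measurable: "(\<lambda>x. x) \<in> measurable \<mu> borel"
  by (rule measurableI) (auto simp: sets_mu_iff unit_cube_borel)

lemma return_set_sets: "{x \<in> unit_cube. (T ^^ n) x \<in> open_rectangle x r} \<in> sets \<mu>"
proof -
  have nth: "(\<lambda>x::real^'n. x $ i) \<in> borel_measurable borel" for i
    by (intro borel_measurable_continuous_onI continuous_intros)
  have [measurable]: "(\<lambda>x. x $ i) \<in> borel_measurable \<mu>" for i
    using measurable_compose[OF ident_measurable nth] .
  have [measurable]: "(\<lambda>x. (T ^^ n) x $ i) \<in> borel_measurable \<mu>" for i
    using measurable_compose[OF measurable_compose[OF funpow_measurable ident_measurable] nth] .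
  have "{x \<in> space \<mu>. \<forall>i. \<bar>(T ^^ n) x $ i - x $ i\<bar> < r $ i} \<in> sets \<mu>"
    by measurable
  then show ?thesis by (simp add: open_rectangle_def)
qed

lemma recurrence_set_sets: "recurrence_set T r \<in> sets \<mu>"
  unfolding recurrence_set_def
  by (intro sets.countable_INT' image_subsetI sets.countable_UN' return_set_sets) auto

lemma sum_measure_tile_le_1:
  assumes "finite Z"
  shows "(\<Sum>z\<in>Z. prob (tile k z)) \<le> 1"
proof -
  have "(\<Sum>z\<in>Z. prob (tile k z)) = prob (\<Union>z\<in>Z. tile k z)"
    by (rule finite_measure_finite_Union[symmetric]) (auto simp: assms disjoint_family_tile)
  then show ?thesis by simp
qed

text \<open>
  A return to within \<open>2 \<cdot> 2\<^sup>-\<^sup>k\<close> changes each coordinate of the tile index by at most two, so \<open>T\<^sup>n x\<close>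
  lies in one of \<open>5\<^sup>d\<close> shifted copies of the tile of \<open>x\<close>. Only the tile of \<open>x\<close> has to be light: the
  masses of the target tiles are summed over all tiles, which gives at most one for each shift.
\<close>

lemma measure_return_not_heavy:
  assumes r: "\<And>i. r $ i < 2 * (1/2) ^ k i" and M: "0 \<le> M"
  shows "prob {x \<in> unit_cube. x \<notin> heavy M \<and> (T ^^ n) x \<in> open_rectangle x r}
    \<le> 5 ^ CARD('n) * (M * tile_volume k + mixing_err n)"
proof -
  let ?E = "\<Pi>\<^sub>E i\<in>(UNIV::'n set). {-2..2::int}"
  define J where "J = {z \<in> tile_indices k. prob (tile k z) \<le> M * tile_volume k}"
  let ?s = "\<lambda>z e i. z i + e i :: int"
  have finE: "finite ?E" by (simp add: finite_PiE)
  have finJ: "finite J" by (simp add: J_def)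
  have "{x \<in> unit_cube. x \<notin> heavy M \<and> (T ^^ n) x \<in> open_rectangle x r}
    \<subseteq> (\<Union>e\<in>?E. \<Union>z\<in>J. tile k z \<inter> (T ^^ n) -` tile k (?s z e))"
  proof safe
    fix x assume x: "x \<in> unit_cube" "x \<notin> heavy M" "(T ^^ n) x \<in> open_rectangle x r"
    let ?z = "tile_index k x"
    define e where "e i = tile_index k ((T ^^ n) x) i - ?z i" for i
    have "e i \<in> {-2..2}" for i
    proof -
      have "\<bar>(T ^^ n) x $ i - x $ i\<bar> < 2 * (1/2) ^ k i"
        using x(3) r[of i] by (auto simp: open_rectangle_def intro: less_trans)
      then have "2 ^ k i * \<bar>(T ^^ n) x $ i - x $ i\<bar> < 2 ^ k i * (2 * (1/2) ^ k i)"
        by (intro mult_strict_left_mono) auto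
      also have "\<dots> = 2" by (simp add: power_one_over)
      finally have "\<bar>2 ^ k i * (T ^^ n) x $ i - 2 ^ k i * x $ i\<bar> < 2"
        by (simp add: abs_mult right_diff_distrib[symmetric])
      then show ?thesis unfolding e_def tile_index_def by (simp add: abs_less_iff) linarith
    qed
    then have "e \<in> ?E" by (simp add: PiE_UNIV_domain)
    moreover have "?z \<in> J"
      using x by (auto simp: J_def heavy_def tile_index_in_indices not_less)
    moreover have "x \<in> tile k ?z" "(T ^^ n) x \<in> tile k (?s ?z e)"
      using x funpow_in_cube by (auto simp: mem_tile_iff e_def)
    ultimately show "x \<in> (\<Union>e\<in>?E. \<Union>z\<in>J. tile k z \<inter> (T ^^ n) -` tile k (?s z e))" by blast
  qed
  then have "prob {x \<in> unit_cube. x \<notin> heavy M \<and> (T ^^ n) x \<in> open_rectangle x r}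
    \<le> prob (\<Union>e\<in>?E. \<Union>z\<in>J. tile k z \<inter> (T ^^ n) -` tile k (?s z e))"
    by (intro finite_measure_mono sets.finite_UN finE finJ Int_vimage_sets tile_sets)
  also have "\<dots> \<le> (\<Sum>e\<in>?E. prob (\<Union>z\<in>J. tile k z \<inter> (T ^^ n) -` tile k (?s z e)))"
    by (intro measure_subadditive_finite finE image_subsetI) (auto intro!: sets.finite_UN finJ Int_vimage_sets)
  also have "\<dots> \<le> (\<Sum>e\<in>?E. M * tile_volume k + mixing_err n)"
  proof (rule sum_mono)
    fix e
    have "prob (\<Union>z\<in>J. tile k z \<inter> (T ^^ n) -` tile k (?s z e))
        \<le> (\<Sum>z\<in>J. prob (tile k z \<inter> (T ^^ n) -` tile k (?s z e)))"
      by (intro measure_subadditive_finite finJ image_subsetI) (auto intro!: Int_vimage_sets)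
    also have "\<dots> \<le> (\<Sum>z\<in>J. (M * tile_volume k + mixing_err n) * prob (tile k (?s z e)))"
    proof (rule sum_mono)
      fix z assume z: "z \<in> J"
      have "prob (tile k z \<inter> (T ^^ n) -` tile k (?s z e))
         \<le> (prob (tile k z) + mixing_err n) * prob (tile k (?s z e))"
        unfolding tile_eq_half_open_box by (rule mixing_box_upper)
      also have "\<dots> \<le> (M * tile_volume k + mixing_err n) * prob (tile k (?s z e))"
        using z by (intro mult_right_mono) (auto simp: J_def)
      finally show "prob (tile k z \<inter> (T ^^ n) -` tile k (?s z e))
         \<le> (M * tile_volume k + mixing_err n) * prob (tile k (?s z e))" .
    qed
    also have "\<dots> = (M * tile_volume k + mixing_err n) * (\<Sum>z\<in>(\<lambda>z. ?s z e) ` J. prob (tile k z))"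
    proof -
      have "inj_on (\<lambda>z. ?s z e) J" by (auto simp: inj_on_def fun_eq_iff)
      then show ?thesis by (simp add: sum.reindex sum_distrib_left)
    qed
    also have "\<dots> \<le> (M * tile_volume k + mixing_err n) * 1"
      using M tile_volume_pos[of k] mixing_err_pos[of n] finJ
      by (intro mult_left_mono sum_measure_tile_le_1) auto
    finally show "prob (\<Union>z\<in>J. tile k z \<inter> (T ^^ n) -` tile k (?s z e)) \<le> M * tile_volume k + mixing_err n" by simp
  qed
  also have "\<dots> = 5 ^ CARD('n) * (M * tile_volume k + mixing_err n)"
    by (simp add: card_PiE)
  finally show ?thesis .
qed

lemma summable_mixing_err: "summable mixing_err"
proof -
  have "mixing_err n = c * exp (- \<tau>) ^ n" for n by (simp add: mixing_err_def exp_of_nat_mult[symmetric] mult.commute)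
  then have "mixing_err = (\<lambda>n. c * exp (- \<tau>) ^ n)" by auto
  then show ?thesis using tau_pos by (auto intro!: summable_mult summable_geometric)
qed

lemma eventually_component_less:
  assumes "(\<lambda>n. infnorm (r n :: real^'n)) \<longlonglongrightarrow> 0" "0 < e"
  shows "\<forall>\<^sub>F n in sequentially. \<forall>i. r n $ i < e"
proof -
  have "\<forall>\<^sub>F n in sequentially. infnorm (r n) < e"
    using assms by (rule order_tendstoD)
  then show ?thesis
  proof eventually_elim
    case (elim n)
    then show ?case using component_le_infnorm_cart[of "r n"] by (meson abs_ge_self le_less_trans order_trans)
  qed
qed

text \<open>
  The returns outside \<open>heavy M\<close> have summable measures, so almost surely finitely many of them
  occur. Almost every point lies outside \<open>heavy M\<close> for some \<open>M\<close>.
\<close>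

theorem recurrence_set_null:
  assumes nonneg: "\<And>n i. n \<ge> 1 \<Longrightarrow> 0 \<le> r n $ i"
    and lim: "(\<lambda>n. infnorm (r n :: real^'n)) \<longlonglongrightarrow> 0"
    and sum: "summable (\<lambda>n. \<Prod>i\<in>UNIV. r (Suc n) $ i)"
  shows "prob (recurrence_set T r) = 0"
proof -
  define A where "A M n = {x \<in> unit_cube. x \<notin> heavy M \<and> (T ^^ n) x \<in> open_rectangle x (r n)}" for M n
  have A_sets: "A M n \<in> sets \<mu>" for M n
  proof -
    have "A M n = {x \<in> unit_cube. (T ^^ n) x \<in> open_rectangle x (r n)} - heavy M" by (auto simp: A_def)
    then show ?thesis using return_set_sets heavy_sets by auto
  qed
  have sumA: "summable (\<lambda>n. prob (A M n))" if M: "0 \<le> M" for M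
  proof -
    have "\<forall>\<^sub>F n in sequentially. norm (prob (A M n)) \<le> 5 ^ CARD('n) * (M * (\<Prod>i\<in>UNIV. r n $ i) + mixing_err n)"
      using eventually_component_less[OF lim zero_less_one] eventually_ge_at_top[of 1]
    proof eventually_elim
      case (elim n)
      show ?case
      proof (cases "\<forall>i. 0 < r n $ i")
        case True
        then have "\<forall>i. \<exists>k::nat. (1/2) ^ k \<le> r n $ i \<and> r n $ i < 2 * (1/2) ^ k"
          using elim dyadic_level_exists by blast
        then obtain k where k: "\<And>i. (1/2) ^ k i \<le> r n $ i" "\<And>i. r n $ i < 2 * (1/2) ^ k i" by metis
        have "prob (A M n) \<le> 5 ^ CARD('n) * (M * tile_volume k + mixing_err n)"
          unfolding A_def by (rule measure_return_not_heavy[OF k(2) M])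
        also have "\<dots> \<le> 5 ^ CARD('n) * (M * (\<Prod>i\<in>UNIV. r n $ i) + mixing_err n)"
          unfolding tile_volume_def using k(1) M by (intro mult_left_mono add_right_mono prod_mono) auto
        finally show ?thesis by simp
      next
        case False
        then obtain i where "r n $ i \<le> 0" by (auto simp: not_less)
        then have "A M n = {}"
          by (auto simp: A_def open_rectangle_def) (metis abs_ge_zero le_less_trans not_less)
        moreover have "0 \<le> (\<Prod>i\<in>UNIV. r n $ i)" using nonneg elim by (intro prod_nonneg) auto
        ultimately show ?thesis using M mixing_err_pos[of n] by simp
      qed
    qed
    moreover have "summable (\<lambda>n. 5 ^ CARD('n) * (M * (\<Prod>i\<in>UNIV. r n $ i) + mixing_err n))"
      using sum summable_Suc_iff[of "\<lambda>n. \<Prod>i\<in>UNIV. r n $ i"]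
      by (intro summable_mult summable_add summable_mixing_err) auto
    ultimately show ?thesis by (rule summable_comparison_test_ev)
  qed
  have "AE x in \<mu>. \<forall>j::nat. \<forall>\<^sub>F n in sequentially. x \<in> space \<mu> - A (real (Suc j)) n"
    unfolding AE_all_countable
    by (intro allI borel_cantelli_AE1 A_sets sumA) (auto simp: less_top[symmetric])
  with AE_not_heavy have "AE x in \<mu>. x \<notin> recurrence_set T r"
  proof eventually_elim
    case (elim x)
    show ?case
    proof
      assume R: "x \<in> recurrence_set T r"
      obtain j :: nat where j: "x \<notin> heavy (real (Suc j))" using elim(1) by blast
      have "\<forall>\<^sub>F n in sequentially. x \<in> space \<mu> - A (real (Suc j)) n" using elim(2) by blast
      then obtain N where N: "\<And>n. n \<ge> N \<Longrightarrow> x \<notin> A (real (Suc j)) n"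
        by (auto simp: eventually_sequentially)
      have "x \<in> (\<Union>n\<in>{Suc N..}. {x \<in> unit_cube. (T ^^ n) x \<in> open_rectangle x (r n)})"
        using R unfolding recurrence_set_def by (auto simp: Suc_le_eq)
      then obtain n where "n \<ge> N" "x \<in> unit_cube" "(T ^^ n) x \<in> open_rectangle x (r n)"
        by (auto dest: Suc_leD)
      with N[of n] j show False by (auto simp: A_def)
    qed
  qed
  then have "recurrence_set T r \<in> null_sets \<mu>"
    by (simp add: AE_iff_null_sets[OF recurrence_set_sets])
  then show ?thesis by (simp add: measure_def null_setsD1)
qed

end

section \<open>A second moment Borel-Cantelli lemma\<close>

lemma not_summable_imp_at_top:
  fixes f :: "nat \<Rightarrow> real"
  assumes "\<And>n. 0 \<le> f n" "\<not> summable f"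
  shows "filterlim (\<lambda>N. \<Sum>n<N. f n) at_top sequentially"
  unfolding filterlim_at_top
proof
  fix Z
  have "\<not> (\<forall>N. (\<Sum>n<N. f n) \<le> Z)"
    using summableI_nonneg_bounded[of f Z] assms by auto
  then obtain N where N: "Z \<le> (\<Sum>n<N. f n)"
    by (auto simp: not_le intro: less_imp_le)
  show "\<forall>\<^sub>F N in sequentially. Z \<le> (\<Sum>n<N. f n)"
    using eventually_ge_at_top[of N]
  proof eventually_elim
    case (elim N')
    have "(\<Sum>n<N. f n) \<le> (\<Sum>n<N'. f n)" using elim assms by (intro sum_mono2) auto
    then show ?case using N by simp
  qed
qed

lemma double_sum_eq_diagonal_plus_lower:
  fixes p :: "nat \<Rightarrow> nat \<Rightarrow> real"
  assumes "\<And>n m. p n m = p m n" "finite I"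
  shows "(\<Sum>n\<in>I. \<Sum>m\<in>I. p n m) = (\<Sum>n\<in>I. p n n) + 2 * (\<Sum>m\<in>I. \<Sum>n\<in>{n\<in>I. n < m}. p n m)"
proof -
  have "(\<Sum>n\<in>I. \<Sum>m\<in>I. p n m) = (\<Sum>n\<in>I. p n n + (\<Sum>m\<in>{m\<in>I. m < n}. p n m) + (\<Sum>m\<in>{m\<in>I. n < m}. p n m))"
  proof (intro sum.cong refl)
    fix n assume n: "n \<in> I"
    have "I = insert n ({m\<in>I. m < n} \<union> {m\<in>I. n < m})" using n by auto
    then have "(\<Sum>m\<in>I. p n m) = (\<Sum>m\<in>insert n ({m\<in>I. m < n} \<union> {m\<in>I. n < m}). p n m)" by simp
    also have "\<dots> = p n n + (\<Sum>m\<in>{m\<in>I. m < n} \<union> {m\<in>I. n < m}. p n m)"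
      using assms by (subst sum.insert) auto
    also have "(\<Sum>m\<in>{m\<in>I. m < n} \<union> {m\<in>I. n < m}. p n m) = (\<Sum>m\<in>{m\<in>I. m < n}. p n m) + (\<Sum>m\<in>{m\<in>I. n < m}. p n m)"
      using assms by (intro sum.union_disjoint) auto
    finally show "(\<Sum>m\<in>I. p n m) = p n n + (\<Sum>m\<in>{m\<in>I. m < n}. p n m) + (\<Sum>m\<in>{m\<in>I. n < m}. p n m)" by simp
  qed
  also have "\<dots> = (\<Sum>n\<in>I. p n n) + (\<Sum>n\<in>I. \<Sum>m\<in>{m\<in>I. m < n}. p n m) + (\<Sum>n\<in>I. \<Sum>m\<in>{m\<in>I. n < m}. p n m)"
    by (simp add: sum.distrib)
  also have "(\<Sum>n\<in>I. \<Sum>m\<in>{m\<in>I. n < m}. p n m) = (\<Sum>m\<in>I. \<Sum>n\<in>{n\<in>I. n < m}. p n m)"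
    using assms by (intro sum.swap_restrict) auto
  also have "(\<Sum>n\<in>I. \<Sum>m\<in>{m\<in>I. m < n}. p n m) = (\<Sum>m\<in>I. \<Sum>n\<in>{n\<in>I. n < m}. p n m)"
    using assms by (intro sum.cong refl) auto
  finally show ?thesis by simp
qed

lemma summable_nat_times_power:
  fixes x :: real
  assumes "0 \<le> x" "x < 1"
  shows "summable (\<lambda>n. real n * x ^ n)"
proof -
  have "summable (\<lambda>n. diffs (\<lambda>_. 1) n * x ^ n)"
    by (rule termdiff_converges[of x 1]) (use assms in \<open>auto intro: summable_geometric\<close>)
  then have "summable (\<lambda>n. real (Suc n) * x ^ n)" by (simp add: diffs_def)
  moreover have "summable (\<lambda>n. x ^ n)" using assms by (intro summable_geometric) auto
  ultimately have "summable (\<lambda>n. real (Suc n) * x ^ n - x ^ n)" by (rule summable_diff)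
  then show ?thesis by (simp add: algebra_simps)
qed

context prob_space
begin

text \<open>
  Let \<open>f\<close> count the events that occur. Then \<open>2 t f - t\<^sup>2 f\<^sup>2 = 1 - (1 - t f)\<^sup>2\<close> is at most one, and it
  vanishes where no event occurs. Optimising over \<open>t\<close> gives the inequality of Chung and Erdos.
\<close>

lemma second_moment_union:
  assumes A: "\<And>n. A n \<in> events" and I: "finite I"
  shows "2 * t * (\<Sum>n\<in>I. prob (A n)) - t\<^sup>2 * (\<Sum>n\<in>I. \<Sum>m\<in>I. prob (A n \<inter> A m)) \<le> prob (\<Union>n\<in>I. A n)"
proof -
  define f where "f x = (\<Sum>n\<in>I. indicator (A n) x :: real)" for x
  have f2: "(f x)\<^sup>2 = (\<Sum>n\<in>I. \<Sum>m\<in>I. indicator (A n \<inter> A m) x)" for x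
    by (simp add: f_def power2_eq_square sum_product indicator_inter_arith)
  have int: "integrable M (indicat_real B)" if "B \<in> events" for B
    using that by (simp add: integrable_real_indicator less_top[symmetric])
  have intf: "integrable M f" unfolding f_def by (intro Bochner_Integration.integrable_sum int A)
  have intf2: "integrable M (\<lambda>x. (f x)\<^sup>2)"
    unfolding f2 by (intro Bochner_Integration.integrable_sum int sets.Int A)
  have Ef: "expectation f = (\<Sum>n\<in>I. prob (A n))"
    unfolding f_def using A by (subst Bochner_Integration.integral_sum) (auto intro: int simp: sets.Int_space_eq2)
  have Ef2: "expectation (\<lambda>x. (f x)\<^sup>2) = (\<Sum>n\<in>I. \<Sum>m\<in>I. prob (A n \<inter> A m))"
  proof -
    have "expectation (\<lambda>x. (f x)\<^sup>2) = (\<Sum>n\<in>I. expectation (\<lambda>x. \<Sum>m\<in>I. indicator (A n \<inter> A m) x))"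
      unfolding f2 using A by (intro Bochner_Integration.integral_sum Bochner_Integration.integrable_sum int) auto
    also have "\<dots> = (\<Sum>n\<in>I. \<Sum>m\<in>I. expectation (indicator (A n \<inter> A m)))"
      using A by (intro sum.cong refl Bochner_Integration.integral_sum int) auto
    also have "\<dots> = (\<Sum>n\<in>I. \<Sum>m\<in>I. prob (A n \<inter> A m))"
      using A by (intro sum.cong refl) (simp add: sets.Int_space_eq2)
    finally show ?thesis .
  qed
  have U: "(\<Union>n\<in>I. A n) \<in> events" using A I by auto
  have "2 * t * (\<Sum>n\<in>I. prob (A n)) - t\<^sup>2 * (\<Sum>n\<in>I. \<Sum>m\<in>I. prob (A n \<inter> A m))
     = expectation (\<lambda>x. 2 * t * f x - t\<^sup>2 * (f x)\<^sup>2)"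
    unfolding Ef[symmetric] Ef2[symmetric] using intf intf2 by simp
  also have "\<dots> \<le> expectation (indicator (\<Union>n\<in>I. A n))"
  proof (rule integral_mono)
    fix x
    show "2 * t * f x - t\<^sup>2 * (f x)\<^sup>2 \<le> indicat_real (\<Union>n\<in>I. A n) x"
    proof (cases "x \<in> (\<Union>n\<in>I. A n)")
      case True
      have "0 \<le> (1 - t * f x)\<^sup>2" by simp
      then show ?thesis using True by (simp add: power2_eq_square algebra_simps)
    next
      case False
      then have "f x = 0" by (auto simp: f_def)
      then show ?thesis by simp
    qed
  qed (use intf intf2 int[OF U] in auto)
  also have "\<dots> = prob (\<Union>n\<in>I. A n)" using U by (simp add: sets.Int_space_eq2)
  finally show ?thesis .
qed

text \<open>
  The sequence \<open>v\<close> is the expected size of the events up to constants. The error terms \<open>s\<close> and \<open>w\<close> in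
  the correlations contribute only \<open>O(S)\<close> and \<open>O(1)\<close> to the second moment, where \<open>S\<close> is the partial sum
  of \<open>v\<close>; the main term is \<open>2 K\<^sup>2 S\<^sup>2\<close>. As the series diverges, the bound on the union of the events
  from \<open>N0\<close> onwards is the same for each \<open>N0\<close>.
\<close>

lemma limsup_second_moment:
  fixes A :: "nat \<Rightarrow> 'a set" and v u s w :: "nat \<Rightarrow> real" and a K :: real
  assumes A: "\<And>n. A n \<in> events"
    and v: "\<And>n. 0 \<le> v n" "\<not> summable v"
    and u: "summable u" "\<And>n. 0 \<le> u n"
    and s: "summable s" "\<And>n. 0 \<le> s n"
    and w: "summable (\<lambda>n. real n * w n)" "\<And>n. 0 \<le> w n"
    and a: "0 < a" and K: "0 < K"
    and lower: "\<And>n. a * v n - u n \<le> prob (A n)"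
    and upper: "\<And>n. prob (A n) \<le> K * v n + u n"
    and pair: "\<And>n m. n < m \<Longrightarrow> prob (A n \<inter> A m) \<le> K\<^sup>2 * v n * v m + v m * (s n + s (m - n)) + w m"
  shows "a\<^sup>2 / (2 * K\<^sup>2) \<le> prob (\<Inter>N. \<Union>n\<in>{N..}. A n)"
proof -
  define U where "U = suminf u"
  define Z where "Z = suminf s"
  define W where "W = (\<Sum>n. real n * w n)"
  define \<theta> where "\<theta> = a / (2 * K\<^sup>2)"
  define S where "S N0 N = (\<Sum>n\<in>{N0..<N0 + N}. v n)" for N0 N
  have U_ge: "(\<Sum>n\<in>I. u n) \<le> U" if "finite I" for I unfolding U_def using u that by (intro sum_le_suminf) auto
  have Z_ge: "(\<Sum>n\<in>I. s n) \<le> Z" if "finite I" for I unfolding Z_def using s that by (intro sum_le_suminf) auto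
  have W_ge: "(\<Sum>n\<in>I. real n * w n) \<le> W" if "finite I" for I unfolding W_def using w that by (intro sum_le_suminf) auto
  have tail: "a\<^sup>2 / (2 * K\<^sup>2) \<le> prob (\<Union>n\<in>{N0..}. A n)" for N0
  proof -
    have bound: "2 * t * (a * S N0 N - U) - t\<^sup>2 * (K * S N0 N + U + 2 * (K\<^sup>2 * (S N0 N)\<^sup>2 + S N0 N * (2 * Z) + W))
       \<le> prob (\<Union>n\<in>{N0..}. A n)" if t: "0 \<le> t" for t N
    proof -
      let ?I = "{N0..<N0 + N}"
      have 1: "a * S N0 N - U \<le> (\<Sum>n\<in>?I. prob (A n))"
      proof -
        have "a * S N0 N - U \<le> (\<Sum>n\<in>?I. a * v n - u n)"
          using U_ge[of ?I] by (simp add: S_def sum_subtractf sum_distrib_left)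
        also have "\<dots> \<le> (\<Sum>n\<in>?I. prob (A n))" by (intro sum_mono lower)
        finally show ?thesis .
      qed
      have 2: "(\<Sum>n\<in>?I. prob (A n)) \<le> K * S N0 N + U"
      proof -
        have "(\<Sum>n\<in>?I. prob (A n)) \<le> (\<Sum>n\<in>?I. K * v n + u n)" by (intro sum_mono upper)
        also have "\<dots> \<le> K * S N0 N + U"
          using U_ge[of ?I] by (simp add: S_def sum.distrib sum_distrib_left)
        finally show ?thesis .
      qed
      have 3: "(\<Sum>m\<in>?I. \<Sum>n\<in>{n\<in>?I. n < m}. prob (A n \<inter> A m)) \<le> K\<^sup>2 * (S N0 N)\<^sup>2 + S N0 N * (2 * Z) + W"
      proof -
        have "(\<Sum>n\<in>{n\<in>?I. n < m}. prob (A n \<inter> A m)) \<le> K\<^sup>2 * v m * S N0 N + v m * (2 * Z) + real m * w m" for m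
        proof -
          let ?J = "{n\<in>?I. n < m}"
          have "(\<Sum>n\<in>?J. prob (A n \<inter> A m)) \<le> (\<Sum>n\<in>?J. K\<^sup>2 * v n * v m + v m * (s n + s (m - n)) + w m)"
            by (intro sum_mono pair) auto
          also have "\<dots> = K\<^sup>2 * v m * (\<Sum>n\<in>?J. v n) + v m * ((\<Sum>n\<in>?J. s n) + (\<Sum>n\<in>?J. s (m - n))) + real (card ?J) * w m"
            by (simp add: sum.distrib sum_distrib_left algebra_simps)
          also have "\<dots> \<le> K\<^sup>2 * v m * S N0 N + v m * (Z + Z) + real m * w m"
          proof (intro add_mono mult_left_mono mult_right_mono)
            show "(\<Sum>n\<in>?J. v n) \<le> S N0 N" unfolding S_def using v by (intro sum_mono2) auto
            show "(\<Sum>n\<in>?J. s n) \<le> Z" by (rule Z_ge) simp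
            have "(\<Sum>n\<in>?J. s (m - n)) = (\<Sum>n\<in>(\<lambda>n. m - n) ` ?J. s n)"
              by (subst sum.reindex) (auto simp: inj_on_def)
            also have "\<dots> \<le> Z" by (rule Z_ge) simp
            finally show "(\<Sum>n\<in>?J. s (m - n)) \<le> Z" .
            have "card ?J \<le> card {..<m}" by (intro card_mono) auto
            then show "real (card ?J) \<le> real m" by simp
          qed (use v w K in auto)
          finally show ?thesis by simp
        qed
        then have "(\<Sum>m\<in>?I. \<Sum>n\<in>{n\<in>?I. n < m}. prob (A n \<inter> A m))
            \<le> (\<Sum>m\<in>?I. K\<^sup>2 * v m * S N0 N + v m * (2 * Z) + real m * w m)"
          by (intro sum_mono)
        also have "\<dots> = K\<^sup>2 * S N0 N * S N0 N + S N0 N * (2 * Z) + (\<Sum>m\<in>?I. real m * w m)"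
          by (simp add: S_def sum.distrib sum_distrib_left sum_distrib_right mult_ac)
        also have "\<dots> \<le> K\<^sup>2 * (S N0 N)\<^sup>2 + S N0 N * (2 * Z) + W"
          using W_ge[of ?I] by (simp add: power2_eq_square)
        finally show ?thesis .
      qed
      have "(\<Sum>n\<in>?I. \<Sum>m\<in>?I. prob (A n \<inter> A m)) = (\<Sum>n\<in>?I. prob (A n)) + 2 * (\<Sum>m\<in>?I. \<Sum>n\<in>{n\<in>?I. n < m}. prob (A n \<inter> A m))"
        using double_sum_eq_diagonal_plus_lower[of "\<lambda>n m. prob (A n \<inter> A m)" ?I] by (simp add: Int_commute)
      then have 4: "(\<Sum>n\<in>?I. \<Sum>m\<in>?I. prob (A n \<inter> A m)) \<le> K * S N0 N + U + 2 * (K\<^sup>2 * (S N0 N)\<^sup>2 + S N0 N * (2 * Z) + W)"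
        using 2 3 by simp
      have "2 * t * (a * S N0 N - U) - t\<^sup>2 * (K * S N0 N + U + 2 * (K\<^sup>2 * (S N0 N)\<^sup>2 + S N0 N * (2 * Z) + W))
        \<le> 2 * t * (\<Sum>n\<in>?I. prob (A n)) - t\<^sup>2 * (\<Sum>n\<in>?I. \<Sum>m\<in>?I. prob (A n \<inter> A m))"
        using 1 4 t by (intro diff_mono mult_left_mono) auto
      also have "\<dots> \<le> prob (\<Union>n\<in>?I. A n)" by (rule second_moment_union) (use A in auto)
      also have "\<dots> \<le> prob (\<Union>n\<in>{N0..}. A n)" using A by (intro finite_measure_mono) auto
      finally show ?thesis .
    qed
    have S_top: "filterlim (S N0) at_top sequentially"
    proof -
      have "\<not> summable (\<lambda>n. v (n + N0))" using v(2) summable_iff_shift by blast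
      then have "filterlim (\<lambda>N. \<Sum>n<N. v (n + N0)) at_top sequentially"
        using v(1) by (intro not_summable_imp_at_top) auto
      moreover have "S N0 = (\<lambda>N. \<Sum>n<N. v (n + N0))"
        unfolding S_def fun_eq_iff using sum.shift_bounds_nat_ivl[of v 0 N0]
        by (simp add: lessThan_atLeast0 add.commute)
      ultimately show ?thesis by simp
    qed
    \<comment> \<open>The second moment bound at \<open>t = \<theta> / S\<close> as a function of the partial sum \<open>x = S\<close>; \<open>\<theta>\<close> maximises its
      limit \<open>2 \<theta> a - 2 \<theta>\<^sup>2 K\<^sup>2\<close>.\<close>
    define g where "g x = 2 * \<theta> * (a - U / x) - \<theta>\<^sup>2 * (K / x + U / x / x + 2 * (K\<^sup>2 + 2 * Z / x + W / x / x))" for x :: real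
    have lim0: "((\<lambda>x. b / x) \<longlongrightarrow> 0) at_top" for b :: real
      by (intro tendsto_divide_0[OF tendsto_const] filterlim_at_top_imp_at_infinity filterlim_ident)
    have lim00: "((\<lambda>x. b / x / x) \<longlongrightarrow> 0) at_top" for b :: real
      by (intro tendsto_divide_0[OF lim0] filterlim_at_top_imp_at_infinity filterlim_ident)
    have "(g \<longlongrightarrow> 2 * \<theta> * (a - 0) - \<theta>\<^sup>2 * (0 + 0 + 2 * (K\<^sup>2 + 0 + 0))) at_top"
      unfolding g_def by (intro tendsto_intros lim0 lim00)
    moreover have "2 * \<theta> * (a - 0) - \<theta>\<^sup>2 * (0 + 0 + 2 * (K\<^sup>2 + 0 + 0)) = a\<^sup>2 / (2 * K\<^sup>2)"
      using K by (simp add: \<theta>_def power2_eq_square field_simps)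
    ultimately have "((\<lambda>N. g (S N0 N)) \<longlongrightarrow> a\<^sup>2 / (2 * K\<^sup>2)) sequentially"
      using filterlim_compose[OF _ S_top] by force
    moreover have "\<forall>\<^sub>F N in sequentially. g (S N0 N) \<le> prob (\<Union>n\<in>{N0..}. A n)"
      using filterlim_at_top_dense[THEN iffD1, OF S_top, rule_format, of 0]
    proof eventually_elim
      case (elim N)
      let ?S = "S N0 N"
      have "g ?S = 2 * (\<theta> / ?S) * (a * ?S - U) - (\<theta> / ?S)\<^sup>2 * (K * ?S + U + 2 * (K\<^sup>2 * ?S\<^sup>2 + ?S * (2 * Z) + W))"
        using elim by (simp add: g_def power2_eq_square field_simps)
      also have "\<dots> \<le> prob (\<Union>n\<in>{N0..}. A n)"
        using elim a K by (intro bound) (auto simp: \<theta>_def)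
      finally show ?case .
    qed
    ultimately show ?thesis by (rule tendsto_upperbound) auto
  qed
  have "(\<lambda>N. prob (\<Union>n\<in>{N..}. A n)) \<longlonglongrightarrow> prob (\<Inter>N. \<Union>n\<in>{N..}. A n)"
  proof (rule finite_Lim_measure_decseq)
    show "decseq (\<lambda>N. \<Union>n\<in>{N..}. A n)"
      unfolding decseq_def by (intro allI impI UN_mono) auto
  qed (use A in auto)
  then show ?thesis using tail by (intro LIMSEQ_le_const) auto
qed

end

section \<open>Boundaries of the pieces and of the tiles\<close>

definition near_set :: "(real^'n::finite) set \<Rightarrow> real \<Rightarrow> (real^'n) set" where
  "near_set S \<delta> = {x \<in> unit_cube. \<exists>s\<in>S. dist x s \<le> \<delta>}"

lemma compact_near_set:
  assumes "compact S"
  shows "compact (near_set S \<delta>)"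
proof -
  have "near_set S \<delta> = unit_cube \<inter> {s + e |s e. s \<in> S \<and> e \<in> cball 0 \<delta>}"
  proof (intro set_eqI iffI)
    fix x assume "x \<in> near_set S \<delta>"
    then obtain s where "x \<in> unit_cube" "s \<in> S" "dist x s \<le> \<delta>" by (auto simp: near_set_def)
    moreover from this have "x = s + (x - s)" "x - s \<in> cball 0 \<delta>" by (auto simp: dist_norm norm_minus_commute)
    ultimately show "x \<in> unit_cube \<inter> {s + e |s e. s \<in> S \<and> e \<in> cball 0 \<delta>}" by blast
  next
    fix x assume "x \<in> unit_cube \<inter> {s + e |s e. s \<in> S \<and> e \<in> cball 0 \<delta>}"
    then obtain s e where "x \<in> unit_cube" "s \<in> S" "x = s + e" "norm e \<le> \<delta>" by auto
    then show "x \<in> near_set S \<delta>" by (auto simp: near_set_def dist_norm intro!: bexI[of _ s])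
  qed
  also have "compact \<dots>" unfolding unit_cube_def
    by (intro compact_Int compact_sums assms) auto
  finally show ?thesis .
qed

text \<open>
  On a compact set that need not be convex, the mean value inequality gives the Lipschitz property
  only locally; compactness makes it global.
\<close>

lemma C1_imp_lipschitz_on_compact:
  fixes f :: "'a::euclidean_space \<Rightarrow> 'a"
  assumes "open V" "K \<subseteq> V" "compact K"
    and "\<And>x. x \<in> V \<Longrightarrow> (f has_derivative blinfun_apply (f' x)) (at x)" and "continuous_on V f'"
  obtains L where "L-lipschitz_on K f"
proof -
  have "local_lipschitz (UNIV :: real set) V (\<lambda>_. f)"
    by (rule c1_implies_local_lipschitz[where f'="\<lambda>p. f' (snd p)"])
      (use assms in \<open>auto intro!: continuous_on_compose2[OF assms(5)] continuous_intros\<close>)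
  then have "local_lipschitz {0::real} K (\<lambda>_. f)"
    by (rule local_lipschitz_subset) (use assms in auto)
  then obtain L where "\<And>t. t \<in> {0::real} \<Longrightarrow> L-lipschitz_on K f"
    by (rule local_lipschitz_compact_implies_lipschitz[OF _ assms(3)]) auto
  then show ?thesis using that by auto
qed

lemma emeasure_cball_le:
  fixes c :: "real^'n::finite"
  assumes "0 \<le> \<rho>"
  shows "emeasure lborel (cball c \<rho>) \<le> ennreal ((2 * \<rho>) ^ CARD('n))"
proof -
  have "cball c \<rho> \<subseteq> cbox (\<chi> i. c $ i - \<rho>) (\<chi> i. c $ i + \<rho>)"
  proof
    fix x assume "x \<in> cball c \<rho>"
    then have "\<bar>(c - x) $ i\<bar> \<le> \<rho>" for i
      using component_le_norm_cart[of "c - x" i] by (simp add: dist_norm)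
    then show "x \<in> cbox (\<chi> i. c $ i - \<rho>) (\<chi> i. c $ i + \<rho>)"
      by (auto simp: mem_box_cart abs_le_iff algebra_simps)
  qed
  then have "emeasure lborel (cball c \<rho>) \<le> emeasure lborel (cbox (\<chi> i. c $ i - \<rho>) (\<chi> i. c $ i + \<rho>))"
    by (intro emeasure_mono) auto
  also have "\<dots> = ennreal (\<Prod>i\<in>(UNIV::'n set). 2 * \<rho>)"
    using assms by (subst emeasure_lborel_cbox_cart) auto
  finally show ?thesis by simp
qed

text \<open>
  The cell is a Lipschitz image of a face of the cube. The face is covered by \<open>O(2\<^sup>N\<^sup>(\<^sup>d\<^sup>-\<^sup>1\<^sup>))\<close> tiles of side
  \<open>2\<^sup>-\<^sup>N\<close>, so the neighbourhood is covered by as many balls of volume \<open>O(2\<^sup>-\<^sup>N\<^sup>d)\<close>.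
\<close>

lemma hypersurface_cell_near_set:
  fixes S :: "(real^'n::finite) set"
  assumes "C1_embedded_hypersurface_cell S"
  shows "compact S" "\<exists>C\<ge>0. \<forall>N. emeasure lborel (near_set S ((1/2) ^ N)) \<le> ennreal (C * (1/2) ^ N)"
proof -
  obtain k :: 'n and V and \<psi> :: "real^'n \<Rightarrow> real^'n" and \<psi>' where V: "open V" "{y \<in> unit_cube. y $ k = 0} \<subseteq> V"
    and der: "\<forall>y\<in>V. (\<psi> has_derivative blinfun_apply (\<psi>' y)) (at y)" "continuous_on V \<psi>'"
    and "inj_on \<psi> {y \<in> unit_cube. y $ k = 0}"
    and "\<forall>y\<in>{y \<in> unit_cube. y $ k = 0}. inj_on (blinfun_apply (\<psi>' y)) {z. z $ k = 0}"
    and S: "S = \<psi> ` {y \<in> unit_cube. y $ k = 0}"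
    using assms unfolding C1_embedded_hypersurface_cell_def by (elim exE conjE)
  define F where "F = {y \<in> unit_cube. y $ k = 0}"
  have F: "compact F"
  proof -
    have "F = unit_cube \<inter> {y. y $ k = 0}" by (auto simp: F_def)
    also have "compact \<dots>" unfolding unit_cube_def
      by (intro compact_Int_closed compact_cbox closed_Collect_eq continuous_intros)
    finally show ?thesis .
  qed
  obtain L where L: "L-lipschitz_on F \<psi>"
    using C1_imp_lipschitz_on_compact[OF V(1) V(2)[folded F_def] F, of \<psi> \<psi>'] der by blast
  have "0 \<le> L" using L by (rule lipschitz_on_nonneg)
  show "compact S" unfolding S F_def[symmetric]
    by (intro compact_continuous_image lipschitz_on_continuous_on[OF L] F)
  define C where "C = 2 ^ (CARD('n) - 1) * (2 * (L * real CARD('n) + 1)) ^ CARD('n)"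
  show "\<exists>C\<ge>0. \<forall>N. emeasure lborel (near_set S ((1/2) ^ N)) \<le> ennreal (C * (1/2) ^ N)"
  proof (intro exI[of _ C] conjI allI)
    show "0 \<le> C" using \<open>0 \<le> L\<close> by (simp add: C_def)
    fix N
    define \<rho> where "\<rho> = (L * real CARD('n) + 1) * (1/2) ^ N"
    define Z where "Z = (\<Pi>\<^sub>E i\<in>(UNIV::'n set). if i = k then {0::int} else {0..2 ^ N})"
    \<comment> \<open>A tile that meets the face is represented by one of its points on the face.\<close>
    define p where "p z = (SOME y. y \<in> F \<and> y \<in> tile (\<lambda>_. N) z)" for z :: "'n \<Rightarrow> int"
    have "0 \<le> \<rho>" using \<open>0 \<le> L\<close> by (simp add: \<rho>_def)
    have finZ: "finite Z" unfolding Z_def by (intro finite_PiE) auto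
    have sub: "near_set S ((1/2) ^ N) \<subseteq> (\<Union>z\<in>Z. cball (\<psi> (p z)) \<rho>)"
    proof
      fix x assume "x \<in> near_set S ((1/2) ^ N)"
      then obtain y where y: "y \<in> F" and xy: "dist x (\<psi> y) \<le> (1/2) ^ N"
        by (auto simp: near_set_def S F_def)
      have yc: "y \<in> unit_cube" using y by (simp add: F_def)
      let ?z = "tile_index (\<lambda>_. N) y"
      have "y \<in> F \<and> y \<in> tile (\<lambda>_. N) ?z" using y yc by (simp add: mem_tile_iff)
      then have p: "p ?z \<in> F \<and> p ?z \<in> tile (\<lambda>_. N) ?z"
        unfolding p_def by (rule someI)
      have "?z k = 0" using y by (simp add: tile_index_def F_def)
      then have "?z \<in> Z" using tile_index_in_indices[OF yc, of "\<lambda>_. N"]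
        by (auto simp: Z_def tile_indices_def PiE_iff)
      moreover have "dist (\<psi> (p ?z)) x \<le> \<rho>"
      proof -
        have "dist (\<psi> (p ?z)) x \<le> dist (\<psi> (p ?z)) (\<psi> y) + dist x (\<psi> y)"
          by (rule dist_triangle2)
        also have "dist (\<psi> (p ?z)) (\<psi> y) \<le> L * dist (p ?z) y"
          using L p y by (intro lipschitz_onD) auto
        also have "\<dots> \<le> L * (real CARD('n) * (1/2) ^ N)"
          using p y yc \<open>0 \<le> L\<close> by (intro mult_left_mono dist_tile_le[of _ _ ?z]) (auto simp: mem_tile_iff)
        finally show ?thesis using xy by (simp add: \<rho>_def algebra_simps)
      qed
      ultimately show "x \<in> (\<Union>z\<in>Z. cball (\<psi> (p z)) \<rho>)" by auto
    qed
    have card: "real (card Z) \<le> 2 ^ (CARD('n) - 1) * (2 ^ N) ^ (CARD('n) - 1)"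
    proof -
      have "real (card Z) = (\<Prod>i\<in>UNIV. real (card (if i = k then {0::int} else {0..2 ^ N})))"
        by (simp add: Z_def card_PiE)
      also have "\<dots> = (\<Prod>i\<in>UNIV - {k}. real (card {0..(2::int) ^ N}))"
        by (subst prod.remove[of UNIV k]) (auto intro!: prod.cong)
      also have "\<dots> = (2 ^ N + 1) ^ (CARD('n) - 1)"
        by (simp add: card_Diff_singleton)
      also have "\<dots> \<le> (2 * 2 ^ N) ^ (CARD('n) - 1)" by (intro power_mono) auto
      finally show ?thesis by (simp add: power_mult_distrib)
    qed
    have "emeasure lborel (near_set S ((1/2) ^ N)) \<le> emeasure lborel (\<Union>z\<in>Z. cball (\<psi> (p z)) \<rho>)"
      using finZ by (intro emeasure_mono sub) auto
    also have "\<dots> \<le> (\<Sum>z\<in>Z. emeasure lborel (cball (\<psi> (p z)) \<rho>))"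
      by (intro emeasure_subadditive_finite finZ) auto
    also have "\<dots> \<le> (\<Sum>z\<in>Z. ennreal ((2 * \<rho>) ^ CARD('n)))"
      using \<open>0 \<le> \<rho>\<close> by (intro sum_mono emeasure_cball_le)
    also have "\<dots> = ennreal (real (card Z) * (2 * \<rho>) ^ CARD('n))"
      using \<open>0 \<le> \<rho>\<close> by (simp add: ennreal_mult ennreal_of_nat_eq_real_of_nat)
    also have "\<dots> \<le> ennreal (C * (1/2) ^ N)"
    proof (rule ennreal_leI)
      obtain d where d: "CARD('n) = Suc d" using zero_less_card_finite[where 'a='n] by (cases "CARD('n)") auto
      have "real (card Z) * (2 * \<rho>) ^ CARD('n) \<le> (2 ^ (CARD('n) - 1) * (2 ^ N) ^ (CARD('n) - 1)) * (2 * \<rho>) ^ CARD('n)"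
        using \<open>0 \<le> \<rho>\<close> by (intro mult_right_mono card) auto
      also have "\<dots> = 2 ^ d * (2 * (L * real (Suc d) + 1)) ^ Suc d * ((2 ^ N) ^ d * ((1/2) ^ N) ^ Suc d)"
        unfolding \<rho>_def d by (simp only: power_mult_distrib mult_ac diff_Suc_1)
      also have "((2::real) ^ N) ^ d * ((1/2) ^ N) ^ Suc d = (1/2) ^ N"
        by (simp add: power_one_over power_mult_distrib[symmetric])
      finally show "real (card Z) * (2 * \<rho>) ^ CARD('n) \<le> C * (1/2) ^ N"
        by (simp add: C_def d)
    qed
    finally show "emeasure lborel (near_set S ((1/2) ^ N)) \<le> ennreal (C * (1/2) ^ N)" .
  qed
qed

lemma near_set_UN: "near_set (\<Union>i\<in>I. S i) \<delta> = (\<Union>i\<in>I. near_set (S i) \<delta>)"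
  by (auto simp: near_set_def)

lemma near_set_finite_UN:
  assumes I: "finite I" and comp: "\<And>i. i \<in> I \<Longrightarrow> compact (S i)"
    and bd: "\<And>i. i \<in> I \<Longrightarrow> \<exists>C\<ge>0. \<forall>N. emeasure lborel (near_set (S i) ((1/2) ^ N)) \<le> ennreal (C * (1/2) ^ N)"
  shows "compact (\<Union>i\<in>I. S i)"
    "\<exists>C\<ge>0. \<forall>N. emeasure lborel (near_set (\<Union>i\<in>I. S i) ((1/2) ^ N)) \<le> ennreal (C * (1/2) ^ N)"
proof -
  show "compact (\<Union>i\<in>I. S i)" using I comp by auto
  from bd obtain C where C: "\<And>i. i \<in> I \<Longrightarrow> 0 \<le> C i"
    "\<And>i N. i \<in> I \<Longrightarrow> emeasure lborel (near_set (S i) ((1/2) ^ N)) \<le> ennreal (C i * (1/2) ^ N)" by metis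
  show "\<exists>C\<ge>0. \<forall>N. emeasure lborel (near_set (\<Union>i\<in>I. S i) ((1/2) ^ N)) \<le> ennreal (C * (1/2) ^ N)"
  proof (intro exI[of _ "\<Sum>i\<in>I. C i"] conjI allI)
    show "0 \<le> (\<Sum>i\<in>I. C i)" using C by (intro sum_nonneg) auto
    fix N
    have "emeasure lborel (near_set (\<Union>i\<in>I. S i) ((1/2) ^ N)) \<le> (\<Sum>i\<in>I. emeasure lborel (near_set (S i) ((1/2) ^ N)))"
      unfolding near_set_UN using I comp
      by (intro emeasure_subadditive_finite) (auto intro!: borel_compact compact_near_set)
    also have "\<dots> \<le> (\<Sum>i\<in>I. ennreal (C i * (1/2) ^ N))" by (intro sum_mono C)
    also have "\<dots> = ennreal ((\<Sum>i\<in>I. C i) * (1/2) ^ N)"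
      using C by (subst sum_ennreal) (auto simp: sum_distrib_right)
    finally show "emeasure lborel (near_set (\<Union>i\<in>I. S i) ((1/2) ^ N)) \<le> ennreal ((\<Sum>i\<in>I. C i) * (1/2) ^ N)" .
  qed
qed

text \<open>
  If \<open>x\<close> is farther from the boundaries of all pieces than from \<open>y\<close>, the segment from \<open>x\<close> to \<open>y\<close> does
  not leave the piece of \<open>x\<close>, and on a piece the map is Lipschitz because it extends to a \<open>C\<^sup>1\<close> map
  near the compact closure.
\<close>

lemma piecewise_expanding_lipschitz_off_hypersurface:
  fixes T :: "real^'n::finite \<Rightarrow> real^'n"
  assumes "piecewise_expanding T"
  obtains S \<Lambda> C where "compact S" "1 \<le> \<Lambda>" "0 \<le> C"
    "\<And>N. emeasure lborel (near_set S ((1/2) ^ N)) \<le> ennreal (C * (1/2) ^ N)"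
    "\<And>x y. x \<in> unit_cube \<Longrightarrow> y \<in> unit_cube \<Longrightarrow> x \<notin> near_set S (dist x y) \<Longrightarrow> dist (T x) (T y) \<le> \<Lambda> * dist x y"
proof -
  obtain P :: nat and U where
    cover: "(\<Union>i\<in>{1..P}. closure (U i)) = unit_cube"
    and C1: "\<And>i. i \<in> {1..P} \<Longrightarrow> C1_extendable_to_closure (U i) T"
    and front: "\<And>i. i \<in> {1..P} \<Longrightarrow> \<exists>S. piecewise_C1_compact_hypersurface S \<and> frontier (U i) \<subseteq> S"
    using assms unfolding piecewise_expanding_def by auto
  have "\<exists>S. frontier (U i) \<subseteq> S \<and> compact S \<and>
     (\<exists>C\<ge>0. \<forall>N. emeasure lborel (near_set S ((1/2) ^ N)) \<le> ennreal (C * (1/2) ^ N))" if "i \<in> {1..P}" for i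
  proof -
    from front[OF that] obtain \<S> where "finite \<S>" "\<forall>M\<in>\<S>. C1_embedded_hypersurface_cell M" "frontier (U i) \<subseteq> \<Union>\<S>"
      unfolding piecewise_C1_compact_hypersurface_def by auto
    then have "compact (\<Union>M\<in>\<S>. M)"
      "\<exists>C\<ge>0. \<forall>N. emeasure lborel (near_set (\<Union>M\<in>\<S>. M) ((1/2) ^ N)) \<le> ennreal (C * (1/2) ^ N)"
      using hypersurface_cell_near_set by (intro near_set_finite_UN; blast)+
    with \<open>frontier (U i) \<subseteq> \<Union>\<S>\<close> show ?thesis by (intro exI[of _ "\<Union>\<S>"]) simp
  qed
  then obtain S where S: "\<And>i. i \<in> {1..P} \<Longrightarrow> frontier (U i) \<subseteq> S i" "\<And>i. i \<in> {1..P} \<Longrightarrow> compact (S i)"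
    "\<And>i. i \<in> {1..P} \<Longrightarrow> \<exists>C\<ge>0. \<forall>N. emeasure lborel (near_set (S i) ((1/2) ^ N)) \<le> ennreal (C * (1/2) ^ N)"
    by metis
  have "\<exists>L\<ge>0. \<forall>x\<in>U i. \<forall>y\<in>U i. dist (T x) (T y) \<le> L * dist x y" if i: "i \<in> {1..P}" for i
  proof -
    obtain V g g' where V: "open V" "closure (U i) \<subseteq> V" and g: "\<forall>x\<in>U i. g x = T x"
      and g': "\<forall>x\<in>V. (g has_derivative blinfun_apply (g' x)) (at x)" "continuous_on V g'"
      using C1[OF i] unfolding C1_extendable_to_closure_def C1_on_open_def by auto
    have "closure (U i) \<subseteq> unit_cube" using cover i by auto
    then have "compact (closure (U i))"
      unfolding unit_cube_def using bounded_subset[OF bounded_cbox] by (auto simp: compact_eq_bounded_closed)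
    then obtain L where L: "L-lipschitz_on (closure (U i)) g"
      using C1_imp_lipschitz_on_compact[OF V, of g g'] g' by blast
    show ?thesis
    proof (intro exI[of _ L] conjI ballI)
      show "0 \<le> L" using L by (rule lipschitz_on_nonneg)
      fix x y assume "x \<in> U i" "y \<in> U i"
      then show "dist (T x) (T y) \<le> L * dist x y"
        using lipschitz_onD[OF L, of x y] g closure_subset[of "U i"] by auto
    qed
  qed
  then obtain L where L: "\<And>i. i \<in> {1..P} \<Longrightarrow> 0 \<le> L i"
    "\<And>i x y. i \<in> {1..P} \<Longrightarrow> x \<in> U i \<Longrightarrow> y \<in> U i \<Longrightarrow> dist (T x) (T y) \<le> L i * dist x y" by metis
  define \<Lambda> where "\<Lambda> = 1 + (\<Sum>i\<in>{1..P}. L i)"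
  let ?S = "\<Union>i\<in>{1..P}. S i"
  obtain C where C: "0 \<le> C" "\<And>N. emeasure lborel (near_set ?S ((1/2) ^ N)) \<le> ennreal (C * (1/2) ^ N)"
    using near_set_finite_UN(2)[of "{1..P}" S] S by auto
  show ?thesis
  proof (rule that[of ?S \<Lambda> C])
    show "compact ?S" using S by (intro near_set_finite_UN(1)) auto
    have "0 \<le> (\<Sum>i\<in>{1..P}. L i)" by (intro sum_nonneg L(1))
    then show "1 \<le> \<Lambda>" unfolding \<Lambda>_def by simp
    show "0 \<le> C" "emeasure lborel (near_set ?S ((1/2) ^ N)) \<le> ennreal (C * (1/2) ^ N)" for N
      using C by auto
    fix x y assume x: "x \<in> unit_cube" and y: "y \<in> unit_cube" and far: "x \<notin> near_set ?S (dist x y)"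
    obtain i where i: "i \<in> {1..P}" "x \<in> closure (U i)" using cover x by blast
    have near: "s \<notin> frontier (U i)" if "dist x s \<le> dist x y" for s
      using far that S(1)[OF i(1)] i x by (auto simp: near_set_def)
    have "x \<notin> frontier (U i)" by (rule near) simp
    then have xU: "x \<in> U i" using i(2) interior_subset[of "U i"] by (auto simp: frontier_def)
    have yU: "y \<in> U i"
    proof (rule ccontr)
      assume "y \<notin> U i"
      then have "closed_segment x y \<inter> frontier (U i) \<noteq> {}"
        using xU by (intro connected_Int_frontier) auto
      then obtain s where "s \<in> closed_segment x y" "s \<in> frontier (U i)" by auto
      then show False using near[of s] dist_in_closed_segment[of s x y] by (auto simp: dist_commute)
    qed
    have "dist (T x) (T y) \<le> L i * dist x y" using L(2)[OF i(1) xU yU] .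
    also have "L i \<le> \<Lambda>"
      unfolding \<Lambda>_def using member_le_sum[of i "{1..P}" L] i L by simp
    finally show "dist (T x) (T y) \<le> \<Lambda> * dist x y" by (simp add: mult_right_mono)
  qed
qed

definition near_grid :: "('n::finite \<Rightarrow> nat) \<Rightarrow> real \<Rightarrow> (real^'n) set" where
  "near_grid k \<delta> = (\<Union>i. \<Union>z\<in>{0..2 ^ k i}. {x \<in> unit_cube. \<bar>x $ i - of_int z / 2 ^ k i\<bar> \<le> \<delta>})"

lemma tile_index_eq_off_grid:
  fixes x y :: "real^'n::finite"
  assumes x: "x \<in> unit_cube" and y: "y \<in> unit_cube" and far: "x \<notin> near_grid k \<delta>" and d: "dist x y \<le> \<delta>"
  shows "tile_index k x = tile_index k y"
proof (rule ccontr)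
  assume "tile_index k x \<noteq> tile_index k y"
  then obtain i where ne: "tile_index k x i \<noteq> tile_index k y i" by auto
  have xi: "tile_index k x i \<in> {0..2 ^ k i}" and yi: "tile_index k y i \<in> {0..2 ^ k i}"
    using tile_index_in_indices[OF x, of k] tile_index_in_indices[OF y, of k] by (auto simp: tile_indices_def PiE_iff)
  have dd: "\<bar>x $ i - y $ i\<bar> \<le> \<delta>"
    using component_le_norm_cart[of "x - y" i] d by (simp add: dist_norm)
  have "\<exists>z\<in>{0..2 ^ k i}. \<bar>x $ i - of_int z / 2 ^ k i\<bar> \<le> \<delta>"
  proof (cases "x $ i \<le> y $ i")
    case True
    then have "tile_index k x i \<le> tile_index k y i"
      unfolding tile_index_def by (intro floor_mono mult_left_mono) auto
    with ne have "tile_index k x i < tile_index k y i" by simp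
    then have "2 ^ k i * x $ i < of_int (tile_index k y i)" unfolding tile_index_def by (simp add: floor_less_iff)
    moreover have "of_int (tile_index k y i) \<le> 2 ^ k i * y $ i" unfolding tile_index_def by simp
    ultimately have "x $ i < of_int (tile_index k y i) / 2 ^ k i" "of_int (tile_index k y i) / 2 ^ k i \<le> y $ i"
      by (auto simp: field_simps)
    then show ?thesis using yi dd by (intro bexI[of _ "tile_index k y i"]) auto
  next
    case False
    then have "tile_index k y i \<le> tile_index k x i"
      unfolding tile_index_def by (intro floor_mono mult_left_mono) auto
    with ne have "tile_index k y i < tile_index k x i" by simp
    then have "2 ^ k i * y $ i < of_int (tile_index k x i)" unfolding tile_index_def by (simp add: floor_less_iff)
    moreover have "of_int (tile_index k x i) \<le> 2 ^ k i * x $ i" unfolding tile_index_def by simp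
    ultimately have "y $ i < of_int (tile_index k x i) / 2 ^ k i" "of_int (tile_index k x i) / 2 ^ k i \<le> x $ i"
      by (auto simp: field_simps)
    then show ?thesis using xi dd by (intro bexI[of _ "tile_index k x i"]) auto
  qed
  then show False using far x by (auto simp: near_grid_def)
qed

lemma near_grid_borel: "near_grid k \<delta> \<in> sets borel"
proof -
  have "{x \<in> unit_cube. \<bar>x $ i - c\<bar> \<le> \<delta>} \<in> sets borel" for i :: 'a and c
  proof -
    have "{x \<in> unit_cube. \<bar>x $ i - c\<bar> \<le> \<delta>} = unit_cube \<inter> {x. \<bar>x $ i - c\<bar> \<le> \<delta>}" by auto
    also have "\<dots> \<in> sets borel"
      by (intro sets.Int borel_closed closed_Collect_le continuous_intros unit_cube_borel)
    finally show ?thesis .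
  qed
  then show ?thesis unfolding near_grid_def by (intro sets.finite_UN) auto
qed

lemma emeasure_near_grid_le:
  fixes k :: "'n::finite \<Rightarrow> nat"
  assumes "0 \<le> \<delta>" "\<And>i. k i \<le> n"
  shows "emeasure lborel (near_grid k \<delta>) \<le> ennreal (real CARD('n) * 2 ^ n * 4 * 3 ^ CARD('n) * \<delta>)"
proof -
  let ?S = "\<lambda>i c. slab i c \<delta>"
  let ?D = "SIGMA i:UNIV. {0..(2::int) ^ k i}"
  have fin: "finite ?D" by auto
  have "near_grid k \<delta> \<subseteq> (\<Union>p\<in>?D. ?S (fst p) (of_int (snd p) / 2 ^ k (fst p)))"
  proof
    fix x :: "real^'n" assume "x \<in> near_grid k \<delta>"
    then obtain i z where x: "x \<in> unit_cube" "z \<in> {0..2 ^ k i}" "\<bar>x $ i - of_int z / 2 ^ k i\<bar> \<le> \<delta>"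
      by (auto simp: near_grid_def)
    show "x \<in> (\<Union>p\<in>?D. ?S (fst p) (of_int (snd p) / 2 ^ k (fst p)))"
      using x by (intro UN_I[of "(i, z)"]) (auto intro: unit_cube_imp_slab)
  qed
  then have "emeasure lborel (near_grid k \<delta>) \<le> emeasure lborel (\<Union>p\<in>?D. ?S (fst p) (of_int (snd p) / 2 ^ k (fst p)))"
    using fin by (intro emeasure_mono sets.finite_UN) auto
  also have "\<dots> \<le> (\<Sum>p\<in>?D. emeasure lborel (?S (fst p) (of_int (snd p) / 2 ^ k (fst p))))"
    by (intro emeasure_subadditive_finite fin) auto
  also have "\<dots> \<le> (\<Sum>p\<in>?D. ennreal (2 * \<delta> * 3 ^ CARD('n)))"
    using assms by (intro sum_mono emeasure_slab_le)
  also have "\<dots> = ennreal (real (card ?D) * (2 * \<delta> * 3 ^ CARD('n)))"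
    using assms by (simp add: ennreal_mult ennreal_of_nat_eq_real_of_nat del: card_SigmaI)
  also have "\<dots> \<le> ennreal (real CARD('n) * 2 ^ n * 4 * 3 ^ CARD('n) * \<delta>)"
  proof (rule ennreal_leI)
    have "real (card ?D) = (\<Sum>i\<in>UNIV. real (card {0..(2::int) ^ k i}))"
      by (simp add: card_SigmaI del: card_atLeastAtMost_int)
    also have "\<dots> \<le> (\<Sum>i\<in>(UNIV::'n set). 2 * 2 ^ n)"
    proof (rule sum_mono)
      fix i :: 'n
      have "real (card {0..(2::int) ^ k i}) = 2 ^ k i + 1" by simp
      also have "\<dots> \<le> 2 ^ n + 2 ^ n" using assms(2)[of i] by (intro add_mono power_increasing) auto
      finally show "real (card {0..(2::int) ^ k i}) \<le> 2 * 2 ^ n" by simp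
    qed
    finally have "real (card ?D) \<le> real CARD('n) * (2 * 2 ^ n)" by simp
    then have "real (card ?D) * (2 * \<delta> * 3 ^ CARD('n)) \<le> real CARD('n) * (2 * 2 ^ n) * (2 * \<delta> * 3 ^ CARD('n))"
      using assms by (intro mult_right_mono) auto
    then show "real (card ?D) * (2 * \<delta> * 3 ^ CARD('n)) \<le> real CARD('n) * 2 ^ n * 4 * 3 ^ CARD('n) * \<delta>"
      by (simp add: mult_ac)
  qed
  finally show ?thesis .
qed

section \<open>Correlations of return sets\<close>

context mixing_cube
begin

definition self_return :: "('n \<Rightarrow> nat) \<Rightarrow> ('n \<Rightarrow> int) set \<Rightarrow> nat \<Rightarrow> (real^'n) set" where
  "self_return k J n = (\<Union>z\<in>J. tile k z \<inter> (T ^^ n) -` tile k z)"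

lemma self_return_sets:
  assumes "finite J"
  shows "self_return k J n \<in> sets \<mu>"
  unfolding self_return_def by (intro sets.finite_UN assms Int_vimage_sets tile_sets)

lemma sum_measure_disjoint_le:
  assumes "finite I" "disjoint_family_on F I" "\<And>i. i \<in> I \<Longrightarrow> F i \<in> sets \<mu>" "\<And>i. i \<in> I \<Longrightarrow> F i \<subseteq> B" "B \<in> sets \<mu>"
  shows "(\<Sum>i\<in>I. prob (F i)) \<le> prob B"
proof -
  have "(\<Sum>i\<in>I. prob (F i)) = prob (\<Union>i\<in>I. F i)"
    by (rule finite_measure_finite_Union[symmetric]) (use assms in auto)
  also have "\<dots> \<le> prob B" using assms by (intro finite_measure_mono) auto
  finally show ?thesis .
qed

lemma mixing_tile_upper:
  "G \<in> sets \<mu> \<Longrightarrow> prob (tile k z \<inter> (T ^^ n) -` G) \<le> (prob (tile k z) + mixing_err n) * prob G"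
  unfolding tile_eq_half_open_box by (rule mixing_upper)

lemma mixing_tile_Int_upper:
  "G \<in> sets \<mu> \<Longrightarrow> prob ((tile k z \<inter> tile k' z') \<inter> (T ^^ n) -` G)
     \<le> (prob (tile k z \<inter> tile k' z') + mixing_err n) * prob G"
  unfolding tile_eq_half_open_box half_open_box_Int by (rule mixing_upper)

lemma measure_self_return_upper:
  assumes J: "finite J" "\<And>z. z \<in> J \<Longrightarrow> prob (tile k z) \<le> K * tile_volume k" and K: "0 \<le> K"
  shows "prob (self_return k J n) \<le> K * tile_volume k + mixing_err n"
proof -
  have "prob (self_return k J n) \<le> (\<Sum>z\<in>J. prob (tile k z \<inter> (T ^^ n) -` tile k z))"
    unfolding self_return_def
    by (intro measure_subadditive_finite J image_subsetI) (auto intro!: Int_vimage_sets)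
  also have "\<dots> \<le> (\<Sum>z\<in>J. (K * tile_volume k + mixing_err n) * prob (tile k z))"
  proof (rule sum_mono)
    fix z assume "z \<in> J"
    have "prob (tile k z \<inter> (T ^^ n) -` tile k z) \<le> (prob (tile k z) + mixing_err n) * prob (tile k z)"
      by (rule mixing_tile_upper) simp
    also have "\<dots> \<le> (K * tile_volume k + mixing_err n) * prob (tile k z)"
      using J \<open>z \<in> J\<close> by (intro mult_right_mono) auto
    finally show "prob (tile k z \<inter> (T ^^ n) -` tile k z) \<le> (K * tile_volume k + mixing_err n) * prob (tile k z)" .
  qed
  also have "\<dots> = (K * tile_volume k + mixing_err n) * (\<Sum>z\<in>J. prob (tile k z))"
    by (simp add: sum_distrib_left)
  also have "\<dots> \<le> (K * tile_volume k + mixing_err n) * 1"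
    using K tile_volume_pos[of k] mixing_err_pos[of n]
    by (intro mult_left_mono sum_measure_tile_le_1 J) auto
  finally show ?thesis by simp
qed

text \<open>
  The sum of the squares of the tile masses is bounded below by the Cauchy-Schwarz inequality, as
  the number of tiles is at most \<open>2\<^sup>d\<close> divided by the volume of a tile.
\<close>

lemma measure_self_return_lower:
  assumes J: "J \<subseteq> tile_indices k" and w: "0 \<le> w" "w \<le> (\<Sum>z\<in>J. prob (tile k z))"
  shows "w\<^sup>2 / 2 ^ CARD('n) * tile_volume k - mixing_err n \<le> prob (self_return k J n)"
proof -
  have fin: "finite J" using J finite_subset finite_tile_indices by blast
  let ?s = "\<Sum>z\<in>J. (prob (tile k z))\<^sup>2"
  have "w\<^sup>2 \<le> (\<Sum>z\<in>J. prob (tile k z))\<^sup>2" using w by (intro power_mono) auto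
  also have "\<dots> \<le> (\<Sum>z\<in>J. 1\<^sup>2) * ?s"
    using Cauchy_Schwarz_ineq_sum[of "\<lambda>_. 1" "\<lambda>z. prob (tile k z)" J] by simp
  also have "\<dots> \<le> (2 ^ CARD('n) / tile_volume k) * ?s"
  proof (rule mult_right_mono)
    have "real (card J) \<le> real (card (tile_indices k))" using J by (simp add: card_mono)
    then show "(\<Sum>z\<in>J. 1\<^sup>2) \<le> 2 ^ CARD('n) / tile_volume k" using card_tile_indices[of k] by simp
  qed (intro sum_nonneg, simp)
  finally have *: "w\<^sup>2 / 2 ^ CARD('n) * tile_volume k \<le> ?s"
    using tile_volume_pos[of k] by (simp add: field_simps)
  have "?s - mixing_err n \<le> ?s - mixing_err n * (\<Sum>z\<in>J. prob (tile k z))"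
    using sum_measure_tile_le_1[OF fin, of k] mixing_err_pos[of n] by (simp add: mult_left_le)
  also have "\<dots> = (\<Sum>z\<in>J. (prob (tile k z) - mixing_err n) * prob (tile k z))"
    by (simp add: sum_subtractf sum_distrib_left left_diff_distrib power2_eq_square)
  also have "\<dots> \<le> (\<Sum>z\<in>J. prob (tile k z \<inter> (T ^^ n) -` tile k z))"
    unfolding tile_eq_half_open_box by (intro sum_mono mixing_box_lower)
  also have "\<dots> \<le> prob (self_return k J n)"
    using fin by (intro sum_measure_disjoint_le self_return_sets)
      (auto simp: disjoint_family_on_def mem_tile_iff self_return_def intro!: Int_vimage_sets)
  finally show ?thesis using * by simp
qed

lemma funpow_split: "n \<le> m \<Longrightarrow> (T ^^ m) x = (T ^^ (m - n)) ((T ^^ n) x)"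
  using funpow_add[of "m - n" n T] by (simp add: fun_eq_iff)

text \<open>
  A point of both sets lies in some \<open>R \<inter> R'\<close>, and its image under \<open>T\<^sup>n\<close> lies in \<open>R \<inter> T\<^sup>-\<^sup>(\<^sup>m\<^sup>-\<^sup>n\<^sup>) R'\<close>. Mixing
  at time \<open>n\<close> and then at time \<open>m - n\<close> separates the three factors. The error of the first step
  involves the measures of disjoint sets, so it does not grow with the number of tiles.
\<close>

lemma self_return_pair_far:
  assumes nm: "n < m"
    and J: "finite J" "\<And>z. z \<in> J \<Longrightarrow> prob (tile k z) \<le> K * tile_volume k"
    and J': "finite J'" "\<And>z. z \<in> J' \<Longrightarrow> prob (tile k' z) \<le> K * tile_volume k'"
    and K: "0 \<le> K"
  shows "prob (self_return k J n \<inter> self_return k' J' m)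
    \<le> (K * tile_volume k + mixing_err (m - n)) * (K * tile_volume k') + mixing_err n"
proof -
  let ?R = "\<lambda>p. tile k (fst p) \<inter> tile k' (snd p)"
  let ?G = "\<lambda>p. tile k (fst p) \<inter> (T ^^ (m - n)) -` tile k' (snd p)"
  have fin: "finite (J \<times> J')" using J J' by simp
  have G: "?G p \<in> sets \<mu>" for p by (intro Int_vimage_sets tile_sets)
  have R: "?R p \<in> sets \<mu>" for p by auto
  have "self_return k J n \<inter> self_return k' J' m \<subseteq> (\<Union>p\<in>J \<times> J'. ?R p \<inter> (T ^^ n) -` ?G p)"
    using funpow_split[of n m] nm by (auto simp: self_return_def)
  then have "prob (self_return k J n \<inter> self_return k' J' m)
     \<le> prob (\<Union>p\<in>J \<times> J'. ?R p \<inter> (T ^^ n) -` ?G p)"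
    by (intro finite_measure_mono sets.finite_UN fin Int_vimage_sets G R)
  also have "\<dots> \<le> (\<Sum>p\<in>J \<times> J'. prob (?R p \<inter> (T ^^ n) -` ?G p))"
    by (intro finite_measure_subadditive_finite fin image_subsetI Int_vimage_sets) (auto intro: G R)
  also have "\<dots> \<le> (\<Sum>p\<in>J \<times> J'. (prob (?R p) + mixing_err n) * prob (?G p))"
    by (intro sum_mono mixing_tile_Int_upper G)
  also have "\<dots> = (\<Sum>p\<in>J \<times> J'. prob (?R p) * prob (?G p)) + mixing_err n * (\<Sum>p\<in>J \<times> J'. prob (?G p))"
    by (simp add: distrib_right sum.distrib sum_distrib_left)
  also have "\<dots> \<le> (K * tile_volume k + mixing_err (m - n)) * (K * tile_volume k') + mixing_err n * 1"
  proof (intro add_mono mult_left_mono)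
    have "(\<Sum>p\<in>J \<times> J'. prob (?R p) * prob (?G p))
       \<le> (\<Sum>p\<in>J \<times> J'. prob (?R p) * ((K * tile_volume k + mixing_err (m - n)) * (K * tile_volume k')))"
    proof (intro sum_mono mult_left_mono)
      fix p assume p: "p \<in> J \<times> J'"
      have "prob (?G p) \<le> (prob (tile k (fst p)) + mixing_err (m - n)) * prob (tile k' (snd p))"
        by (rule mixing_tile_upper) simp
      also have "\<dots> \<le> (K * tile_volume k + mixing_err (m - n)) * (K * tile_volume k')"
        using p J J' K tile_volume_pos[of k] mixing_err_pos[of "m - n"]
        by (intro mult_mono add_right_mono) (auto intro!: add_nonneg_nonneg)
      finally show "prob (?G p) \<le> (K * tile_volume k + mixing_err (m - n)) * (K * tile_volume k')" .
    qed simp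
    also have "\<dots> = (\<Sum>p\<in>J \<times> J'. prob (?R p)) * ((K * tile_volume k + mixing_err (m - n)) * (K * tile_volume k'))"
      by (simp add: sum_distrib_right)
    also have "\<dots> \<le> 1 * ((K * tile_volume k + mixing_err (m - n)) * (K * tile_volume k'))"
    proof (rule mult_right_mono)
      have "(\<Sum>p\<in>J \<times> J'. prob (?R p)) \<le> prob (space \<mu>)"
        by (intro sum_measure_disjoint_le fin R) (auto simp: disjoint_family_on_def mem_tile_iff)
      then show "(\<Sum>p\<in>J \<times> J'. prob (?R p)) \<le> 1" using prob_space by simp
    qed (use K tile_volume_pos[of k] tile_volume_pos[of k'] mixing_err_pos[of "m - n"] in auto)
    finally show "(\<Sum>p\<in>J \<times> J'. prob (?R p) * prob (?G p))
       \<le> (K * tile_volume k + mixing_err (m - n)) * (K * tile_volume k')" by simp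
    have "(\<Sum>p\<in>J \<times> J'. prob (?G p)) \<le> prob (space \<mu>)"
      by (intro sum_measure_disjoint_le fin G) (auto simp: disjoint_family_on_def mem_tile_iff)
    then show "(\<Sum>p\<in>J \<times> J'. prob (?G p)) \<le> 1" using prob_space by simp
    show "0 \<le> mixing_err n" using mixing_err_pos[of n] by simp
  qed
  finally show ?thesis by simp
qed

text \<open>
  Cover the first set by cubes of side \<open>2\<^sup>-\<^sup>N\<close> and apply mixing at time \<open>m\<close> to each intersection of a
  cube with a tile of the second set. The stability hypothesis says that the cubes cover nothing
  but the first set and \<open>Bad\<close>. The number of cubes multiplies the mixing error.
\<close>

lemma self_return_pair_near:
  assumes J: "finite J" 
    and J': "finite J'" "\<And>z. z \<in> J' \<Longrightarrow> prob (tile k' z) \<le> K * tile_volume k'"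
    and K: "0 \<le> K" and Bad: "Bad \<in> sets \<mu>"
    and stable: "\<And>x y. x \<in> unit_cube \<Longrightarrow> x \<notin> Bad \<Longrightarrow> y \<in> self_return k J n \<Longrightarrow>
       tile_index (\<lambda>_. N) x = tile_index (\<lambda>_. N) y \<Longrightarrow> x \<in> self_return k J n"
  shows "prob (self_return k J n \<inter> self_return k' J' m)
    \<le> K * tile_volume k' * (prob (self_return k J n) + prob Bad) + 2 ^ CARD('n) * 2 ^ (N * CARD('n)) * mixing_err m"
proof -
  let ?A = "self_return k J n"
  let ?Q = "\<lambda>u. tile (\<lambda>_::'n. N) u"
  define H where "H = tile_index (\<lambda>_. N) ` ?A"
  have A: "?A \<in> sets \<mu>" by (rule self_return_sets[OF J])
  have Ac: "?A \<subseteq> unit_cube" using A by (simp add: sets_mu_iff)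
  have HI: "H \<subseteq> tile_indices (\<lambda>_. N)" unfolding H_def using Ac tile_index_in_indices by blast
  have finH: "finite H" unfolding H_def by (rule finite_tile_index_image[OF Ac])
  have fin: "finite (H \<times> J')" using finH J' by simp
  let ?R = "\<lambda>p. ?Q (fst p) \<inter> tile k' (snd p)"
  have R: "?R p \<in> sets \<mu>" for p by auto
  have "?A \<inter> self_return k' J' m \<subseteq> (\<Union>p\<in>H \<times> J'. ?R p \<inter> (T ^^ m) -` tile k' (snd p))"
  proof
    fix x assume x: "x \<in> ?A \<inter> self_return k' J' m"
    then obtain i where i: "i \<in> J'" "x \<in> tile k' i" "(T ^^ m) x \<in> tile k' i" by (auto simp: self_return_def)
    have "tile_index (\<lambda>_. N) x \<in> H" "x \<in> ?Q (tile_index (\<lambda>_. N) x)"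
      using x Ac by (auto simp: H_def mem_tile_iff)
    then show "x \<in> (\<Union>p\<in>H \<times> J'. ?R p \<inter> (T ^^ m) -` tile k' (snd p))"
      using i by (intro UN_I[of "(tile_index (\<lambda>_. N) x, i)"]) auto
  qed
  then have "prob (?A \<inter> self_return k' J' m) \<le> prob (\<Union>p\<in>H \<times> J'. ?R p \<inter> (T ^^ m) -` tile k' (snd p))"
    by (intro finite_measure_mono sets.finite_UN fin Int_vimage_sets R tile_sets)
  also have "\<dots> \<le> (\<Sum>p\<in>H \<times> J'. prob (?R p \<inter> (T ^^ m) -` tile k' (snd p)))"
    by (intro finite_measure_subadditive_finite fin image_subsetI Int_vimage_sets R tile_sets)
  also have "\<dots> \<le> (\<Sum>p\<in>H \<times> J'. (prob (?R p) + mixing_err m) * prob (tile k' (snd p)))"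
    by (intro sum_mono mixing_tile_Int_upper tile_sets)
  also have "\<dots> = (\<Sum>p\<in>H \<times> J'. prob (?R p) * prob (tile k' (snd p))) + mixing_err m * (\<Sum>p\<in>H \<times> J'. prob (tile k' (snd p)))"
    by (simp add: distrib_right sum.distrib sum_distrib_left)
  also have "\<dots> \<le> K * tile_volume k' * (prob ?A + prob Bad) + mixing_err m * (2 ^ CARD('n) * 2 ^ (N * CARD('n)))"
  proof (intro add_mono mult_left_mono)
    have "(\<Sum>p\<in>H \<times> J'. prob (?R p) * prob (tile k' (snd p)))
       \<le> (\<Sum>p\<in>H \<times> J'. prob (?R p) * (K * tile_volume k'))"
      using J' by (intro sum_mono mult_left_mono) auto
    also have "\<dots> = K * tile_volume k' * (\<Sum>p\<in>H \<times> J'. prob (?R p))"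
      by (simp add: sum_distrib_left mult_ac)
    also have "\<dots> \<le> K * tile_volume k' * (prob ?A + prob Bad)"
    proof (rule mult_left_mono)
      have "(\<Sum>p\<in>H \<times> J'. prob (?R p)) \<le> prob (?A \<union> Bad)"
      proof (intro sum_measure_disjoint_le fin R sets.Un A Bad)
        show "disjoint_family_on ?R (H \<times> J')" by (auto simp: disjoint_family_on_def mem_tile_iff)
        fix p assume "p \<in> H \<times> J'"
        show "?R p \<subseteq> ?A \<union> Bad"
        proof
          fix x assume x: "x \<in> ?R p"
          from \<open>p \<in> H \<times> J'\<close> obtain y where y: "y \<in> ?A" "fst p = tile_index (\<lambda>_. N) y" by (auto simp: H_def)
          show "x \<in> ?A \<union> Bad" using stable[of x y] x y by (auto simp: mem_tile_iff)
        qed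
      qed
      also have "\<dots> \<le> prob ?A + prob Bad" by (rule measure_Un_le[OF A Bad])
      finally show "(\<Sum>p\<in>H \<times> J'. prob (?R p)) \<le> prob ?A + prob Bad" .
    qed (use K tile_volume_pos[of k'] in auto)
    finally show "(\<Sum>p\<in>H \<times> J'. prob (?R p) * prob (tile k' (snd p)))
       \<le> K * tile_volume k' * (prob ?A + prob Bad)" .
    have "(\<Sum>p\<in>H \<times> J'. prob (tile k' (snd p))) = (\<Sum>u\<in>H. \<Sum>i\<in>J'. prob (tile k' i))"
      by (simp only: sum.cartesian_product case_prod_unfold)
    also have "\<dots> = real (card H) * (\<Sum>i\<in>J'. prob (tile k' i))" by simp
    also have "\<dots> \<le> real (card H) * 1"
      by (intro mult_left_mono sum_measure_tile_le_1 J') auto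
    also have "\<dots> \<le> 2 ^ CARD('n) / tile_volume (\<lambda>_::'n. N)"
      using card_mono[OF finite_tile_indices HI] card_tile_indices[of "\<lambda>_::'n. N"] by simp
    also have "\<dots> = 2 ^ CARD('n) * 2 ^ (N * CARD('n))"
      by (simp add: tile_volume_const power_one_over field_simps)
    finally show "(\<Sum>p\<in>H \<times> J'. prob (tile k' (snd p))) \<le> 2 ^ CARD('n) * 2 ^ (N * CARD('n))" .
    show "0 \<le> mixing_err m" using mixing_err_pos[of m] by simp
  qed
  finally show ?thesis by (simp add: mult_ac)
qed

end

locale piecewise_lipschitz_mixing_cube = mixing_cube \<mu> h q T c \<tau>
  for \<mu> :: "(real^'n::finite) measure" and h q T c \<tau> +
  fixes S :: "(real^'n) set" and \<Lambda> C :: real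
  assumes S_compact: "compact S" and Lambda_ge_1: "1 \<le> \<Lambda>" and C_nonneg: "0 \<le> C"
    and emeasure_near_S: "\<And>N. emeasure lborel (near_set S ((1/2) ^ N)) \<le> ennreal (C * (1/2) ^ N)"
    and lipschitz_off_S: "\<And>x y. x \<in> unit_cube \<Longrightarrow> y \<in> unit_cube \<Longrightarrow> x \<notin> near_set S (dist x y) \<Longrightarrow>
        dist (T x) (T y) \<le> \<Lambda> * dist x y"
begin

text \<open>
  The points for which knowledge of the orbit at scale \<open>4\<^sup>-\<^sup>n\<close> may not determine the tiles at the times
  \<open>0\<close> and \<open>n\<close>: the orbit comes near a boundary of a piece before time \<open>n\<close>, or near a wall of a tile
  at time \<open>0\<close> or \<open>n\<close>.
\<close>

definition bad_set :: "('n \<Rightarrow> nat) \<Rightarrow> nat \<Rightarrow> (real^'n) set" where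
  "bad_set k n = (\<Union>j<n. unit_cube \<inter> (T ^^ j) -` near_set S ((1/2) ^ (2 * n)))
     \<union> (unit_cube \<inter> (T ^^ n) -` near_grid k ((1/2) ^ (2 * n))) \<union> near_grid k ((1/2) ^ (2 * n))"

lemma near_S_sets: "near_set S \<delta> \<in> sets \<mu>"
  using compact_near_set[OF S_compact, of \<delta>] by (auto simp: sets_mu_iff near_set_def intro: borel_compact)

lemma near_grid_sets: "near_grid k \<delta> \<in> sets \<mu>"
  by (auto simp: sets_mu_iff near_grid_borel) (auto simp: near_grid_def)

lemma bad_set_sets: "bad_set k n \<in> sets \<mu>"
  unfolding bad_set_def
  by (intro sets.Un sets.finite_UN Int_vimage_sets near_S_sets near_grid_sets unit_cube_sets) auto

lemma orbits_stay_close: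
  assumes x: "x \<in> unit_cube" and y: "y \<in> unit_cube" and bad: "x \<notin> bad_set k n"
    and d: "dist x y \<le> d" and d0: "\<Lambda> ^ n * d \<le> (1/2) ^ (2 * n)" and "j \<le> n"
  shows "dist ((T ^^ j) x) ((T ^^ j) y) \<le> (1/2) ^ (2 * n)"
proof -
  have d_nonneg: "0 \<le> d" using d zero_le_dist[of x y] by linarith
  have small: "\<Lambda> ^ j * d \<le> (1/2) ^ (2 * n)" if "j \<le> n" for j
    using mult_right_mono[OF power_increasing[OF that Lambda_ge_1] d_nonneg] d0 by linarith
  have "j \<le> n \<Longrightarrow> dist ((T ^^ j) x) ((T ^^ j) y) \<le> \<Lambda> ^ j * d"
  proof (induction j)
    case (Suc j)
    let ?x = "(T ^^ j) x" and ?y = "(T ^^ j) y"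
    have IH: "dist ?x ?y \<le> \<Lambda> ^ j * d" using Suc by simp
    then have le: "dist ?x ?y \<le> (1/2) ^ (2 * n)" using small[of j] Suc.prems by linarith
    have "?x \<notin> near_set S ((1/2) ^ (2 * n))"
      using bad x Suc.prems by (auto simp: bad_set_def)
    then have "?x \<notin> near_set S (dist ?x ?y)"
      using le by (auto simp: near_set_def intro: order_trans)
    then have "dist (T ?x) (T ?y) \<le> \<Lambda> * dist ?x ?y"
      using x y funpow_in_cube by (intro lipschitz_off_S) auto
    also have "\<dots> \<le> \<Lambda> * (\<Lambda> ^ j * d)" using IH Lambda_ge_1 by (intro mult_left_mono) auto
    finally show ?case by simp
  qed (use d in simp)
  then show ?thesis using small[OF \<open>j \<le> n\<close>] \<open>j \<le> n\<close> by simp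
qed

lemma self_return_stable:
  assumes x: "x \<in> unit_cube" and bad: "x \<notin> bad_set k n" and y: "y \<in> self_return k J n"
    and eq: "tile_index (\<lambda>_. N) x = tile_index (\<lambda>_. N) y"
    and N: "\<Lambda> ^ n * (real CARD('n) * (1/2) ^ N) \<le> (1/2) ^ (2 * n)"
  shows "x \<in> self_return k J n"
proof -
  obtain z where z: "z \<in> J" "y \<in> tile k z" "(T ^^ n) y \<in> tile k z" using y by (auto simp: self_return_def)
  have yc: "y \<in> unit_cube" using z by (auto simp: mem_tile_iff)
  have d: "dist x y \<le> real CARD('n) * (1/2) ^ N"
    using x yc eq by (intro dist_tile_le[of _ _ "tile_index (\<lambda>_. N) y"]) (auto simp: mem_tile_iff)
  note close = orbits_stay_close[OF x yc bad d N]
  have "tile_index k x = tile_index k y"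
    using close[of 0] bad x yc by (intro tile_index_eq_off_grid[of _ _ _ "(1/2) ^ (2 * n)"]) (auto simp: bad_set_def)
  moreover have "tile_index k ((T ^^ n) x) = tile_index k ((T ^^ n) y)"
    using close[of n] bad x yc funpow_in_cube
    by (intro tile_index_eq_off_grid[of _ _ _ "(1/2) ^ (2 * n)"]) (auto simp: bad_set_def)
  ultimately show ?thesis
    using z x funpow_in_cube by (auto simp: self_return_def mem_tile_iff intro!: bexI[of _ z])
qed

text \<open>
  A set of volume \<open>O(2\<^sup>-\<^sup>n)\<close> has measure \<open>O(bad_rate\<^sup>n)\<close>: truncate the density at height \<open>2\<^sup>n\<^sup>/\<^sup>2\<close>.
\<close>

definition bad_rate :: real where "bad_rate = max (1 / sqrt 2) (sqrt 2 powr (1 - q))"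

definition bad_const :: real where
  "bad_const = C + real CARD('n) * 4 * 3 ^ CARD('n) + powr_integral"

lemma bad_rate: "0 < bad_rate" "bad_rate < 1"
proof -
  have "1 < sqrt 2" by simp
  then have "sqrt 2 powr (1 - q) < 1" using q_gt_1 by (simp add: powr_less_one)
  then show "0 < bad_rate" "bad_rate < 1" unfolding bad_rate_def by (auto simp: max_def)
qed

lemma bad_const_nonneg: "0 \<le> bad_const"
  unfolding bad_const_def using C_nonneg powr_integral_nonneg by simp

lemma measure_thin_le:
  assumes A: "A \<in> sets \<mu>" and E: "emeasure lborel A \<le> ennreal (E * (1/2) ^ n)" "0 \<le> E"
    and le: "E + powr_integral \<le> bad_const"
  shows "prob A \<le> bad_const * bad_rate ^ n"
proof -
  let ?t = "sqrt 2 ^ n"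
  have "prob A \<le> ?t * (E * (1/2) ^ n) + ?t powr (1 - q) * powr_integral"
    using E by (intro measure_le_truncation[OF A]) auto
  also have "?t * (E * (1/2) ^ n) = E * (1 / sqrt 2) ^ n"
  proof -
    have "sqrt 2 * (1/2) = 1 / sqrt 2" by (simp add: field_simps)
    then show ?thesis by (metis (no_types, lifting) mult.left_commute power_mult_distrib)
  qed
  also have "?t powr (1 - q) = (sqrt 2 powr (1 - q)) ^ n"
    by (simp add: powr_realpow[symmetric] powr_powr mult.commute)
  also have "E * (1 / sqrt 2) ^ n + (sqrt 2 powr (1 - q)) ^ n * powr_integral
     \<le> E * bad_rate ^ n + bad_rate ^ n * powr_integral"
    unfolding bad_rate_def using E powr_integral_nonneg
    by (intro add_mono mult_left_mono mult_right_mono power_mono) auto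
  also have "\<dots> = (E + powr_integral) * bad_rate ^ n" by (simp add: algebra_simps)
  also have "\<dots> \<le> bad_const * bad_rate ^ n" using le bad_rate by (intro mult_right_mono) auto
  finally show ?thesis .
qed

definition bad_bound :: "nat \<Rightarrow> real" where
  "bad_bound n = (real n + 2) * (bad_const * bad_rate ^ n)"

text \<open>
  By invariance each preimage in the definition of the bad set has the measure of the thin set
  itself. The condition on \<open>k\<close> limits the number of walls to \<open>O(2\<^sup>n)\<close>, which the thickness \<open>4\<^sup>-\<^sup>n\<close> beats.
\<close>

lemma measure_bad_set_le:
  assumes k: "\<And>i. k i \<le> n"
  shows "prob (bad_set k n) \<le> bad_bound n"
proof -
  let ?\<delta> = "(1/2::real) ^ (2 * n)"
  have half: "(1/2::real) ^ (2 * n) \<le> (1/2) ^ n" by (intro power_decreasing) auto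
  have S: "prob (near_set S ?\<delta>) \<le> bad_const * bad_rate ^ n"
  proof (rule measure_thin_le[OF near_S_sets])
    have "C * ?\<delta> \<le> C * (1/2) ^ n" using half C_nonneg by (rule mult_left_mono)
    then show "emeasure lborel (near_set S ?\<delta>) \<le> ennreal (C * (1/2) ^ n)"
      using emeasure_near_S[of "2 * n"] by (meson ennreal_leI order_trans)
  qed (auto simp: C_nonneg bad_const_def)
  have G: "prob (near_grid k ?\<delta>) \<le> bad_const * bad_rate ^ n"
  proof (rule measure_thin_le[OF near_grid_sets])
    have e: "real CARD('n) * 2 ^ n * 4 * 3 ^ CARD('n) * ?\<delta> = real CARD('n) * 4 * 3 ^ CARD('n) * (1/2) ^ n"
      unfolding mult_2[of n] power_add by (simp add: power_one_over)
    have "emeasure lborel (near_grid k ?\<delta>) \<le> ennreal (real CARD('n) * 2 ^ n * 4 * 3 ^ CARD('n) * ?\<delta>)"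
      by (rule emeasure_near_grid_le) (use k in auto)
    then show "emeasure lborel (near_grid k ?\<delta>) \<le> ennreal (real CARD('n) * 4 * 3 ^ CARD('n) * (1/2) ^ n)"
      unfolding e .
  qed (auto simp: C_nonneg bad_const_def)
  let ?A = "\<Union>j<n. unit_cube \<inter> (T ^^ j) -` near_set S ?\<delta>"
  let ?B = "unit_cube \<inter> (T ^^ n) -` near_grid k ?\<delta>"
  have s: "?A \<in> sets \<mu>" "?B \<in> sets \<mu>"
    by (intro sets.finite_UN Int_vimage_sets near_S_sets near_grid_sets unit_cube_sets; simp)+
  have "prob (bad_set k n) \<le> prob (?A \<union> ?B) + prob (near_grid k ?\<delta>)"
    unfolding bad_set_def by (intro measure_Un_le sets.Un s near_grid_sets)
  also have "prob (?A \<union> ?B) \<le> prob ?A + prob ?B" by (intro measure_Un_le s)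
  also have "prob ?A \<le> (\<Sum>j<n. prob (unit_cube \<inter> (T ^^ j) -` near_set S ?\<delta>))"
    by (intro measure_subadditive_finite image_subsetI Int_vimage_sets near_S_sets unit_cube_sets) auto
  also have "\<dots> = real n * prob (near_set S ?\<delta>)" by (simp add: measure_vimage near_S_sets)
  also have "\<dots> \<le> real n * (bad_const * bad_rate ^ n)" using S by (intro mult_left_mono) auto
  also have "prob ?B = prob (near_grid k ?\<delta>)" by (rule measure_vimage[OF near_grid_sets])
  finally show ?thesis using G unfolding bad_bound_def by (simp add: algebra_simps)
qed

lemma summable_bad_bound: "summable bad_bound"
proof -
  have "bad_bound = (\<lambda>n. bad_const * (real n * bad_rate ^ n) + 2 * bad_const * bad_rate ^ n)"
    by (auto simp: bad_bound_def algebra_simps)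
  then show ?thesis
    using bad_rate by (auto intro!: summable_add summable_mult summable_nat_times_power summable_geometric)
qed

lemma bad_bound_nonneg: "0 \<le> bad_bound n"
  unfolding bad_bound_def using bad_const_nonneg bad_rate by simp

definition light_tiles :: "real \<Rightarrow> ('n \<Rightarrow> nat) \<Rightarrow> ('n \<Rightarrow> int) set \<Rightarrow> bool" where
  "light_tiles K k J \<longleftrightarrow> finite J \<and> (\<forall>z\<in>J. prob (tile k z) \<le> K * tile_volume k)"

text \<open>
  The two correlation bounds in one formula. The error sequence \<open>w\<close> serves all levels and all
  families of light tiles at once, which is why it is obtained first.
\<close>

lemma self_return_pair:
  obtains w :: "nat \<Rightarrow> real" where "\<And>m. 0 \<le> w m" "summable (\<lambda>m. real m * w m)"
    "\<forall>k J n k' J' m K. 1 \<le> n \<longrightarrow> n < m \<longrightarrow> 0 \<le> K \<longrightarrow> (\<forall>i. k i \<le> n) \<longrightarrow> light_tiles K k J \<longrightarrow> light_tiles K k' J'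
     \<longrightarrow> prob (self_return k J n \<inter> self_return k' J' m)
       \<le> K\<^sup>2 * tile_volume k * tile_volume k'
         + tile_volume k' * (K * (mixing_err n + bad_bound n) + K * (mixing_err (m - n) + bad_bound (m - n))) + w m"
proof -
  \<comment> \<open>Away from the bad set, cubes of side \<open>2\<^sup>-\<^sup>(\<^sup>a\<^sup>+\<^sup>2\<^sup>)\<^sup>n\<close> have images of diameter at most \<open>4\<^sup>-\<^sup>n\<close> at time \<open>n\<close>, and \<open>p\<close> is so large that
    their number is at most \<open>e\<^sup>\<tau>\<^sup>m\<^sup>/\<^sup>2\<close> up to a constant when \<open>m \<ge> p n\<close>.\<close>
  obtain a :: nat where a: "real CARD('n) * \<Lambda> \<le> 2 ^ a"
    using real_arch_pow[of 2 "real CARD('n) * \<Lambda>"] by (auto intro: less_imp_le)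
  obtain p :: nat where p: "2 / \<tau> * (real (a + 2) * real CARD('n) * ln 2) < real p"
    using reals_Archimedean2 by blast
  have "0 < p"
  proof (rule ccontr)
    assume "\<not> 0 < p"
    then have "2 / \<tau> * (real (a + 2) * real CARD('n) * ln 2) < 0" using p by simp
    moreover have "0 \<le> 2 / \<tau> * (real (a + 2) * real CARD('n) * ln 2)" using tau_pos by simp
    ultimately show False by simp
  qed
  define w where "w m = 2 ^ CARD('n) * c * exp (- \<tau> / 2) ^ m + c * exp (- \<tau> / real p) ^ m" for m
  show ?thesis
  proof (rule that[of w])
    show "0 \<le> w m" for m using c_pos by (simp add: w_def)
    have "(\<lambda>m. real m * w m) = (\<lambda>m. 2 ^ CARD('n) * c * (real m * exp (- \<tau> / 2) ^ m) + c * (real m * exp (- \<tau> / real p) ^ m))"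
      by (auto simp: w_def algebra_simps)
    then show "summable (\<lambda>m. real m * w m)"
      using tau_pos \<open>0 < p\<close> by (auto intro!: summable_add summable_mult summable_nat_times_power)
  next
    show "\<forall>k J n k' J' m K. 1 \<le> n \<longrightarrow> n < m \<longrightarrow> 0 \<le> K \<longrightarrow> (\<forall>i. k i \<le> n) \<longrightarrow> light_tiles K k J \<longrightarrow> light_tiles K k' J'
     \<longrightarrow> prob (self_return k J n \<inter> self_return k' J' m)
       \<le> K\<^sup>2 * tile_volume k * tile_volume k'
         + tile_volume k' * (K * (mixing_err n + bad_bound n) + K * (mixing_err (m - n) + bad_bound (m - n))) + w m"
    proof (intro allI impI)
      fix k J n k' J' m and K :: real
      assume n: "1 \<le> n" "n < m" and K: "0 \<le> K" and k': "\<forall>i. k i \<le> n"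
        and light: "light_tiles K k J" "light_tiles K k' J'"
      have k: "k i \<le> n" for i using k' by simp
      have J: "finite J" and J': "finite J'"
        and JK: "\<And>z. z \<in> J \<Longrightarrow> prob (tile k z) \<le> K * tile_volume k"
        and JK': "\<And>z. z \<in> J' \<Longrightarrow> prob (tile k' z) \<le> K * tile_volume k'"
        using light by (auto simp: light_tiles_def)
      let ?P = "prob (self_return k J n \<inter> self_return k' J' m)"
      let ?v = "tile_volume k" and ?v' = "tile_volume k'"
      have pos: "0 < ?v" "0 < ?v'" "0 \<le> bad_bound n" "0 \<le> bad_bound (m - n)" "0 < mixing_err n" "0 < mixing_err (m - n)"
        by (auto simp: tile_volume_pos bad_bound_nonneg mixing_err_pos)
      show "?P \<le> K\<^sup>2 * ?v * ?v' + ?v' * (K * (mixing_err n + bad_bound n) + K * (mixing_err (m - n) + bad_bound (m - n))) + w m"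
      proof (cases "n * p \<le> m")
        case True
        define N where "N = (a + 2) * n"
        have "\<Lambda> ^ n * (real CARD('n) * (1/2) ^ N) \<le> (1/2) ^ (2 * n)"
        proof -
          have "real CARD('n) \<le> real CARD('n) ^ n"
            using n by (intro self_le_power) auto
          then have "\<Lambda> ^ n * real CARD('n) \<le> \<Lambda> ^ n * real CARD('n) ^ n"
            using Lambda_ge_1 by (intro mult_left_mono) auto
          also have "\<dots> = (real CARD('n) * \<Lambda>) ^ n" by (simp add: power_mult_distrib mult.commute)
          also have "\<dots> \<le> (2 ^ a) ^ n" using a Lambda_ge_1 by (intro power_mono) auto
          finally have "\<Lambda> ^ n * real CARD('n) * (1/2) ^ N \<le> (2 ^ a) ^ n * (1/2) ^ N"
            by (intro mult_right_mono) auto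
          also have "\<dots> = (1/2) ^ (2 * n)"
            by (simp add: N_def power_one_over power_mult[symmetric] power_add[symmetric] field_simps)
          finally show ?thesis by (simp add: mult.assoc)
        qed
        then have "?P \<le> K * ?v' * (prob (self_return k J n) + prob (bad_set k n))
            + 2 ^ CARD('n) * 2 ^ (N * CARD('n)) * mixing_err m"
          using self_return_stable by (intro self_return_pair_near J J' JK' K bad_set_sets) blast+
        also have "\<dots> \<le> K * ?v' * ((K * ?v + mixing_err n) + bad_bound n) + 2 ^ CARD('n) * (c * exp (- \<tau> / 2) ^ m)"
        proof (intro add_mono mult_left_mono measure_self_return_upper measure_bad_set_le J JK K k)
          have "real n * real p \<le> real m" using True by (metis of_nat_le_iff of_nat_mult)
          have "real (N * CARD('n)) * ln 2 = real n * (real (a + 2) * real CARD('n) * ln 2)"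
            by (simp add: N_def algebra_simps)
          also have "\<dots> \<le> real n * (\<tau> / 2 * real p)"
            using p tau_pos by (intro mult_left_mono) (auto simp: field_simps)
          also have "\<dots> = \<tau> / 2 * (real n * real p)" by simp
          also have "\<dots> \<le> \<tau> / 2 * real m" using \<open>real n * real p \<le> real m\<close> tau_pos by (intro mult_left_mono) auto
          finally have e: "real (N * CARD('n)) * ln 2 \<le> \<tau> / 2 * real m" .
          have "(2::real) ^ (N * CARD('n)) = exp (real (N * CARD('n)) * ln 2)"
            by (subst exp_of_nat_mult) simp
          also have "\<dots> \<le> exp (\<tau> / 2 * real m)" using e by simp
          finally have "2 ^ (N * CARD('n)) * mixing_err m \<le> exp (\<tau> / 2 * real m) * mixing_err m"
            using mixing_err_pos[of m] by (intro mult_right_mono) auto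
          also have "\<dots> = c * exp (- \<tau> / 2) ^ m"
            by (simp add: mixing_err_def exp_of_nat_mult[symmetric] exp_add[symmetric] algebra_simps)
          finally show "2 ^ CARD('n) * 2 ^ (N * CARD('n)) * mixing_err m \<le> 2 ^ CARD('n) * (c * exp (- \<tau> / 2) ^ m)"
            by (simp add: mult.assoc)
        qed (use K pos in auto)
        also have "\<dots> \<le> K\<^sup>2 * ?v * ?v' + ?v' * (K * (mixing_err n + bad_bound n) + K * (mixing_err (m - n) + bad_bound (m - n))) + w m"
        proof -
          have "0 \<le> ?v' * (K * (mixing_err (m - n) + bad_bound (m - n)))" using K pos by simp
          moreover have "0 \<le> c * exp (- \<tau> / real p) ^ m" using c_pos by simp
          ultimately show ?thesis by (simp add: w_def power2_eq_square algebra_simps)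
        qed
        finally show ?thesis .
      next
        case False
        have "?P \<le> (K * ?v + mixing_err (m - n)) * (K * ?v') + mixing_err n"
          by (intro self_return_pair_far n J J' JK JK' K)
        also have "mixing_err n \<le> w m"
        proof -
          have "real m \<le> real n * real p" using False by (metis linear of_nat_le_iff of_nat_mult)
          then have "- \<tau> * real n \<le> real m * (- \<tau> / real p)"
            using \<open>0 < p\<close> tau_pos by (simp add: field_simps)
          then have "mixing_err n \<le> c * exp (- \<tau> / real p) ^ m"
            using c_pos unfolding mixing_err_def exp_of_nat_mult[symmetric] by (intro mult_left_mono) auto
          moreover have "0 \<le> 2 ^ CARD('n) * c * exp (- \<tau> / 2) ^ m" using c_pos by simp
          ultimately show ?thesis by (simp add: w_def)
        qed
        finally have "?P \<le> (K * ?v + mixing_err (m - n)) * (K * ?v') + w m" by simp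
        moreover have "0 \<le> ?v' * (K * (mixing_err n + bad_bound n) + K * bad_bound (m - n))" using K pos by simp
        ultimately show ?thesis by (simp add: power2_eq_square algebra_simps)
      qed
    qed
  qed
qed

end

section \<open>Divergent volume sums\<close>

context cube_density
begin

text \<open>
  At a single level the tiles with mass above \<open>K\<close> times their volume have total volume at most
  \<open>1 / K\<close>, and truncation bounds their mass. The constant \<open>K\<close> is the same for all levels.
\<close>

lemma measure_heavy_tiles_small:
  assumes "0 < e"
  obtains K where "0 < K"
    "\<And>k. (\<Sum>z\<in>{z \<in> tile_indices k. K * tile_volume k < prob (tile k z)}. prob (tile k z)) \<le> e"
proof -
  have "((\<lambda>t. t powr (1 - q) * powr_integral) \<longlongrightarrow> 0 * powr_integral) at_top"
    using q_gt_1 by (intro tendsto_mult_right tendsto_neg_powr filterlim_ident) auto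
  then have "\<forall>\<^sub>F t in at_top. t powr (1 - q) * powr_integral < e / 2"
    using assms by (intro order_tendstoD) auto
  then obtain t where t: "0 < t" "t powr (1 - q) * powr_integral < e / 2"
    using eventually_happens[OF eventually_conj[OF eventually_gt_at_top[of 0]]] trivial_limit_at_top_linorder by blast
  define K where "K = 2 * t / e"
  have K: "0 < K" using t assms by (simp add: K_def)
  show ?thesis
  proof (rule that[OF K])
    fix k :: "'n \<Rightarrow> nat"
    let ?Z = "{z \<in> tile_indices k. K * tile_volume k < prob (tile k z)}"
    let ?B = "\<Union>z\<in>?Z. tile k z"
    have fin: "finite ?Z" by simp
    have B: "?B \<in> sets \<mu>" by (intro sets.finite_UN) auto
    have eq: "(\<Sum>z\<in>?Z. prob (tile k z)) = prob ?B"
      by (rule finite_measure_finite_Union[symmetric]) (auto simp: disjoint_family_tile)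
    have "real (card ?Z) * (K * tile_volume k) \<le> (\<Sum>z\<in>?Z. prob (tile k z))"
      using sum_mono[of ?Z "\<lambda>_. K * tile_volume k" "\<lambda>z. prob (tile k z)"] by simp
    also have "\<dots> \<le> 1" unfolding eq by simp
    finally have card: "real (card ?Z) * tile_volume k \<le> 1 / K" using K by (simp add: field_simps)
    have "emeasure lborel ?B \<le> (\<Sum>z\<in>?Z. emeasure lborel (tile k z))"
      by (intro emeasure_subadditive_finite) (auto simp: tile_borel)
    also have "\<dots> \<le> (\<Sum>z\<in>?Z. ennreal (tile_volume k))" by (intro sum_mono emeasure_tile_le)
    also have "\<dots> = ennreal (real (card ?Z) * tile_volume k)"
      using tile_volume_pos[of k] by (simp add: ennreal_mult ennreal_of_nat_eq_real_of_nat less_imp_le)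
    also have "\<dots> \<le> ennreal (1 / K)" using card by (rule ennreal_leI)
    finally have "prob ?B \<le> t * (1 / K) + t powr (1 - q) * powr_integral"
      using K t by (intro measure_le_truncation B) auto
    also have "t * (1 / K) = e / 2" using t assms by (simp add: K_def)
    finally show "(\<Sum>z\<in>?Z. prob (tile k z)) \<le> e" unfolding eq using t by simp
  qed
qed

end

lemma tile_subset_coarser:
  assumes "\<And>i. k i \<le> m i"
  shows "tile m (tile_index m x) \<subseteq> tile k (tile_index k x)"
proof
  fix y assume "y \<in> tile m (tile_index m x)"
  then have y: "y \<in> unit_cube" "tile_index m y = tile_index m x" by (auto simp: mem_tile_iff)
  have "tile_index k y = tile_index k x"
    using tile_index_coarsen[of k _ m x] tile_index_coarsen[of k _ m y] assms y by (auto simp: fun_eq_iff)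
  then show "y \<in> tile k (tile_index k x)" using y by (simp add: mem_tile_iff)
qed

lemma same_tile_imp_close:
  assumes "x \<in> tile k z" "y \<in> tile k z"
  shows "\<bar>y $ i - x $ i\<bar> < (1/2) ^ k i"
proof -
  have "of_int (z i) / 2 ^ k i \<le> x $ i" "x $ i < (of_int (z i) + 1) / 2 ^ k i"
    "of_int (z i) / 2 ^ k i \<le> y $ i" "y $ i < (of_int (z i) + 1) / 2 ^ k i"
    using assms by (auto simp: tile_eq_half_open_box half_open_box_def)
  then show ?thesis by (auto simp: add_divide_distrib power_one_over abs_less_iff)
qed

context piecewise_lipschitz_mixing_cube
begin

text \<open>
  The constants are chosen in the order \<open>K\<close>, \<open>p\<close>, \<open>V\<close>: the lower bound \<open>p\<close> for the measure of the limsup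
  depends only on \<open>\<mu>(W)\<close>, and \<open>V\<close> is an approximation of \<open>W\<close> with an error below \<open>p\<close>.
\<close>

theorem recurrence_set_full:
  assumes nonneg: "\<And>n i. n \<ge> 1 \<Longrightarrow> 0 \<le> r n $ i"
    and lim: "(\<lambda>n. infnorm (r n :: real^'n)) \<longlonglongrightarrow> 0"
    and div: "\<not> summable (\<lambda>n. \<Prod>i\<in>UNIV. r (Suc n) $ i)"
  shows "prob (recurrence_set T r) = 1"
proof (rule ccontr)
  let ?R = "recurrence_set T r"
  assume "prob ?R \<noteq> 1"
  define W where "W = unit_cube - ?R"
  have W: "W \<in> sets \<mu>" unfolding W_def by (intro sets.Diff unit_cube_sets recurrence_set_sets)
  define w where "w = prob W"
  have "prob W = 1 - prob ?R"
    using prob_compl[OF recurrence_set_sets[of r]] by (simp add: W_def)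
  moreover have "prob ?R < 1" using \<open>prob ?R \<noteq> 1\<close> by (simp add: less_le)
  ultimately have w: "0 < w" by (simp add: w_def)
  obtain K where K: "0 < K"
    "\<And>k. (\<Sum>z\<in>{z \<in> tile_indices k. K * tile_volume k < prob (tile k z)}. prob (tile k z)) \<le> w / 4"
    using measure_heavy_tiles_small[of "w / 4"] w by auto
  define a where "a = (w / 2)\<^sup>2 / 2 ^ CARD('n)"
  define p where "p = a\<^sup>2 / (2 * K\<^sup>2)"
  have a: "0 < a" using w by (simp add: a_def)
  have p: "0 < p" using a K by (simp add: p_def)
  obtain N1 Z where Z: "Z \<subseteq> tile_indices (\<lambda>_. N1)"
    and V1: "prob (W - (\<Union>z\<in>Z. tile (\<lambda>_. N1) z)) < min (w / 4) p"
    and V2: "prob ((\<Union>z\<in>Z. tile (\<lambda>_. N1) z) - W) < min (w / 4) p"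
    by (rule tile_approximation[OF W, of "min (w / 4) p"]) (use w p in simp)
  define V where "V = (\<Union>z\<in>Z. tile (\<lambda>_. N1) z)"
  have "finite Z" using Z finite_subset finite_tile_indices by blast
  then have V: "V \<in> sets \<mu>" unfolding V_def by (intro sets.finite_UN) auto
  have wV: "3 * w / 4 \<le> prob V"
  proof -
    have "prob W \<le> prob (V \<union> (W - V))" using V W by (intro finite_measure_mono) auto
    also have "\<dots> \<le> prob V + prob (W - V)" using V W by (intro measure_Un_le) auto
    finally show ?thesis using V1 by (simp add: V_def w_def)
  qed
  define k where "k n i = (SOME k::nat. (1/2) ^ k \<le> r n $ i \<and> r n $ i < 2 * (1/2) ^ k)" for n i
  obtain n0 where n0: "\<And>n i. n \<ge> n0 \<Longrightarrow> r n $ i < (1/2) ^ N1"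
    using eventually_component_less[OF lim, of "(1/2) ^ N1"] by (auto simp: eventually_sequentially)
  have k: "(1/2) ^ k n i \<le> r n $ i" "r n $ i < 2 * (1/2) ^ k n i" if "n \<ge> n0" "0 < r n $ i" for n i
  proof -
    have "r n $ i < 1" using n0[OF that(1), of i] power_le_one[of "1/2::real" N1] by simp
    then have "\<exists>k::nat. (1/2) ^ k \<le> r n $ i \<and> r n $ i < 2 * (1/2) ^ k"
      using that by (intro dyadic_level_exists) auto
    then have "(1/2) ^ k n i \<le> r n $ i \<and> r n $ i < 2 * (1/2) ^ k n i"
      unfolding k_def by (rule someI_ex)
    then show "(1/2) ^ k n i \<le> r n $ i" "r n $ i < 2 * (1/2) ^ k n i" by auto
  qed
  \<comment> \<open>The times with \<open>v\<^sub>n < 2\<^sup>-\<^sup>n\<close> contribute a convergent series and are dropped. For the other times all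
    levels are at most \<open>n\<close>, as the estimate of the bad set requires.\<close>
  define I where "I = {n. n \<ge> n0 \<and> n \<ge> 1 \<and> (\<forall>i. 0 < r n $ i) \<and> (1/2) ^ n \<le> tile_volume (k n)}"
  define J where "J n = {z \<in> tile_indices (k n). tile (k n) z \<subseteq> V \<and> prob (tile (k n) z) \<le> K * tile_volume (k n)}" for n
  define A where "A n = (if n \<in> I then self_return (k n) (J n) n else {})" for n
  define v where "v n = (if n \<in> I then tile_volume (k n) else 0)" for n
  have finJ: "finite (J n)" for n by (simp add: J_def)
  have JK: "prob (tile (k n) z) \<le> K * tile_volume (k n)" if "z \<in> J n" for n z
    using that by (simp add: J_def)
  have A_sets: "A n \<in> sets \<mu>" for n by (simp add: A_def self_return_sets finJ)
  have kn: "k n i \<le> n" if "n \<in> I" for n i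
  proof -
    have "(1/2::real) ^ n \<le> tile_volume (k n)" using that by (simp add: I_def)
    also have "\<dots> \<le> (1/2) ^ k n i" by (rule tile_volume_le)
    finally show ?thesis by (subst (asm) power_decreasing_iff) auto
  qed
  have v_div: "\<not> summable v"
  proof
    assume "summable v"
    then have "summable (\<lambda>n. 2 ^ CARD('n) * (v n + (1/2) ^ n))"
      by (intro summable_mult summable_add summable_geometric) auto
    moreover have "norm (\<Prod>i\<in>UNIV. r n $ i) \<le> 2 ^ CARD('n) * (v n + (1/2) ^ n)" if n: "n \<ge> max n0 1" for n
    proof (cases "\<forall>i. 0 < r n $ i")
      case True
      have "(\<Prod>i\<in>UNIV. r n $ i) \<le> (\<Prod>i\<in>UNIV. 2 * (1/2) ^ k n i)"
        using k[of n] True n by (intro prod_mono) (auto simp: less_imp_le)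
      also have "\<dots> = 2 ^ CARD('n) * tile_volume (k n)"
        unfolding tile_volume_def prod.distrib by simp
      also have "\<dots> \<le> 2 ^ CARD('n) * (v n + (1/2) ^ n)"
        using True n by (intro mult_left_mono) (auto simp: v_def I_def)
      finally show ?thesis using True by (simp add: abs_of_nonneg prod_nonneg less_imp_le)
    next
      case False
      then have "\<exists>i. r n $ i = 0" using nonneg[of n] n by (metis le_max_iff_disj less_eq_real_def max.boundedE)
      then have prod_0: "(\<Prod>i\<in>UNIV. r n $ i) = 0" by (intro prod_zero) auto
      have "0 \<le> v n" using tile_volume_pos[of "k n"] by (simp add: v_def)
      then show ?thesis unfolding prod_0 by simp
    qed
    ultimately have "summable (\<lambda>n. \<Prod>i\<in>UNIV. r n $ i)"
      by (rule summable_comparison_test')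
    then show False using div summable_Suc_iff[of "\<lambda>n. \<Prod>i\<in>UNIV. r n $ i"] by simp
  qed
  have sumJ: "w / 2 \<le> (\<Sum>z\<in>J n. prob (tile (k n) z))" if n: "n \<in> I" for n
  proof -
    let ?V = "{z \<in> tile_indices (k n). tile (k n) z \<subseteq> V}"
    let ?H = "{z \<in> tile_indices (k n). K * tile_volume (k n) < prob (tile (k n) z)}"
    \<comment> \<open>By the choice of \<open>n0\<close> the tiles at time \<open>n\<close> are finer than those forming \<open>V\<close>.\<close>
    have "V \<subseteq> (\<Union>z\<in>?V. tile (k n) z)"
    proof
      fix x assume x: "x \<in> V"
      have xc: "x \<in> unit_cube" using x V by (auto simp: sets_mu_iff)
      have "N1 \<le> k n i" for i
      proof -
        have "n \<ge> n0" "0 < r n $ i" using n by (auto simp: I_def)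
        then have "(1/2::real) ^ k n i < (1/2) ^ N1" using k(1) n0 by (meson le_less_trans)
        then show ?thesis by (subst (asm) power_strict_decreasing_iff) auto
      qed
      then have "tile (k n) (tile_index (k n) x) \<subseteq> tile (\<lambda>_. N1) (tile_index (\<lambda>_. N1) x)"
        by (intro tile_subset_coarser)
      also have "\<dots> \<subseteq> V" using x by (auto simp: V_def mem_tile_iff)
      finally have "tile_index (k n) x \<in> ?V" using tile_index_in_indices[OF xc] by simp
      then show "x \<in> (\<Union>z\<in>?V. tile (k n) z)" using xc by (intro UN_I) (auto simp: mem_tile_iff)
    qed
    then have "prob V \<le> prob (\<Union>z\<in>?V. tile (k n) z)"
      by (intro finite_measure_mono sets.finite_UN) auto
    also have "\<dots> \<le> (\<Sum>z\<in>?V. prob (tile (k n) z))"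
      by (intro finite_measure_subadditive_finite) auto
    also have "\<dots> \<le> (\<Sum>z\<in>J n \<union> ?H. prob (tile (k n) z))"
      by (intro sum_mono2) (auto simp: J_def)
    also have "\<dots> \<le> (\<Sum>z\<in>J n. prob (tile (k n) z)) + (\<Sum>z\<in>?H. prob (tile (k n) z))"
      by (subst sum.union_disjoint) (auto simp: J_def)
    also have "\<dots> \<le> (\<Sum>z\<in>J n. prob (tile (k n) z)) + w / 4" using K(2)[of "k n"] by simp
    finally show ?thesis using wV by simp
  qed
  obtain s :: "nat \<Rightarrow> real" where s: "\<And>m. 0 \<le> s m" "summable (\<lambda>m. real m * s m)"
    and pair: "\<forall>k J n k' J' m K. 1 \<le> n \<longrightarrow> n < m \<longrightarrow> 0 \<le> K \<longrightarrow> (\<forall>i. k i \<le> n) \<longrightarrow> light_tiles K k J \<longrightarrow> light_tiles K k' J'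
     \<longrightarrow> prob (self_return k J n \<inter> self_return k' J' m)
       \<le> K\<^sup>2 * tile_volume k * tile_volume k'
         + tile_volume k' * (K * (mixing_err n + bad_bound n) + K * (mixing_err (m - n) + bad_bound (m - n))) + s m"
    by (rule self_return_pair) (rule that)
  have light: "light_tiles K (k n) (J n)" for n
    using finJ JK by (simp add: light_tiles_def)
  have "p \<le> prob (\<Inter>N. \<Union>n\<in>{N..}. A n)"
    unfolding p_def
  proof (rule limsup_second_moment[where v=v and u=mixing_err and s="\<lambda>n. K * (mixing_err n + bad_bound n)" and w=s])
    show "0 \<le> v n" for n using tile_volume_pos[of "k n"] by (simp add: v_def)
    show "summable (\<lambda>n. K * (mixing_err n + bad_bound n))"
      by (intro summable_mult summable_add summable_mixing_err summable_bad_bound)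
    show "0 \<le> K * (mixing_err n + bad_bound n)" for n using K mixing_err_pos[of n] bad_bound_nonneg[of n] by simp
    show "0 \<le> mixing_err n" for n using mixing_err_pos[of n] by simp
    show "a * v n - mixing_err n \<le> prob (A n)" for n
    proof (cases "n \<in> I")
      case True
      then show ?thesis
        using measure_self_return_lower[of "J n" "k n" "w / 2" n] sumJ[OF True] w by (auto simp: A_def v_def a_def J_def)
    next
      case False
      then show ?thesis using mixing_err_pos[of n] by (simp add: v_def A_def)
    qed
    show "prob (A n) \<le> K * v n + mixing_err n" for n
    proof (cases "n \<in> I")
      case True
      have "prob (self_return (k n) (J n) n) \<le> K * tile_volume (k n) + mixing_err n"
        using K by (intro measure_self_return_upper finJ JK) auto
      then show ?thesis using True by (simp add: A_def v_def)
    next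
      case False
      then show ?thesis using mixing_err_pos[of n] by (simp add: v_def A_def)
    qed
    fix n m :: nat assume nm: "n < m"
    let ?rhs = "K\<^sup>2 * v n * v m + v m * (K * (mixing_err n + bad_bound n) + K * (mixing_err (m - n) + bad_bound (m - n))) + s m"
    show "prob (A n \<inter> A m) \<le> ?rhs"
    proof (cases "n \<in> I \<and> m \<in> I")
      case True
      then have "1 \<le> n" by (simp add: I_def)
      have "prob (self_return (k n) (J n) n \<inter> self_return (k m) (J m) m)
       \<le> K\<^sup>2 * tile_volume (k n) * tile_volume (k m)
         + tile_volume (k m) * (K * (mixing_err n + bad_bound n) + K * (mixing_err (m - n) + bad_bound (m - n))) + s m"
        using \<open>1 \<le> n\<close> nm K(1) True by (intro pair[rule_format] light kn) auto
      then show ?thesis using True by (simp add: A_def v_def)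
    next
      case False
      then have "A n \<inter> A m = {}" by (auto simp: A_def)
      moreover have "0 \<le> ?rhs"
        using K mixing_err_pos[of n] bad_bound_nonneg[of n] mixing_err_pos[of "m - n"] bad_bound_nonneg[of "m - n"] s(1)[of m]
          tile_volume_pos[of "k n"] tile_volume_pos[of "k m"]
        by (auto simp: v_def intro!: add_nonneg_nonneg mult_nonneg_nonneg)
      ultimately show ?thesis by simp
    qed
  qed (use A_sets v_div summable_mixing_err s a K in auto)
  also have "\<dots> \<le> prob (V - W)"
  proof (rule finite_measure_mono)
    show "V - W \<in> sets \<mu>" using V W by auto
    have An: "x \<in> V \<and> (T ^^ n) x \<in> open_rectangle x (r n)" if xA: "x \<in> A n" for x n
    proof -
      have n: "n \<in> I" using xA by (auto simp: A_def split: if_splits)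
      then obtain z where z: "z \<in> J n" "x \<in> tile (k n) z" "(T ^^ n) x \<in> tile (k n) z"
        using xA by (auto simp: A_def self_return_def)
      have "\<bar>(T ^^ n) x $ i - x $ i\<bar> < r n $ i" for i
        using same_tile_imp_close[OF z(2,3), of i] k(1)[of n i] n by (auto simp: I_def)
      then show ?thesis using z by (auto simp: J_def open_rectangle_def)
    qed
    show "(\<Inter>N. \<Union>n\<in>{N..}. A n) \<subseteq> V - W"
    proof
      fix x assume x: "x \<in> (\<Inter>N. \<Union>n\<in>{N..}. A n)"
      then have xV: "x \<in> V" using An by blast
      then have "x \<in> unit_cube" using V by (auto simp: sets_mu_iff)
      then have "x \<in> ?R" unfolding recurrence_set_def using x An by blast
      then show "x \<in> V - W" using xV by (simp add: W_def)
    qed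
  qed
  also have "\<dots> < p" using V2 by (simp add: V_def)
  finally show False by simp
qed

end

theorem theorem1p3:
  fixes T :: "real^'n::finite \<Rightarrow> real^'n"
    and \<mu> :: "(real^'n) measure"
    and h :: "real^'n \<Rightarrow> real"
    and q :: real
    and r :: "nat \<Rightarrow> real^'n"
  assumes "piecewise_expanding T"
    and "sets \<mu> = sets (restrict_space borel unit_cube)"
    and "prob_space \<mu>"
    and "invariant_measure T \<mu>"
    and "absolutely_continuous cube_lebesgue \<mu>"
    and "exponential_mixing T \<mu>"
    and "h \<in> borel_measurable cube_lebesgue"
    and "\<And>x. x \<in> unit_cube \<Longrightarrow> 0 \<le> h x"
    and "\<mu> = density cube_lebesgue (\<lambda>x. ennreal (h x))"
    and "q > 1"
    and "integrable cube_lebesgue (\<lambda>x. h x powr q)"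
    and "\<And>n i. n \<ge> 1 \<Longrightarrow> 0 \<le> r n $ i"
    and "(\<lambda>n. infnorm (r n)) \<longlonglongrightarrow> 0"
  shows "measure \<mu> (recurrence_set T r) =
    (if summable (\<lambda>n. \<Prod>i\<in>UNIV. r (Suc n) $ i) then 0 else 1)"
proof -
  obtain c \<tau> where c: "c > 0" "\<tau> > 0"
    and mix: "\<And>a b a' b' n. \<bar>measure \<mu> (half_open_box a b \<inter> (T ^^ n) -` half_open_box a' b')
        - measure \<mu> (half_open_box a b) * measure \<mu> (half_open_box a' b')\<bar>
      \<le> c * measure \<mu> (half_open_box a' b') * exp (- \<tau> * real n)"
    using exponential_mixing_half_open_box[OF assms(6,2)] by metis
  obtain S \<Lambda> C where S: "compact S" "1 \<le> \<Lambda>" "0 \<le> C"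
    "\<And>N. emeasure lborel (near_set S ((1/2) ^ N)) \<le> ennreal (C * (1/2) ^ N)"
    "\<And>x y. x \<in> unit_cube \<Longrightarrow> y \<in> unit_cube \<Longrightarrow> x \<notin> near_set S (dist x y) \<Longrightarrow> dist (T x) (T y) \<le> \<Lambda> * dist x y"
    using piecewise_expanding_lipschitz_off_hypersurface[OF assms(1)] by metis
  interpret prob_space \<mu> by (rule assms(3))
  interpret piecewise_lipschitz_mixing_cube \<mu> h q T c \<tau> S \<Lambda> C
    by unfold_locales
      (use assms(4,7-11) c mix S in \<open>auto simp: invariant_measure_def\<close>)
  show ?thesis
    using recurrence_set_null[OF assms(12,13)] recurrence_set_full[OF assms(12,13)] by simp
qed

end
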